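(* Let $\mathfrak g=\mathfrak s\oplus\mathfrak z\oplus\mathfrak u$, $\mathfrak u=\bigoplus_{\ell=1}^mP_\ell$, be a nondegenerate flat metric Lie algebra, let $G$ be the simply connected Lie group with Lie algebra $\mathfrak g$, and let $S=\exp(\mathfrak s)$, $N=\exp(\mathfrak z\oplus\mathfrak u)$, so that $G\cong S\ltimes N$. Let $R:\mathfrak g\to\wedge^2\mathfrak g$ be a normalized $1$-cocycle. Then the unique group $1$-cocycle $\Pi_R:G\to\wedge^2\mathfrak g$ integrating $R$ is determined by its restrictions to $S$ and $N$, and: (1) for $s\in S$, $\Pi_R(s)=R(\log s)$; (2) for $n=\exp(u)\in N$ with $u\in\mathfrak z\oplus\mathfrak u$, $\Pi_R(\exp u)=R(u)+\frac12[u,R(u)]$. For a general element $g=sn$ with $s\in S$ and $n=\exp u\in N$, $$\Pi_R(sn)=R(\log s)+\mathrm{Ad}_s\Big(R(u)+\tfrac12[u,R(u)]\Big).$$ If $\xi=\mathrm{ad}\,r+R$ ($r\in\wedge^2\mathfrak g$) is a Lie bialgebra structure on $\mathfrak g$, the corresponding multiplicative Poisson tensor on $G$ is $\pi=\pi_r+\pi_R$, where $\pi_r=r^L-r^R$ and $\pi_R$ is the bivector field corresponding to $\Pi_R$ via right trivialization.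
   Context: All Lie algebras are finite-dimensional and real. A flat metric Lie algebra is a Lie algebra $\mathfrak g$ with an inner product $\langle\cdot,\cdot\rangle$ such that the left-invariant Riemannian metric it induces on the simply connected Lie group of $\mathfrak g$ has zero curvature. By Milnor's theorem there is an orthogonal decomposition $\mathfrak g=\mathfrak s\oplus\mathfrak z\oplus\mathfrak u$, where $\mathfrak s$ is an abelian subalgebra, $\mathfrak z$ is the center of $\mathfrak g$, $\mathfrak u=[\mathfrak g,\mathfrak g]$ is an even-dimensional abelian ideal, and the operators $\mathrm{ad}_s|_{\mathfrak u}$ ($s\in\mathfrak s$) are skew-symmetric and commute pairwise. Moreover $\mathfrak u=\bigoplus_{\ell=1}^m P_\ell$ orthogonally, where the $P_\ell$ are $2$-dimensional and $\mathfrak s$-invariant, and there are nonzero weights $\lambda_\ell\in\mathfrak s^*\setminus\{0\}$ and orthogonal complex structures $J_\ell\in \mathrm{SO}(P_\ell)$ with $[s,v]=\lambda_\ell(s)J_\ell v$ for $s\in\mathfrak s$, $v\in P_\ell$. $\mathfrak g$ is called nondegenerate if: (a) $\lambda_i\neq\pm\lambda_j$ for all $i\neq j$; (b) for any pairwise distinct $i,j,k$ there is no relation $\lambda_k=a\lambda_i+b\lambda_j$ with $a,b\in\{-1,0,1\}$. For $x\in\mathfrak g$, $\mathrm{ad}_x=[x,\cdot]$ is extended to $\wedge^k\mathfrak g$ as a derivation, and $\mathrm{Ad}_g$ to $\wedge^k\mathfrak g$ multiplicatively; $(\wedge^2\mathfrak g)^{\mathfrak g}$ is the space of bivectors killed by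 all $\mathrm{ad}_x$. A $1$-cocycle $R:\mathfrak g\to\wedge^2\mathfrak g$ is a linear map with $R([x,y])=\mathrm{ad}_xR(y)-\mathrm{ad}_yR(x)$; it is normalized if $R(\mathfrak s\oplus\mathfrak z)\subset(\wedge^2\mathfrak g)^{\mathfrak g}$ and $R(P_\ell)\subset(\mathfrak s\wedge P_\ell)\oplus(\mathfrak z\wedge P_\ell)$ for each $\ell$. $\mathrm{ad}\,r$ denotes $x\mapsto\mathrm{ad}_xr$. A Lie bialgebra structure on $\mathfrak g$ is a $1$-cocycle $\xi:\mathfrak g\to\wedge^2\mathfrak g$ whose transpose $\wedge^2\mathfrak g^*\to\mathfrak g^*$ is a Lie bracket on $\mathfrak g^*$. A group $1$-cocycle is a smooth map $\Pi:G\to\wedge^2\mathfrak g$ with $\Pi(gh)=\Pi(g)+\mathrm{Ad}_g\Pi(h)$; it integrates $\xi$ if $d_e\Pi=\xi$. Here $\exp:\mathfrak s\to S$ and $\exp:\mathfrak z\oplus\mathfrak u\to N$ are diffeomorphisms onto abelian subgroups, and $\log$ is the inverse of $\exp$ on $S$. Via right trivialization, $\Pi$ corresponds to the bivector field $\pi$ with $\pi(g)=(R_g)_*\Pi(g)$, $R_g$ being right translation by $g$; multiplicative Poisson tensors on $G$ correspond in this way to group $1$-cocycles integrating Lie bialgebra structures. $r^L$ and $r^R$ are the left- and right-invariant bivector fields on $G$ with value $r$ at the identity. *)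

theory Defs
  imports "HOL-Analysis.Analysis" "HOL-Algebra.Coset"
begin

section \<open>Lie algebras and bivectors\<close>

definition lie_algebra :: "('a::real_vector \<Rightarrow> 'a \<Rightarrow> 'a) \<Rightarrow> bool" where
  "lie_algebra br \<longleftrightarrow> bilinear br \<and> (\<forall>x. br x x = 0) \<and>
     (\<forall>x y z. br x (br y z) + br y (br z x) + br z (br x y) = 0)"

text \<open>
  The bivectors over a finite-dimensional space are the alternating bilinear forms on its dual.
  They live in the normed space of all bounded bilinear forms on the dual, so that maps into the
  space of bivectors can be differentiated.
\<close>

type_synonym 'a dual = "'a \<Rightarrow>\<^sub>L real"

type_synonym 'a bilin = "'a dual \<Rightarrow>\<^sub>L 'a dual \<Rightarrow>\<^sub>L real"

definition bivectors :: "'a::euclidean_space bilin set" where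
  "bivectors = {r. \<forall>\<alpha>. blinfun_apply (blinfun_apply r \<alpha>) \<alpha> = 0}"

definition mk_bilin :: "('a::euclidean_space dual \<Rightarrow> 'a dual \<Rightarrow> real) \<Rightarrow> 'a bilin" where
  "mk_bilin b = Blinfun (\<lambda>\<alpha>. Blinfun (b \<alpha>))"

definition wedge :: "'a::euclidean_space \<Rightarrow> 'a \<Rightarrow> 'a bilin" where
  "wedge x y = mk_bilin (\<lambda>\<alpha> \<beta>. blinfun_apply \<alpha> x * blinfun_apply \<beta> y
                             - blinfun_apply \<alpha> y * blinfun_apply \<beta> x)"

definition wedge_space :: "'a::euclidean_space set \<Rightarrow> 'a set \<Rightarrow> 'a bilin set" where
  "wedge_space V W = span {wedge v w |v w. v \<in> V \<and> w \<in> W}"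

definition subspace_sum :: "'v::real_vector set \<Rightarrow> 'v set \<Rightarrow> 'v set" where
  "subspace_sum V W = {v + w |v w. v \<in> V \<and> w \<in> W}"

definition transpose_map :: "('a::euclidean_space \<Rightarrow> 'a) \<Rightarrow> 'a dual \<Rightarrow> 'a dual" where
  "transpose_map A \<alpha> = Blinfun (\<lambda>x. blinfun_apply \<alpha> (A x))"

text \<open>
  The multiplicative extension and the derivation extension of a linear map to bivectors; on
  decomposable bivectors they are computed in \<open>ext_mult_wedge\<close> and \<open>ext_deriv_wedge\<close> below.
\<close>

definition ext_mult :: "('a::euclidean_space \<Rightarrow> 'a) \<Rightarrow> 'a bilin \<Rightarrow> 'a bilin" where
  "ext_mult A r = mk_bilin (\<lambda>\<alpha> \<beta>.
     blinfun_apply (blinfun_apply r (transpose_map A \<alpha>)) (transpose_map A \<beta>))"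

definition ext_deriv :: "('a::euclidean_space \<Rightarrow> 'a) \<Rightarrow> 'a bilin \<Rightarrow> 'a bilin" where
  "ext_deriv A r = mk_bilin (\<lambda>\<alpha> \<beta>.
     blinfun_apply (blinfun_apply r (transpose_map A \<alpha>)) \<beta>
     + blinfun_apply (blinfun_apply r \<alpha>) (transpose_map A \<beta>))"

lemma mk_bilin_apply:
  assumes "bounded_bilinear b"
  shows "blinfun_apply (blinfun_apply (mk_bilin b) \<alpha>) \<beta> = b \<alpha> \<beta>"
proof -
  interpret bounded_bilinear b by fact
  have 1: "blinfun_apply (Blinfun (b \<alpha>)) = b \<alpha>" for \<alpha>
    by (simp add: bounded_linear_Blinfun_apply bounded_linear_right)
  obtain K where K: "\<And>\<alpha> \<beta>. norm (b \<alpha> \<beta>) \<le> norm \<alpha> * norm \<beta> * K" and "0 \<le> K"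
    using nonneg_bounded by blast
  have "bounded_linear (\<lambda>\<alpha>. Blinfun (b \<alpha>))"
  proof (rule bounded_linear_intro[where K = K])
    show "norm (Blinfun (b \<alpha>)) \<le> norm \<alpha> * K" for \<alpha>
    proof (rule norm_blinfun_bound)
      show "norm (blinfun_apply (Blinfun (b \<alpha>)) \<beta>) \<le> norm \<alpha> * K * norm \<beta>" for \<beta>
        using K[of \<alpha> \<beta>] by (simp add: 1 ac_simps)
    qed (simp add: \<open>0 \<le> K\<close>)
  qed (rule blinfun_eqI; simp add: 1 blinfun.add_left blinfun.scaleR_left add_left scaleR_left)+
  then show ?thesis
    by (simp add: mk_bilin_def bounded_linear_Blinfun_apply 1)
qed

lemma bounded_bilinear_bilin:
  "bounded_bilinear (\<lambda>\<alpha> \<beta>. blinfun_apply (blinfun_apply (r :: 'a::euclidean_space bilin) \<alpha>) \<beta>)"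
  by (rule bounded_bilinear.comp1[OF bounded_bilinear_blinfun_apply blinfun.bounded_linear_right])

lemma bounded_bilinear_bilin_add:
  fixes b c :: "'a::euclidean_space dual \<Rightarrow> 'a dual \<Rightarrow> real"
  assumes "bounded_bilinear b" "bounded_bilinear c"
  shows "bounded_bilinear (\<lambda>\<alpha> \<beta>. b \<alpha> \<beta> + c \<alpha> \<beta>)" "bounded_bilinear (\<lambda>\<alpha> \<beta>. b \<alpha> \<beta> - c \<alpha> \<beta>)"
  using bounded_bilinear_bilin[of "mk_bilin b + mk_bilin c"]
    bounded_bilinear_bilin[of "mk_bilin b - mk_bilin c"]
  by (simp_all add: mk_bilin_apply assms blinfun.add_left blinfun.diff_left)

lemma transpose_map_apply:
  assumes "linear A"
  shows "blinfun_apply (transpose_map A \<alpha>) x = blinfun_apply \<alpha> (A x)"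
  unfolding transpose_map_def
  by (subst bounded_linear_Blinfun_apply)
    (use assms in \<open>auto intro!: bounded_linear_compose[OF blinfun.bounded_linear_right]
      simp: linear_conv_bounded_linear\<close>)

lemma bounded_linear_transpose_map:
  assumes "linear A"
  shows "bounded_linear (transpose_map A)"
proof -
  have "transpose_map A = (\<lambda>\<alpha>. \<alpha> o\<^sub>L Blinfun A)"
    using assms
    by (intro ext blinfun_eqI)
      (simp add: transpose_map_apply bounded_linear_Blinfun_apply
        linear_conv_bounded_linear[THEN iffD1])
  then show ?thesis
    by (simp add: bounded_bilinear.bounded_linear_left[OF bounded_bilinear_blinfun_compose])
qed

lemma wedge_apply:
  fixes x y :: "'a::euclidean_space"
  shows "blinfun_apply (blinfun_apply (wedge x y) \<alpha>) \<beta>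
    = blinfun_apply \<alpha> x * blinfun_apply \<beta> y - blinfun_apply \<alpha> y * blinfun_apply \<beta> x"
  unfolding wedge_def
proof (rule mk_bilin_apply)
  have "bounded_bilinear (\<lambda>\<alpha> \<beta>. blinfun_apply (\<alpha>::'a dual) u * blinfun_apply (\<beta>::'a dual) v)" for u v
    by (rule bounded_bilinear.comp[OF bounded_bilinear_mult blinfun.bounded_linear_left
          blinfun.bounded_linear_left])
  from bounded_bilinear_bilin_add(2)[OF this[of x y] this[of y x]]
  show "bounded_bilinear (\<lambda>\<alpha> \<beta>. blinfun_apply (\<alpha>::'a dual) x * blinfun_apply (\<beta>::'a dual) y
      - blinfun_apply \<alpha> y * blinfun_apply \<beta> x)" .
qed

lemma ext_mult_apply:
  assumes "linear A"
  shows "blinfun_apply (blinfun_apply (ext_mult A r) \<alpha>) \<beta>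
    = blinfun_apply (blinfun_apply r (transpose_map A \<alpha>)) (transpose_map A \<beta>)"
  unfolding ext_mult_def
  by (rule mk_bilin_apply, rule bounded_bilinear.comp[OF bounded_bilinear_bilin])
    (intro bounded_linear_transpose_map assms)+

lemma ext_deriv_apply:
  assumes "linear A"
  shows "blinfun_apply (blinfun_apply (ext_deriv A r) \<alpha>) \<beta>
    = blinfun_apply (blinfun_apply r (transpose_map A \<alpha>)) \<beta>
      + blinfun_apply (blinfun_apply r \<alpha>) (transpose_map A \<beta>)"
  unfolding ext_deriv_def
  by (rule mk_bilin_apply, rule bounded_bilinear_bilin_add)
    (intro bounded_bilinear.comp1[OF bounded_bilinear_bilin]
      bounded_bilinear.comp[OF bounded_bilinear_bilin bounded_linear_ident]
      bounded_linear_transpose_map assms)+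

lemma ext_mult_wedge: "linear A \<Longrightarrow> ext_mult A (wedge x y) = wedge (A x) (A y)"
  by (intro blinfun_eqI) (simp add: ext_mult_apply wedge_apply transpose_map_apply)

lemma ext_deriv_wedge:
  "linear A \<Longrightarrow> ext_deriv A (wedge x y) = wedge (A x) y + wedge x (A y)"
  by (intro blinfun_eqI)
    (simp add: ext_deriv_apply wedge_apply transpose_map_apply blinfun.add_left)

lemma wedge_in_bivectors: "wedge x y \<in> bivectors"
  by (simp add: bivectors_def wedge_apply)

abbreviation ad_biv :: "('a::euclidean_space \<Rightarrow> 'a \<Rightarrow> 'a) \<Rightarrow> 'a \<Rightarrow> 'a bilin \<Rightarrow> 'a bilin" where
  "ad_biv br x \<equiv> ext_deriv (br x)"

definition invariant_bivectors :: "('a::euclidean_space \<Rightarrow> 'a \<Rightarrow> 'a) \<Rightarrow> 'a bilin set" where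
  "invariant_bivectors br = {r \<in> bivectors. \<forall>x. ad_biv br x r = 0}"

definition cocycle :: "('a::euclidean_space \<Rightarrow> 'a \<Rightarrow> 'a) \<Rightarrow> ('a \<Rightarrow> 'a bilin) \<Rightarrow> bool" where
  "cocycle br R \<longleftrightarrow> linear R \<and> range R \<subseteq> bivectors \<and>
     (\<forall>x y. R (br x y) = ad_biv br x (R y) - ad_biv br y (R x))"

definition cobracket_transpose ::
    "('a::euclidean_space \<Rightarrow> 'a bilin) \<Rightarrow> 'a dual \<Rightarrow> 'a dual \<Rightarrow> 'a dual" where
  "cobracket_transpose \<xi> \<alpha> \<beta> = Blinfun (\<lambda>x. blinfun_apply (blinfun_apply (\<xi> x) \<alpha>) \<beta>)"

definition lie_bialgebra ::
    "('a::euclidean_space \<Rightarrow> 'a \<Rightarrow> 'a) \<Rightarrow> ('a \<Rightarrow> 'a bilin) \<Rightarrow> bool" where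
  "lie_bialgebra br \<xi> \<longleftrightarrow> cocycle br \<xi> \<and> lie_algebra (cobracket_transpose \<xi>)"


section \<open>Flat metric Lie algebras\<close>

text \<open>
  The metric is the inner product of the ambient Euclidean type. A left-invariant metric makes the
  inner product of two left-invariant vector fields constant, so on left-invariant fields the
  Levi-Civita connection is the unique bilinear \<open>nabla\<close> on the Lie algebra that is torsion-free and
  skew with respect to the inner product, and its curvature tensor is given by the usual formula.
\<close>

definition flat_metric_lie_algebra :: "('a::euclidean_space \<Rightarrow> 'a \<Rightarrow> 'a) \<Rightarrow> bool" where
  "flat_metric_lie_algebra br \<longleftrightarrow> lie_algebra br \<and>
     (\<exists>nabla. bilinear nabla \<and>
        (\<forall>x y. nabla x y - nabla y x = br x y) \<and>
        (\<forall>x y z. nabla x y \<bullet> z + y \<bullet> nabla x z = 0) \<and>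
        (\<forall>x y z. nabla x (nabla y z) - nabla y (nabla x z) - nabla (br x y) z = 0))"

definition lie_center :: "('a::real_vector \<Rightarrow> 'a \<Rightarrow> 'a) \<Rightarrow> 'a set" where
  "lie_center br = {x. \<forall>y. br x y = 0}"

definition derived_algebra :: "('a::real_vector \<Rightarrow> 'a \<Rightarrow> 'a) \<Rightarrow> 'a set" where
  "derived_algebra br = span {br x y |x y. True}"

text \<open>
  The planes \<open>P l\<close>, weights \<open>lam l\<close> and complex structures \<open>J l\<close> are indexed by \<open>l < m\<close>. Weights are
  functionals on \<open>s\<close> and \<open>J l\<close> is an endomorphism of \<open>P l\<close>; both are represented by linear extensions
  to the whole space, of which only the values on \<open>s\<close> and on \<open>P l\<close> are ever used. An orthogonal
  map of a plane with square \<open>-1\<close> automatically has determinant \<open>1\<close>.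
\<close>

definition milnor_decomposition ::
    "('a::euclidean_space \<Rightarrow> 'a \<Rightarrow> 'a) \<Rightarrow> 'a set \<Rightarrow> nat \<Rightarrow> (nat \<Rightarrow> 'a set)
      \<Rightarrow> (nat \<Rightarrow> 'a \<Rightarrow> real) \<Rightarrow> (nat \<Rightarrow> 'a \<Rightarrow> 'a) \<Rightarrow> bool" where
  "milnor_decomposition br s m P lam J \<longleftrightarrow>
     (let z = lie_center br; u = derived_algebra br in
       subspace s \<and> (\<forall>x\<in>s. \<forall>y\<in>s. br x y = 0) \<and>
       (\<forall>x\<in>s. \<forall>y\<in>z. x \<bullet> y = 0) \<and> (\<forall>x\<in>s. \<forall>y\<in>u. x \<bullet> y = 0) \<and> (\<forall>x\<in>z. \<forall>y\<in>u. x \<bullet> y = 0) \<and>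
       subspace_sum (subspace_sum s z) u = UNIV \<and>
       (\<forall>x\<in>u. \<forall>y\<in>u. br x y = 0) \<and> even (dim u) \<and>
       (\<forall>x\<in>s. \<forall>v\<in>u. \<forall>w\<in>u. br x v \<bullet> w = - (v \<bullet> br x w)) \<and>
       (\<forall>x\<in>s. \<forall>y\<in>s. \<forall>v\<in>u. br x (br y v) = br y (br x v)) \<and>
       (\<forall>l<m. subspace (P l) \<and> dim (P l) = 2 \<and> (\<forall>x\<in>s. \<forall>v\<in>P l. br x v \<in> P l)) \<and>
       (\<forall>i<m. \<forall>j<m. i \<noteq> j \<longrightarrow> (\<forall>v\<in>P i. \<forall>w\<in>P j. v \<bullet> w = 0)) \<and>
       u = span (\<Union>l<m. P l) \<and>
       (\<forall>l<m. linear (lam l) \<and> (\<exists>x\<in>s. lam l x \<noteq> 0)) \<and>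
       (\<forall>l<m. linear (J l) \<and> J l ` P l \<subseteq> P l \<and>
          (\<forall>v\<in>P l. \<forall>w\<in>P l. J l v \<bullet> J l w = v \<bullet> w) \<and> (\<forall>v\<in>P l. J l (J l v) = - v)) \<and>
       (\<forall>l<m. \<forall>x\<in>s. \<forall>v\<in>P l. br x v = lam l x *\<^sub>R J l v))"

definition nondegenerate :: "'a set \<Rightarrow> nat \<Rightarrow> (nat \<Rightarrow> 'a \<Rightarrow> real) \<Rightarrow> bool" where
  "nondegenerate s m lam \<longleftrightarrow>
     (\<forall>i<m. \<forall>j<m. i \<noteq> j \<longrightarrow> \<not> (\<forall>x\<in>s. lam i x = lam j x) \<and> \<not> (\<forall>x\<in>s. lam i x = - lam j x)) \<and>
     (\<forall>i<m. \<forall>j<m. \<forall>k<m. i \<noteq> j \<and> j \<noteq> k \<and> i \<noteq> k \<longrightarrow>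
        \<not> (\<exists>a\<in>{-1,0,1}. \<exists>b\<in>{-1,0,1}. \<forall>x\<in>s. lam k x = a * lam i x + b * lam j x))"

definition normalized_cocycle ::
    "('a::euclidean_space \<Rightarrow> 'a \<Rightarrow> 'a) \<Rightarrow> 'a set \<Rightarrow> nat \<Rightarrow> (nat \<Rightarrow> 'a set)
      \<Rightarrow> ('a \<Rightarrow> 'a bilin) \<Rightarrow> bool" where
  "normalized_cocycle br s m P R \<longleftrightarrow> cocycle br R \<and>
     R ` subspace_sum s (lie_center br) \<subseteq> invariant_bivectors br \<and>
     (\<forall>l<m. R ` P l \<subseteq> subspace_sum (wedge_space s (P l)) (wedge_space (lie_center br) (P l)))"


section \<open>Smooth manifolds and Lie groups\<close>

text \<open>\<open>C\<^sup>k\<close> on an open set, by iterating directional derivatives.\<close>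

primrec Ck_on :: "nat \<Rightarrow> 'a::euclidean_space set \<Rightarrow> ('a \<Rightarrow> 'b::real_normed_vector) \<Rightarrow> bool" where
  "Ck_on 0 U f \<longleftrightarrow> continuous_on U f"
| "Ck_on (Suc k) U f \<longleftrightarrow> (\<forall>x\<in>U. f differentiable (at x)) \<and>
     (\<forall>v. Ck_on k U (\<lambda>x. frechet_derivative f (at x) v))"

definition smooth_on :: "'a::euclidean_space set \<Rightarrow> ('a \<Rightarrow> 'b::real_normed_vector) \<Rightarrow> bool" where
  "smooth_on U f \<longleftrightarrow> (\<forall>k. Ck_on k U f)"

type_synonym ('p, 'a) chart = "'p set \<times> ('p \<Rightarrow> 'a)"

definition smooth_atlas :: "('p::topological_space, 'a::euclidean_space) chart set \<Rightarrow> bool" where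
  "smooth_atlas A \<longleftrightarrow>
     \<Union>(fst ` A) = UNIV \<and>
     (\<forall>(U, \<phi>)\<in>A. open U \<and> open (\<phi> ` U) \<and> homeomorphism U (\<phi> ` U) \<phi> (inv_into U \<phi>)) \<and>
     (\<forall>(U, \<phi>)\<in>A. \<forall>(V, \<psi>)\<in>A. smooth_on (\<phi> ` (U \<inter> V)) (\<psi> \<circ> inv_into U \<phi>))"

definition vector_atlas :: "('v, 'v) chart set" where
  "vector_atlas = {(UNIV, id)}"

definition prod_atlas :: "('p, 'a) chart set \<Rightarrow> ('q, 'b) chart set \<Rightarrow> ('p \<times> 'q, 'a \<times> 'b) chart set" where
  "prod_atlas A B = {(U \<times> V, map_prod \<phi> \<psi>) |U \<phi> V \<psi>. (U, \<phi>) \<in> A \<and> (V, \<psi>) \<in> B}"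

definition smooth_map ::
    "('p::topological_space, 'a::euclidean_space) chart set
      \<Rightarrow> ('q::topological_space, 'b::real_normed_vector) chart set \<Rightarrow> ('p \<Rightarrow> 'q) \<Rightarrow> bool" where
  "smooth_map A B f \<longleftrightarrow> continuous_on UNIV f \<and>
     (\<forall>(U, \<phi>)\<in>A. \<forall>(V, \<psi>)\<in>B. smooth_on (\<phi> ` (U \<inter> f -` V)) (\<psi> \<circ> f \<circ> inv_into U \<phi>))"

definition lie_group ::
    "('g::{t2_space,second_countable_topology}) monoid \<Rightarrow> ('g, 'a::euclidean_space) chart set \<Rightarrow> bool" where
  "lie_group G A \<longleftrightarrow> group G \<and> carrier G = UNIV \<and> smooth_atlas A \<and>
     smooth_map (prod_atlas A A) A (\<lambda>(g, h). g \<otimes>\<^bsub>G\<^esub> h) \<and> smooth_map A A (\<lambda>g. inv\<^bsub>G\<^esub> g)"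

text \<open>
  A Lie group \<open>G\<close> with Lie algebra \<open>'a\<close> is presented by its exponential map \<open>ex\<close>, whose differential at
  \<open>0\<close> is the identification of \<open>'a\<close> with the tangent space of \<open>G\<close> at the identity. Under this
  identification the differential at the identity of \<open>f\<close> is the derivative of \<open>f \<circ> ex\<close> at \<open>0\<close>. Every
  Lie group has exactly one such smooth family of one-parameter subgroups for each identification.
\<close>

definition diff_id :: "('a::euclidean_space \<Rightarrow> 'g) \<Rightarrow> ('g \<Rightarrow> 'v::real_normed_vector) \<Rightarrow> 'a \<Rightarrow> 'v" where
  "diff_id ex f = frechet_derivative (f \<circ> ex) (at 0)"

text \<open>\<open>Ad g\<close> is the differential at the identity of conjugation by \<open>g\<close>, read in charts around it.\<close>

definition Ad :: "'g monoid \<Rightarrow> ('g, 'a::euclidean_space) chart set \<Rightarrow> ('a \<Rightarrow> 'g) \<Rightarrow> 'g \<Rightarrow> 'a \<Rightarrow> 'a" where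
  "Ad G A ex g x = (THE y. \<forall>(U, \<phi>)\<in>A. \<one>\<^bsub>G\<^esub> \<in> U \<longrightarrow>
     diff_id ex \<phi> y = diff_id ex (\<lambda>h. \<phi> (g \<otimes>\<^bsub>G\<^esub> h \<otimes>\<^bsub>G\<^esub> inv\<^bsub>G\<^esub> g)) x)"

text \<open>The last condition says that the bracket \<open>br\<close> is that of \<open>G\<close>: the differential of \<open>Ad\<close> is \<open>ad\<close>.\<close>

definition lie_group_with_algebra ::
    "('g::{t2_space,second_countable_topology}) monoid \<Rightarrow> ('g, 'a::euclidean_space) chart set
      \<Rightarrow> ('a \<Rightarrow> 'g) \<Rightarrow> ('a \<Rightarrow> 'a \<Rightarrow> 'a) \<Rightarrow> bool" where
  "lie_group_with_algebra G A ex br \<longleftrightarrow> lie_group G A \<and>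
     smooth_map vector_atlas A ex \<and>
     (\<forall>x a b. ex ((a + b) *\<^sub>R x) = ex (a *\<^sub>R x) \<otimes>\<^bsub>G\<^esub> ex (b *\<^sub>R x)) \<and>
     (\<forall>(U, \<phi>)\<in>A. \<one>\<^bsub>G\<^esub> \<in> U \<longrightarrow> bij (diff_id ex \<phi>)) \<and>
     (\<forall>x y. ((\<lambda>t. Ad G A ex (ex (t *\<^sub>R x)) y) has_vector_derivative br x y) (at 0))"

definition group_cocycle ::
    "('g::{t2_space,second_countable_topology}) monoid \<Rightarrow> ('g, 'a::euclidean_space) chart set
      \<Rightarrow> ('a \<Rightarrow> 'g) \<Rightarrow> ('g \<Rightarrow> 'a bilin) \<Rightarrow> bool" where
  "group_cocycle G A ex \<Phi> \<longleftrightarrow> smooth_map A vector_atlas \<Phi> \<and> range \<Phi> \<subseteq> bivectors \<and>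
     (\<forall>g h. \<Phi> (g \<otimes>\<^bsub>G\<^esub> h) = \<Phi> g + ext_mult (Ad G A ex g) (\<Phi> h))"

definition integrates :: "('a::euclidean_space \<Rightarrow> 'g) \<Rightarrow> ('g \<Rightarrow> 'a bilin) \<Rightarrow> ('a \<Rightarrow> 'a bilin) \<Rightarrow> bool" where
  "integrates ex \<Phi> \<xi> \<longleftrightarrow> ((\<Phi> \<circ> ex) has_derivative \<xi>) (at 0)"

definition internal_semidirect :: "('g, 'b) monoid_scheme \<Rightarrow> 'g set \<Rightarrow> 'g set \<Rightarrow> bool" where
  "internal_semidirect G S N \<longleftrightarrow> subgroup S G \<and> N \<lhd> G \<and> S \<inter> N = {\<one>\<^bsub>G\<^esub>} \<and> S <#>\<^bsub>G\<^esub> N = carrier G"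


section \<open>Bivector fields and multiplicative Poisson tensors\<close>

text \<open>
  A bivector at a point \<open>g\<close> is represented by its values \<open>\<beta> f\<^sub>1 f\<^sub>2\<close> on the differentials at \<open>g\<close> of
  smooth functions \<open>f\<^sub>1\<close>, \<open>f\<^sub>2\<close>; values on other functions are irrelevant. Bivector fields are then
  the alternating biderivations of the algebra of smooth functions.
\<close>

type_synonym 'g bivector_at = "('g \<Rightarrow> real) \<Rightarrow> ('g \<Rightarrow> real) \<Rightarrow> real"

definition smooth_functions ::
    "('g::topological_space, 'a::euclidean_space) chart set \<Rightarrow> ('g \<Rightarrow> real) set" where
  "smooth_functions A = {f. smooth_map A vector_atlas f}"

definition bivector_field ::
    "('g::topological_space, 'a::euclidean_space) chart set \<Rightarrow> ('g \<Rightarrow> 'g bivector_at) \<Rightarrow> bool" where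
  "bivector_field A \<pi> \<longleftrightarrow> (\<forall>f\<in>smooth_functions A. \<forall>h\<in>smooth_functions A.
     (\<lambda>g. \<pi> g f h) \<in> smooth_functions A \<and>
     (\<forall>g. \<pi> g f h = - \<pi> g h f) \<and>
     (\<forall>k\<in>smooth_functions A. \<forall>g.
        (\<forall>a b. \<pi> g (\<lambda>x. a * f x + b * h x) k = a * \<pi> g f k + b * \<pi> g h k) \<and>
        \<pi> g (\<lambda>x. f x * h x) k = f g * \<pi> g h k + h g * \<pi> g f k))"

definition same_bivector_field ::
    "('g::topological_space, 'a::euclidean_space) chart set
      \<Rightarrow> ('g \<Rightarrow> 'g bivector_at) \<Rightarrow> ('g \<Rightarrow> 'g bivector_at) \<Rightarrow> bool" where
  "same_bivector_field A \<pi> \<rho> \<longleftrightarrow>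
     (\<forall>g. \<forall>f\<in>smooth_functions A. \<forall>h\<in>smooth_functions A. \<pi> g f h = \<rho> g f h)"

definition poisson_tensor ::
    "('g::topological_space, 'a::euclidean_space) chart set \<Rightarrow> ('g \<Rightarrow> 'g bivector_at) \<Rightarrow> bool" where
  "poisson_tensor A \<pi> \<longleftrightarrow> bivector_field A \<pi> \<and>
     (\<forall>f\<in>smooth_functions A. \<forall>h\<in>smooth_functions A. \<forall>k\<in>smooth_functions A. \<forall>g.
        \<pi> g f (\<lambda>x. \<pi> x h k) + \<pi> g h (\<lambda>x. \<pi> x k f) + \<pi> g k (\<lambda>x. \<pi> x f h) = 0)"

definition pushforward :: "('g \<Rightarrow> 'g) \<Rightarrow> 'g bivector_at \<Rightarrow> 'g bivector_at" where
  "pushforward F \<beta> f h = \<beta> (f \<circ> F) (h \<circ> F)"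

definition multiplicative ::
    "'g monoid \<Rightarrow> ('g::topological_space, 'a::euclidean_space) chart set
      \<Rightarrow> ('g \<Rightarrow> 'g bivector_at) \<Rightarrow> bool" where
  "multiplicative G A \<pi> \<longleftrightarrow> (\<forall>a b. \<forall>f\<in>smooth_functions A. \<forall>h\<in>smooth_functions A.
     \<pi> (a \<otimes>\<^bsub>G\<^esub> b) f h =
       pushforward (\<lambda>x. a \<otimes>\<^bsub>G\<^esub> x) (\<pi> b) f h + pushforward (\<lambda>x. x \<otimes>\<^bsub>G\<^esub> b) (\<pi> a) f h)"

definition bivector_at_one :: "('a::euclidean_space \<Rightarrow> 'g) \<Rightarrow> 'a bilin \<Rightarrow> 'g bivector_at" where
  "bivector_at_one ex r f h =
     blinfun_apply (blinfun_apply r (Blinfun (diff_id ex f))) (Blinfun (diff_id ex h))"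

definition left_invariant_field ::
    "'g monoid \<Rightarrow> ('a::euclidean_space \<Rightarrow> 'g) \<Rightarrow> 'a bilin \<Rightarrow> 'g \<Rightarrow> 'g bivector_at" where
  "left_invariant_field G ex r g = pushforward (\<lambda>x. g \<otimes>\<^bsub>G\<^esub> x) (bivector_at_one ex r)"

definition right_invariant_field ::
    "'g monoid \<Rightarrow> ('a::euclidean_space \<Rightarrow> 'g) \<Rightarrow> 'a bilin \<Rightarrow> 'g \<Rightarrow> 'g bivector_at" where
  "right_invariant_field G ex r g = pushforward (\<lambda>x. x \<otimes>\<^bsub>G\<^esub> g) (bivector_at_one ex r)"

definition right_trivialized_field ::
    "'g monoid \<Rightarrow> ('a::euclidean_space \<Rightarrow> 'g) \<Rightarrow> ('g \<Rightarrow> 'a bilin) \<Rightarrow> 'g \<Rightarrow> 'g bivector_at" where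
  "right_trivialized_field G ex \<Phi> g = pushforward (\<lambda>x. x \<otimes>\<^bsub>G\<^esub> g) (bivector_at_one ex (\<Phi> g))"

definition corresponding_poisson_tensor ::
    "('g::{t2_space,second_countable_topology}) monoid \<Rightarrow> ('g, 'a::euclidean_space) chart set
      \<Rightarrow> ('a \<Rightarrow> 'g) \<Rightarrow> ('a \<Rightarrow> 'a bilin) \<Rightarrow> ('g \<Rightarrow> 'g bivector_at) \<Rightarrow> bool" where
  "corresponding_poisson_tensor G A ex \<xi> \<pi> \<longleftrightarrow>
     poisson_tensor A \<pi> \<and> multiplicative G A \<pi> \<and>
     (\<exists>\<Phi>. group_cocycle G A ex \<Phi> \<and> integrates ex \<Phi> \<xi> \<and>
        same_bivector_field A \<pi> (right_trivialized_field G ex \<Phi>))"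

end

theory Submission
  imports Defs
begin

text \<open>
  The Lie algebra is the direct sum of two abelian subalgebras, \<open>s\<close> and the ideal \<open>n = z + u\<close>. The map
  \<open>pt x = ex (pn x) \<otimes> ex (ps x)\<close>, where \<open>ps\<close> and \<open>pn\<close> are the two projections, is a local diffeomorphism at
  \<open>0\<close>, and left translations of the group are affine maps in these coordinates. Hence \<open>pt\<close> is a covering
  (\<open>covering_pt\<close>), and since the group is simply connected it is injective
  (\<open>simply_connected_covering_injective\<close>). It is therefore a global chart, which exhibits the group as a
  semidirect product of \<open>S\<close> and \<open>N\<close> and reduces smoothness on the group to smoothness on a vector space
  (\<open>smooth_function_iff\<close>).

  A group cocycle integrating \<open>\<xi>\<close> solves a linear differential equation along one-parameter subgroups, so
  it is determined by \<open>\<xi>\<close> on exponentials (\<open>cocycles_agree_on_exponentials\<close>) and then on products of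
  exponentials. For a normalized cocycle \<open>R\<close> the equation has an explicit solution. On \<open>s\<close> the values of
  \<open>R\<close> are invariant, and the solution is \<open>R\<close> itself. On \<open>n\<close> the values of \<open>R\<close> are sums of an invariant
  bivector and of bivectors \<open>a \<and> v\<close> with \<open>v\<close> in \<open>u\<close>; one element of the abelian ideal maps \<open>a \<and> v\<close> to
  \<open>u \<and> u\<close> and a second one kills it, so the exponential series stops at \<open>R u + 1/2 [u, R u]\<close>. That these two
  pieces fit together to a cocycle (\<open>PhiR_mult\<close>) rests on the equivariance of \<open>R\<close> under \<open>S\<close> and on
  \<open>[u, R v] = [v, R u]\<close> for \<open>u, v\<close> in \<open>n\<close>, both of which are instances of the cocycle identity of \<open>R\<close>.

  For the Poisson tensor, \<open>g \<mapsto> Ad g r - r\<close> is the cocycle that integrates \<open>ad r\<close>, and its right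
  trivialization is the difference of the invariant fields; so the cocycle integrating \<open>ad r + R\<close> is
  the sum of the two. It remains to see that a cocycle \<open>\<Phi>\<close> integrating a Lie bialgebra structure defines a
  Poisson bracket. Its Jacobiator at \<open>g\<close> is a polynomial \<open>jac\<close> in the value \<open>\<Phi> g\<close> (\<open>poi_jacobi\<close>). When \<open>g\<close>
  moves under left multiplication by a one-parameter subgroup, the cocycle and co-Jacobi identities
  show that \<open>jac\<close> moves by the coadjoint action (\<open>jac_curve_constant\<close>); it vanishes at the identity
  and hence everywhere.

  The facts about Lie groups that enter, in particular the local inverse of the exponential map, the
  uniqueness of one-parameter subgroups and the smoothness of \<open>Ad\<close>, are derived from a calculus of
  smooth maps built on the inverse function theorem.
\<close>

section \<open>Smooth maps between Euclidean spaces\<close>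

lemma Ck_on_cong_imp:
  assumes "open U" "\<And>x. x \<in> U \<Longrightarrow> f x = g x" "Ck_on k U f"
  shows "Ck_on k U g"
  using assms(2,3)
proof (induction k arbitrary: f g)
  case 0
  then show ?case using continuous_on_cong[of U U f g] by simp
next
  case (Suc k)
  have d: "(g has_derivative frechet_derivative f (at x)) (at x)" if "x \<in> U" for x
  proof (rule has_derivative_transform_within_open[OF _ assms(1) that])
    show "(f has_derivative frechet_derivative f (at x)) (at x)"
      using Suc.prems(2) that by (simp add: frechet_derivative_works[symmetric])
  qed (use Suc.prems in auto)
  then have e: "frechet_derivative g (at x) = frechet_derivative f (at x)" if "x \<in> U" for x
    using frechet_derivative_at that by metis
  have "Ck_on k U (\<lambda>x. frechet_derivative g (at x) v)" for v
    by (rule Suc.IH[of "\<lambda>x. frechet_derivative f (at x) v"]) (use e Suc.prems in auto)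
  with d show ?case by (auto simp: differentiable_def)
qed

text \<open>
  The derivative may be given by any formula that is valid on \<open>U\<close>; as \<open>U\<close> is open, the formula can be
  differentiated in its place.
\<close>

lemma Ck_on_SucI:
  assumes "open U" "\<And>x. x \<in> U \<Longrightarrow> (f has_derivative f' x) (at x)" "\<And>v. Ck_on k U (\<lambda>x. f' x v)"
  shows "Ck_on (Suc k) U f"
proof -
  have "Ck_on k U (\<lambda>x. frechet_derivative f (at x) v)" for v
    by (rule Ck_on_cong_imp[OF assms(1) _ assms(3)[of v]])
      (metis assms(2) frechet_derivative_at)
  then show ?thesis using assms(2) by (auto simp: differentiable_def)
qed

lemma Ck_on_SucD:
  assumes "Ck_on (Suc k) U f"
  shows "x \<in> U \<Longrightarrow> (f has_derivative frechet_derivative f (at x)) (at x)"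
    and "Ck_on k U (\<lambda>x. frechet_derivative f (at x) v)"
  using assms by (auto simp: frechet_derivative_works[symmetric])

lemma Ck_on_subset: "Ck_on k U f \<Longrightarrow> V \<subseteq> U \<Longrightarrow> Ck_on k V f"
  by (induction k arbitrary: f) (auto intro: continuous_on_subset)

lemma Ck_on_lower: "Ck_on (Suc k) U f \<Longrightarrow> Ck_on k U f"
proof (induction k arbitrary: f)
  case 0
  then show ?case
    by (auto intro!: continuous_at_imp_continuous_on differentiable_imp_continuous_within)
next
  case (Suc k)
  show ?case using Suc.prems Suc.IH[of "\<lambda>x. frechet_derivative f (at x) v" for v]
    by (subst Ck_on.simps) (use Ck_on.simps(2) in blast)
qed

lemma Ck_on_const: "open U \<Longrightarrow> Ck_on k U (\<lambda>x. c)"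
proof (induction k arbitrary: c)
  case (Suc k)
  show ?case by (rule Ck_on_SucI[OF Suc.prems has_derivative_const]) (rule Suc.IH[OF Suc.prems])
qed simp

lemma Ck_on_bounded_linear:
  assumes "open U" "bounded_linear L"
  shows "Ck_on k U L"
proof (cases k)
  case 0
  then show ?thesis using assms linear_continuous_on by auto
next
  case (Suc j)
  then show ?thesis
    using Ck_on_SucI[OF assms(1) bounded_linear_imp_has_derivative[OF assms(2)] Ck_on_const[OF assms(1)]]
    by simp
qed

lemma Ck_on_add:
  assumes "open U"
  shows "Ck_on k U f \<Longrightarrow> Ck_on k U g \<Longrightarrow> Ck_on k U (\<lambda>x. f x + g x)"
proof (induction k arbitrary: f g)
  case 0
  then show ?case by (auto intro: continuous_intros)
next
  case (Suc k)
  show ?case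
    by (rule Ck_on_SucI[OF assms, where f' = "\<lambda>x v. frechet_derivative f (at x) v + frechet_derivative g (at x) v"])
      (auto intro!: has_derivative_add Ck_on_SucD Suc.IH Ck_on_SucD(2)[OF Suc.prems(1)] Ck_on_SucD(2)[OF Suc.prems(2)]
        Ck_on_SucD(1)[OF Suc.prems(1)] Ck_on_SucD(1)[OF Suc.prems(2)] simp del: Ck_on.simps(2))
qed

lemma Ck_on_bilinear:
  assumes "open U" "bounded_bilinear b"
  shows "Ck_on k U f \<Longrightarrow> Ck_on k U g \<Longrightarrow> Ck_on k U (\<lambda>x. b (f x) (g x))"
proof (induction k arbitrary: f g)
  case 0
  then show ?case by (auto intro: bounded_bilinear.continuous_on[OF assms(2)])
next
  case (Suc k)
  show ?case
    by (rule Ck_on_SucI[OF assms(1), where f' = "\<lambda>x v. b (f x) (frechet_derivative g (at x) v) + b (frechet_derivative f (at x) v) (g x)"])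
      (auto intro!: bounded_bilinear.FDERIV[OF assms(2)] Ck_on_add[OF assms(1)] Suc.IH
         Ck_on_SucD(2)[OF Suc.prems(1)] Ck_on_SucD(2)[OF Suc.prems(2)]
        Ck_on_SucD(1)[OF Suc.prems(1)] Ck_on_SucD(1)[OF Suc.prems(2)]
        Ck_on_lower[OF Suc.prems(1)] Ck_on_lower[OF Suc.prems(2)] simp del: Ck_on.simps(2))
qed

lemma Ck_on_linear_compose:
  assumes "open U" "bounded_linear L"
  shows "Ck_on k U f \<Longrightarrow> Ck_on k U (\<lambda>x. L (f x))"
proof (induction k arbitrary: f)
  case 0
  then show ?case by (auto intro: bounded_linear.continuous_on[OF assms(2)])
next
  case (Suc k)
  show ?case
    by (rule Ck_on_SucI[OF assms(1), where f' = "\<lambda>x v. L (frechet_derivative f (at x) v)"])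
      (auto intro!: bounded_linear.has_derivative[OF assms(2)] Suc.IH Ck_on_SucD(2)[OF Suc.prems(1)]
        Ck_on_SucD(1)[OF Suc.prems(1)] simp del: Ck_on.simps(2))
qed

lemma Ck_on_sum:
  assumes "open U" "\<And>i. i \<in> I \<Longrightarrow> Ck_on k U (f i)"
  shows "Ck_on k U (\<lambda>x. \<Sum>i\<in>I. f i x)"
  using assms(2)
  by (induction I rule: infinite_finite_induct) (auto intro: Ck_on_const Ck_on_add assms(1))

lemma linear_expand_Basis:
  fixes L :: "'a::euclidean_space \<Rightarrow> 'b::real_vector"
  assumes "linear L"
  shows "L v = (\<Sum>i\<in>Basis. (v \<bullet> i) *\<^sub>R L i)"
proof -
  have "L v = L (\<Sum>i\<in>Basis. (v \<bullet> i) *\<^sub>R i)" by (simp add: euclidean_representation)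
  also have "\<dots> = (\<Sum>i\<in>Basis. (v \<bullet> i) *\<^sub>R L i)"
    using assms by (simp add: linear_sum linear_scale)
  finally show ?thesis .
qed

text \<open>
  The differential of a composite is expanded in a basis, so that only directional derivatives
  of the two factors appear, with scalar coefficients.
\<close>

lemma Ck_on_compose:
  fixes f :: "'a::euclidean_space \<Rightarrow> 'b::euclidean_space"
  assumes "open U" "open V" "f ` U \<subseteq> V"
  shows "Ck_on k U f \<Longrightarrow> Ck_on k V g \<Longrightarrow> Ck_on k U (\<lambda>x. g (f x))"
proof (induction k arbitrary: g)
  case 0
  then show ?case using assms continuous_on_compose2 by auto
next
  case (Suc k)
  let ?f' = "\<lambda>x. frechet_derivative f (at x)" and ?g' = "\<lambda>x. frechet_derivative g (at x)"
  have f': "(f has_derivative ?f' x) (at x)" if "x \<in> U" for x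
    using Ck_on_SucD(1)[OF Suc.prems(1) that] .
  have g': "(g has_derivative ?g' (f x)) (at (f x))" if "x \<in> U" for x
    using Ck_on_SucD(1)[OF Suc.prems(2), of "f x"] that assms(3) by auto
  show ?case
  proof (rule Ck_on_SucI[OF assms(1), where f' = "\<lambda>x v. \<Sum>i\<in>Basis. (?f' x v \<bullet> i) *\<^sub>R ?g' (f x) i"])
    fix x assume x: "x \<in> U"
    have eq: "?g' (f x) = (\<lambda>w. \<Sum>i\<in>Basis. (w \<bullet> i) *\<^sub>R ?g' (f x) i)"
      by (rule ext, rule linear_expand_Basis) (use g'[OF x] has_derivative_linear in blast)
    then show "((\<lambda>x. g (f x)) has_derivative (\<lambda>v. \<Sum>i\<in>Basis. (?f' x v \<bullet> i) *\<^sub>R ?g' (f x) i)) (at x)"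
      using has_derivative_compose[OF f'[OF x] g'[OF x]] by (subst (asm) eq) simp
  next
    fix v
    have "Ck_on k U (\<lambda>x. ?f' x v \<bullet> i)" "Ck_on k U (\<lambda>x. ?g' (f x) i)" for i
      using Ck_on_linear_compose[OF assms(1) bounded_linear_inner_left Ck_on_SucD(2)[OF Suc.prems(1)]]
        Suc.IH[OF Ck_on_lower[OF Suc.prems(1)] Ck_on_SucD(2)[OF Suc.prems(2)]] by auto
    then show "Ck_on k U (\<lambda>x. \<Sum>i\<in>Basis. (?f' x v \<bullet> i) *\<^sub>R ?g' (f x) i)"
      by (intro Ck_on_sum[OF assms(1)] Ck_on_bilinear[OF assms(1) bounded_bilinear_scaleR])
  qed
qed

lemma Ck_on_local:
  assumes "\<And>x. x \<in> U \<Longrightarrow> \<exists>V. open V \<and> x \<in> V \<and> Ck_on k V f"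
  shows "Ck_on k U f"
  using assms
proof (induction k arbitrary: f)
  case 0
  have "continuous (at x) f" if "x \<in> U" for x
    using 0[OF that] continuous_on_eq_continuous_at by auto
  then show ?case by (simp add: continuous_at_imp_continuous_on)
next
  case (Suc k)
  have "f differentiable (at x)" if "x \<in> U" for x
    using Suc.prems[OF that] by auto
  moreover have "Ck_on k U (\<lambda>x. frechet_derivative f (at x) v)" for v
    by (rule Suc.IH) (use Suc.prems in fastforce)
  ultimately show ?case by simp
qed

lemma smooth_on_cong_imp:
  "open U \<Longrightarrow> (\<And>x. x \<in> U \<Longrightarrow> f x = g x) \<Longrightarrow> smooth_on U f \<Longrightarrow> smooth_on U g"
  unfolding smooth_on_def using Ck_on_cong_imp by blast

lemma smooth_on_subset: "smooth_on U f \<Longrightarrow> V \<subseteq> U \<Longrightarrow> smooth_on V f"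
  unfolding smooth_on_def using Ck_on_subset by blast

lemma smooth_on_const: "open U \<Longrightarrow> smooth_on U (\<lambda>x. c)"
  by (simp add: smooth_on_def Ck_on_const)

lemma smooth_on_bounded_linear: "open U \<Longrightarrow> bounded_linear L \<Longrightarrow> smooth_on U L"
  by (simp add: smooth_on_def Ck_on_bounded_linear)

lemma smooth_on_linear:
  fixes L :: "'a::euclidean_space \<Rightarrow> 'b::real_normed_vector"
  shows "open U \<Longrightarrow> linear L \<Longrightarrow> smooth_on U L"
  by (simp add: smooth_on_bounded_linear linear_conv_bounded_linear)

lemma smooth_on_add: "open U \<Longrightarrow> smooth_on U f \<Longrightarrow> smooth_on U g \<Longrightarrow> smooth_on U (\<lambda>x. f x + g x)"
  by (simp add: smooth_on_def Ck_on_add)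

lemma smooth_on_bilinear:
  "open U \<Longrightarrow> bounded_bilinear b \<Longrightarrow> smooth_on U f \<Longrightarrow> smooth_on U g \<Longrightarrow> smooth_on U (\<lambda>x. b (f x) (g x))"
  by (simp add: smooth_on_def Ck_on_bilinear)

lemma smooth_on_linear_compose:
  "open U \<Longrightarrow> bounded_linear L \<Longrightarrow> smooth_on U f \<Longrightarrow> smooth_on U (\<lambda>x. L (f x))"
  by (simp add: smooth_on_def Ck_on_linear_compose)

lemma smooth_on_sum:
  "open U \<Longrightarrow> (\<And>i. i \<in> I \<Longrightarrow> smooth_on U (f i)) \<Longrightarrow> smooth_on U (\<lambda>x. \<Sum>i\<in>I. f i x)"
  by (simp add: smooth_on_def Ck_on_sum)

lemma smooth_on_diff:
  assumes "open U" "smooth_on U f" "smooth_on U g" shows "smooth_on U (\<lambda>x. f x - g x)"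
  using smooth_on_add[OF assms(1,2) smooth_on_linear_compose[OF assms(1) bounded_linear_minus[OF bounded_linear_ident] assms(3)]]
  by simp

lemmas smooth_on_scaleR = smooth_on_bilinear[OF _ bounded_bilinear_scaleR]
lemmas smooth_on_mult = smooth_on_bilinear[OF _ bounded_bilinear_mult]

lemma smooth_on_compose:
  fixes f :: "'a::euclidean_space \<Rightarrow> 'b::euclidean_space"
  shows "open U \<Longrightarrow> open V \<Longrightarrow> f ` U \<subseteq> V \<Longrightarrow> smooth_on U f \<Longrightarrow> smooth_on V g
    \<Longrightarrow> smooth_on U (\<lambda>x. g (f x))"
  by (simp add: smooth_on_def Ck_on_compose)

lemma smooth_on_Pair:
  assumes "open U" "smooth_on U f" "smooth_on U g"
  shows "smooth_on U (\<lambda>x. (f x, g x))"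
  using smooth_on_add[OF assms(1)
      smooth_on_linear_compose[OF assms(1) bounded_linear_Pair[OF bounded_linear_ident bounded_linear_zero] assms(2)]
      smooth_on_linear_compose[OF assms(1) bounded_linear_Pair[OF bounded_linear_zero bounded_linear_ident] assms(3)]]
  by simp

lemma smooth_on_local:
  "(\<And>x. x \<in> U \<Longrightarrow> \<exists>V. open V \<and> x \<in> V \<and> smooth_on V f) \<Longrightarrow> smooth_on U f"
  unfolding smooth_on_def by (intro allI Ck_on_local) blast

lemma smooth_on_imp_continuous_on: "smooth_on U f \<Longrightarrow> continuous_on U f"
  using Ck_on.simps(1) smooth_on_def by blast

lemma smooth_on_has_derivative:
  "smooth_on U f \<Longrightarrow> x \<in> U \<Longrightarrow> (f has_derivative frechet_derivative f (at x)) (at x)"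
  unfolding smooth_on_def using Ck_on_SucD(1) by blast

lemma smooth_on_directional: "smooth_on U f \<Longrightarrow> smooth_on U (\<lambda>x. frechet_derivative f (at x) v)"
  unfolding smooth_on_def using Ck_on_SucD(2) by blast

lemma frechet_derivative_eqI: "(f has_derivative f') (at x) \<Longrightarrow> frechet_derivative f (at x) = f'"
  using frechet_derivative_at by metis

subsection \<open>The inverse function theorem for smooth maps\<close>

text \<open>
  A product of a differentiable factor vanishing at a point and a merely continuous factor is
  differentiable there.
\<close>

lemma has_derivative_vanishing_scaleR:
  fixes s :: "'a::real_normed_vector \<Rightarrow> real"
  assumes s: "(s has_derivative s') (at x)" "s x = 0" and c: "isCont c x"
  shows "((\<lambda>y. s y *\<^sub>R c y) has_derivative (\<lambda>h. s' h *\<^sub>R c x)) (at x)"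
proof -
  have bl: "bounded_linear s'" using s(1) has_derivative_bounded_linear by blast
  have 1: "((\<lambda>y. s y *\<^sub>R c x) has_derivative (\<lambda>h. s' h *\<^sub>R c x)) (at x)"
    using s(1) by (auto intro: derivative_eq_intros)
  have 2: "((\<lambda>y. s y *\<^sub>R (c y - c x)) has_derivative (\<lambda>h. 0)) (at x)"
  proof -
    obtain B where B: "\<forall>\<^sub>F y in at x. norm (s y) \<le> B * norm (y - x)"
    proof -
      obtain K where K: "\<And>h. norm (s' h) \<le> norm h * K" using bl bounded_linear.bounded by blast
      have "((\<lambda>y. norm (s y - s x - s' (y - x)) / norm (y - x)) \<longlongrightarrow> 0) (at x)"
        using s(1) unfolding has_derivative_iff_norm by simp
      then have "\<forall>\<^sub>F y in at x. norm (s y - s x - s' (y - x)) / norm (y - x) < 1"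
        by (rule order_tendstoD) simp
      then have "\<forall>\<^sub>F y in at x. norm (s y) \<le> (K + 1) * norm (y - x)"
      proof (eventually_elim)
        case (elim y)
        have "norm (s y - s' (y - x)) \<le> norm (y - x)"
          using elim s(2) by (cases "y = x") (auto simp: field_simps linear_0 bounded_linear.linear[OF bl])
        then show ?case using K[of "y - x"] s(2) by (simp add: algebra_simps) 
      qed
      then show ?thesis using that by blast
    qed
    have lim: "((\<lambda>y. B * norm (c y - c x)) \<longlongrightarrow> 0) (at x)"
      using c by (auto simp: isCont_def intro!: tendsto_eq_intros)
    have "((\<lambda>y. norm (s y *\<^sub>R (c y - c x)) / norm (y - x)) \<longlongrightarrow> 0) (at x)"
    proof (rule Lim_null_comparison[OF _ lim])
      show "\<forall>\<^sub>F y in at x. norm (norm (s y *\<^sub>R (c y - c x)) / norm (y - x)) \<le> B * norm (c y - c x)"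
        using B
      proof (eventually_elim)
        case (elim y)
        have "norm (s y) * norm (c y - c x) \<le> (B * norm (y - x)) * norm (c y - c x)"
          using elim by (intro mult_right_mono) auto
        then show ?case
          by (cases "y = x") (simp_all add: pos_divide_le_eq ac_simps)
      qed
    qed
    then show ?thesis using s(2)
      unfolding has_derivative_iff_norm by simp
  qed
  from has_derivative_add[OF 1 2] show ?thesis by (simp add: scaleR_diff_right)
qed


text \<open>
  If \<open>M y\<close> is close to \<open>M y0\<close>, a lower bound for \<open>M y0\<close> is inherited by \<open>M y\<close>, so that the inverses
  \<open>N y\<close> are bounded near \<open>y0\<close>; then \<open>N y w - N y0 w = N y (M y0 - M y) (N y0 w)\<close> tends to zero.
\<close>

lemma isCont_inverse_family:
  fixes M N :: "'b::metric_space \<Rightarrow> 'a::euclidean_space \<Rightarrow> 'a"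
  assumes "open U" "y0 \<in> U"
    and lin: "\<And>y. y \<in> U \<Longrightarrow> linear (M y)" "\<And>y. y \<in> U \<Longrightarrow> linear (N y)"
    and inv: "\<And>y w. y \<in> U \<Longrightarrow> N y (M y w) = w" "\<And>y w. y \<in> U \<Longrightarrow> M y (N y w) = w"
    and cont: "\<And>w. isCont (\<lambda>y. M y w) y0"
  shows "isCont (\<lambda>y. N y w) y0"
proof -
  have U: "\<forall>\<^sub>F y in at y0. y \<in> U" using assms(1,2) eventually_at_topological by blast
  have tM: "((\<lambda>y. M y w - M y0 w) \<longlongrightarrow> 0) (at y0)" for w
    using cont[of w] unfolding isCont_def by (simp add: LIM_zero)
  obtain K where K: "K > 0" "\<And>v. norm (N y0 v) \<le> norm v * K"
    using linear_conv_bounded_linear[THEN iffD1, OF lin(2)[OF assms(2)]] bounded_linear.pos_bounded by blast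
  have "((\<lambda>y. \<Sum>b\<in>Basis. norm (M y b - M y0 b)) \<longlongrightarrow> 0) (at y0)"
    by (rule tendsto_null_sum) (use tM tendsto_norm_zero in blast)
  then have "\<forall>\<^sub>F y in at y0. (\<Sum>b\<in>Basis. norm (M y b - M y0 b)) < 1 / (2 * K)"
    by (rule order_tendstoD) (use K in simp)
  then have bnd: "\<forall>\<^sub>F y in at y0. norm (N y v) \<le> 2 * K * norm v" for v
    using U
  proof eventually_elim
    case (elim y)
    let ?x = "N y v"
    have "M y ?x - M y0 ?x = (\<Sum>b\<in>Basis. (?x \<bullet> b) *\<^sub>R (M y b - M y0 b))"
      by (subst linear_expand_Basis[OF lin(1)[OF elim(2)]], subst linear_expand_Basis[OF lin(1)[OF assms(2)]])
        (simp add: scaleR_diff_right sum_subtractf)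
    then have "norm (M y ?x - M y0 ?x) \<le> (\<Sum>b\<in>Basis. \<bar>?x \<bullet> b\<bar> * norm (M y b - M y0 b))"
      by (metis (no_types, lifting) norm_scaleR norm_sum sum.cong)
    also have "\<dots> \<le> (\<Sum>b\<in>Basis. norm ?x * norm (M y b - M y0 b))"
      by (intro sum_mono mult_right_mono) (auto simp: Basis_le_norm)
    also have "\<dots> \<le> norm ?x * (1 / (2 * K))"
      using elim(1) unfolding sum_distrib_left[symmetric] by (intro mult_left_mono) auto
    finally have 1: "norm (v - M y0 ?x) \<le> norm ?x / (2 * K)"
      using inv(2)[OF elim(2)] by simp
    have "norm ?x = norm (N y0 (M y0 ?x))" using inv(1)[OF assms(2)] by simp
    also have "\<dots> \<le> norm (M y0 ?x) * K" by (rule K)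
    also have "\<dots> \<le> (norm v + norm ?x / (2 * K)) * K"
      using 1 K(1) norm_triangle_sub[of "M y0 ?x" v] norm_minus_commute[of v] by (intro mult_right_mono) auto
    finally show ?case using K(1) by (simp add: field_simps)
  qed
  have "((\<lambda>y. N y w - N y0 w) \<longlongrightarrow> 0) (at y0)"
  proof (rule Lim_null_comparison)
    let ?u = "N y0 w"
    show "((\<lambda>y. \<Sum>b\<in>Basis. \<bar>(M y0 ?u - M y ?u) \<bullet> b\<bar> * (2 * K * norm b)) \<longlongrightarrow> 0) (at y0)"
    proof (intro tendsto_null_sum tendsto_mult_left_zero tendsto_rabs_zero)
      show "((\<lambda>y. (M y0 ?u - M y ?u) \<bullet> b) \<longlongrightarrow> 0) (at y0)" for b
        using tendsto_inner[OF tendsto_minus[OF tM[of ?u]] tendsto_const[of b]] by simp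
    qed
    have "\<forall>\<^sub>F y in at y0. \<forall>b\<in>Basis. norm (N y b) \<le> 2 * K * norm (b::'a)"
      using bnd by (intro eventually_ball_finite ballI finite_Basis)
    then show "\<forall>\<^sub>F y in at y0. norm (N y w - N y0 w) \<le> (\<Sum>b\<in>Basis. \<bar>(M y0 ?u - M y ?u) \<bullet> b\<bar> * (2 * K * norm b))"
      using U
    proof eventually_elim
      case (elim y)
      have "N y w - N y0 w = N y (M y0 ?u - M y ?u)"
        using inv elim(2) assms(2) by (simp add: linear_diff[OF lin(2)])
      also have "\<dots> = (\<Sum>b\<in>Basis. ((M y0 ?u - M y ?u) \<bullet> b) *\<^sub>R N y b)"
        by (rule linear_expand_Basis[OF lin(2)[OF elim(2)]])
      finally have "norm (N y w - N y0 w) \<le> (\<Sum>b\<in>Basis. \<bar>(M y0 ?u - M y ?u) \<bullet> b\<bar> * norm (N y b))"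
        by (metis (no_types, lifting) norm_scaleR norm_sum sum.cong)
      also have "\<dots> \<le> (\<Sum>b\<in>Basis. \<bar>(M y0 ?u - M y ?u) \<bullet> b\<bar> * (2 * K * norm b))"
        using elim(1) by (intro sum_mono mult_left_mono) auto
      finally show ?case .
    qed
  qed
  then show ?thesis unfolding isCont_def by (rule LIM_zero_cancel)
qed

text \<open>
  Inversion of matrices is smooth: the derivative of \<open>N = M\<^sup>-\<^sup>1\<close> is \<open>- N M' N\<close>, which is as
  differentiable as \<open>N\<close> itself and the derivative of \<open>M\<close>.
\<close>

lemma Ck_on_inverse_family:
  fixes M N :: "'b::euclidean_space \<Rightarrow> 'a::euclidean_space \<Rightarrow> 'a"
  assumes "open U"
    and lin: "\<And>y. y \<in> U \<Longrightarrow> linear (M y)" "\<And>y. y \<in> U \<Longrightarrow> linear (N y)"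
    and inv: "\<And>y w. y \<in> U \<Longrightarrow> N y (M y w) = w" "\<And>y w. y \<in> U \<Longrightarrow> M y (N y w) = w"
  shows "(\<And>w. Ck_on k U (\<lambda>y. M y w)) \<Longrightarrow> Ck_on k U (\<lambda>y. N y w)"
proof (induction k arbitrary: w)
  case 0
  have "isCont (\<lambda>y. M y w) y" if "y \<in> U" for y w
    using 0 assms(1) that continuous_on_eq_continuous_at by auto
  then have "isCont (\<lambda>y. N y w) y" if "y \<in> U" for y
    by (intro isCont_inverse_family[OF assms(1) that lin inv]) (use that in auto)
  then show ?case by (auto intro: continuous_at_imp_continuous_on)
next
  case (Suc k)
  have cN: "isCont (\<lambda>y. N y w) y" if y: "y \<in> U" for y w
  proof (rule isCont_inverse_family[OF assms(1) that lin inv])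
    show "isCont (\<lambda>y. M y w) y" for w
      using Ck_on_SucD(1)[OF Suc.prems y] has_derivative_continuous by blast
  qed auto
  define D where "D c y h = frechet_derivative (\<lambda>y. M y c) (at y) h" for c y h
  have D: "((\<lambda>y. M y c) has_derivative D c y) (at y)" if "y \<in> U" for c y
    using Ck_on_SucD(1)[OF Suc.prems that] by (simp add: D_def[abs_def])
  define DM where "DM y h u = (\<Sum>c\<in>Basis. (u \<bullet> c) *\<^sub>R D c y h)" for y h u
  have DM: "((\<lambda>y. M y u) has_derivative (\<lambda>h. DM y h u)) (at y)" if "y \<in> U" for y u
  proof (rule has_derivative_transform_within_open[OF _ assms(1) that])
    show "((\<lambda>y. \<Sum>c\<in>Basis. (u \<bullet> c) *\<^sub>R M y c) has_derivative (\<lambda>h. DM y h u)) (at y)"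
      unfolding DM_def by (intro has_derivative_sum has_derivative_scaleR_right D that)
    show "\<And>x. x \<in> U \<Longrightarrow> (\<Sum>c\<in>Basis. (u \<bullet> c) *\<^sub>R M x c) = M x u"
      using linear_expand_Basis[OF lin(1)] by metis
  qed
  show ?case
  proof (rule Ck_on_SucI[OF assms(1), where f' = "\<lambda>y h. - (\<Sum>b\<in>Basis. (DM y h (N y w) \<bullet> b) *\<^sub>R N y b)"])
    fix y assume y: "y \<in> U"
    let ?u = "N y w"
    have *: "((\<lambda>z. ((M z ?u - M y ?u) \<bullet> b) *\<^sub>R N z b) has_derivative (\<lambda>h. (DM y h ?u \<bullet> b) *\<^sub>R N y b)) (at y)" for b
      by (rule has_derivative_vanishing_scaleR) (auto intro!: derivative_eq_intros DM y cN)
    show "((\<lambda>y. N y w) has_derivative (\<lambda>h. - (\<Sum>b\<in>Basis. (DM y h ?u \<bullet> b) *\<^sub>R N y b))) (at y)"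
    proof (rule has_derivative_transform_within_open[OF _ assms(1) y])
      show "((\<lambda>z. ?u - (\<Sum>b\<in>Basis. ((M z ?u - M y ?u) \<bullet> b) *\<^sub>R N z b)) has_derivative
          (\<lambda>h. - (\<Sum>b\<in>Basis. (DM y h ?u \<bullet> b) *\<^sub>R N y b))) (at y)"
        using has_derivative_diff[OF has_derivative_const[of ?u] has_derivative_sum[OF *]] by simp
      show "?u - (\<Sum>b\<in>Basis. ((M z ?u - M y ?u) \<bullet> b) *\<^sub>R N z b) = N z w" if "z \<in> U" for z
        using linear_expand_Basis[OF lin(2)[OF that], of "M z ?u - M y ?u", symmetric] inv that y
        by (simp add: linear_diff[OF lin(2)])
    qed
  next
    fix h
    have N: "Ck_on k U (\<lambda>y. N y b)" for b
      by (rule Suc.IH) (rule Ck_on_lower[OF Suc.prems])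
    have "Ck_on k U (\<lambda>y. D c y h)" for c
      using Ck_on_SucD(2)[OF Suc.prems] by (simp add: D_def)
    then have "Ck_on k U (\<lambda>y. DM y h (N y w))"
      unfolding DM_def
      by (intro Ck_on_sum[OF assms(1)] Ck_on_bilinear[OF assms(1) bounded_bilinear_scaleR]
          Ck_on_linear_compose[OF assms(1) bounded_linear_inner_left N])
    then have "Ck_on k U (\<lambda>y. \<Sum>b\<in>Basis. (DM y h (N y w) \<bullet> b) *\<^sub>R N y b)"
      by (intro Ck_on_sum[OF assms(1)] Ck_on_bilinear[OF assms(1) bounded_bilinear_scaleR] N
          Ck_on_linear_compose[OF assms(1) bounded_linear_inner_left])
    from Ck_on_linear_compose[OF assms(1) bounded_linear_minus[OF bounded_linear_ident] this]
    show "Ck_on k U (\<lambda>y. - (\<Sum>b\<in>Basis. (DM y h (N y w) \<bullet> b) *\<^sub>R N y b))" .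
  qed
qed

text \<open>
  The derivative of the inverse is the inverse of the derivative, composed with the inverse function.
  Every order of differentiability of the inverse function thus yields the next one.
\<close>

lemma smooth_inverse_function:
  fixes f :: "'a::euclidean_space \<Rightarrow> 'a"
  assumes "open U" "x0 \<in> U" "smooth_on U f" "bij (frechet_derivative f (at x0))"
  obtains U' V g where "open U'" "U' \<subseteq> U" "x0 \<in> U'" "open V" "f x0 \<in> V" "homeomorphism U' V f g"
    "smooth_on V g"
proof -
  let ?D = "\<lambda>x. frechet_derivative f (at x)"
  have D: "(f has_derivative ?D x) (at x)" if "x \<in> U" for x
    using smooth_on_has_derivative[OF assms(3) that] .
  have bl: "bounded_linear (?D x)" if "x \<in> U" for x
    using D[OF that] has_derivative_bounded_linear by blast
  have ap: "blinfun_apply (Blinfun (?D x)) = ?D x" if "x \<in> U" for x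
    using bl[OF that] by (simp add: bounded_linear_Blinfun_apply)
  have "continuous_on U (\<lambda>x. Blinfun (?D x))"
  proof (rule continuous_on_blinfun_componentwise)
    fix i :: 'a
    have "continuous_on U (\<lambda>x. ?D x i)"
      using smooth_on_imp_continuous_on[OF smooth_on_directional[OF assms(3)]] .
    then show "continuous_on U (\<lambda>x. blinfun_apply (Blinfun (?D x)) i)"
      using ap continuous_on_cong[of U U] by simp
  qed
  moreover have "Blinfun (inv_into UNIV (?D x0)) o\<^sub>L Blinfun (?D x0) = id_blinfun"
  proof (rule blinfun_eqI)
    have lin: "linear (?D x0)" using bl[OF assms(2)] bounded_linear.linear by blast
    then have "linear (inv_into UNIV (?D x0))"
      using assms(4) by (metis bij_is_inj inj_linear_imp_inv_linear)
    then have bli: "bounded_linear (inv_into UNIV (?D x0))" by (simp add: linear_conv_bounded_linear)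
    show "blinfun_apply (Blinfun (inv_into UNIV (?D x0)) o\<^sub>L Blinfun (?D x0)) i = blinfun_apply id_blinfun i" for i
      using assms(2,4) by (simp add: ap bounded_linear_Blinfun_apply[OF bli] bij_is_inj)
  qed
  ultimately obtain U' V g g' where *: "open U'" "U' \<subseteq> U" "x0 \<in> U'" "open V" "f x0 \<in> V"
      and hom: "homeomorphism U' V f g"
      and g: "\<And>y. y \<in> V \<Longrightarrow> (g has_derivative (g' y)) (at y)"
        "\<And>y. y \<in> V \<Longrightarrow> g' y = inv_into UNIV (blinfun_apply (Blinfun (?D (g y))))"
        "\<And>y. y \<in> V \<Longrightarrow> bij (blinfun_apply (Blinfun (?D (g y))))"
    using inverse_function_theorem[of U f "\<lambda>x. Blinfun (?D x)" x0] assms(1,2) D ap by metis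
  have gU: "g y \<in> U" if "y \<in> V" for y
    using hom *(2) that by (auto simp: homeomorphism_def)
  have "Ck_on k V g" for k
  proof (induction k)
    case 0
    then show ?case using hom by (simp add: homeomorphism_def)
  next
    case (Suc k)
    show ?case
    proof (rule Ck_on_SucI[OF *(4) g(1)])
      show "Ck_on k V (\<lambda>y. g' y v)" for v
      proof (rule Ck_on_inverse_family[OF *(4), where M = "\<lambda>y. ?D (g y)"])
        fix y assume y: "y \<in> V"
        show "linear (?D (g y))" using bl[OF gU[OF y]] bounded_linear.linear by blast
        show "linear (g' y)" using g(1)[OF y] has_derivative_linear by blast
        have "bij (?D (g y))" "g' y = inv_into UNIV (?D (g y))" using g(2,3)[OF y] ap[OF gU[OF y]] by auto
        then show "g' y (?D (g y) w) = w" "?D (g y) (g' y w) = w" for w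
          by (auto simp: bij_is_inj bij_is_surj surj_f_inv_f)
      next
        show "Ck_on k V (\<lambda>y. ?D (g y) w)" for w
          using Ck_on_compose[OF *(4) assms(1) _ Suc.IH] smooth_on_directional[OF assms(3)] gU
          unfolding smooth_on_def by blast
      qed
    qed
  qed
  then show ?thesis using that * hom by (simp add: smooth_on_def)
qed

section \<open>Smooth maps between manifolds\<close>

text \<open>
  The topological part of \<open>smooth_atlas\<close>, on which the composition of smooth maps rests. It also holds
  for \<open>vector_atlas\<close> on normed spaces that are not Euclidean, such as the space of bivectors.
\<close>

definition open_charts :: "('p::topological_space, 'a::topological_space) chart set \<Rightarrow> bool" where
  "open_charts A \<longleftrightarrow> \<Union>(fst ` A) = UNIV \<and>
     (\<forall>(U, \<phi>)\<in>A. open U \<and> inj_on \<phi> U \<and> (\<forall>W. open W \<longrightarrow> open (\<phi> ` (U \<inter> W))))"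

lemma open_chartsD:
  assumes "open_charts A" "(U, \<phi>) \<in> A"
  shows "open U" "inj_on \<phi> U" "open W \<Longrightarrow> open (\<phi> ` (U \<inter> W))"
  using assms by (auto simp: open_charts_def)

lemma open_charts_cover:
  assumes "open_charts A" obtains U \<phi> where "(U, \<phi>) \<in> A" "x \<in> U"
proof -
  have "x \<in> \<Union>(fst ` A)" using assms by (simp add: open_charts_def)
  then show ?thesis using that by (metis UN_E prod.collapse)
qed

lemma smooth_atlas_open_charts:
  assumes "smooth_atlas A" shows "open_charts A"
proof -
  have "inj_on \<phi> U \<and> (\<forall>W. open W \<longrightarrow> open (\<phi> ` (U \<inter> W)))" if "(U, \<phi>) \<in> A" for U \<phi>
  proof (intro conjI allI impI)
    have hom: "homeomorphism U (\<phi> ` U) \<phi> (inv_into U \<phi>)" and op: "open (\<phi> ` U)"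
      using assms that by (auto simp: smooth_atlas_def)
    then show "inj_on \<phi> U" by (intro inj_onI) (metis homeomorphism_apply1)
    fix W :: "'a set" assume "open W"
    then have "openin (top_of_set U) (U \<inter> W)" by (simp add: openin_open_Int)
    from homeomorphism_imp_open_map[OF hom this] show "open (\<phi> ` (U \<inter> W))"
      using op openin_open_eq by blast
  qed
  then show ?thesis using assms by (auto simp: open_charts_def smooth_atlas_def)
qed

lemma vector_atlas_open: "open_charts (vector_atlas :: ('v::topological_space, 'v) chart set)"
  by (simp add: open_charts_def vector_atlas_def)

lemma open_charts_prod:
  assumes "open_charts A" "open_charts B" shows "open_charts (prod_atlas A B)"
proof -
  have "x \<in> \<Union>(fst ` prod_atlas A B)" for x
  proof -
    obtain U \<phi> V \<psi> where *: "(U, \<phi>) \<in> A" "fst x \<in> U" "(V, \<psi>) \<in> B" "snd x \<in> V"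
      using open_charts_cover assms by metis
    then have "(U \<times> V, map_prod \<phi> \<psi>) \<in> prod_atlas A B" by (auto simp: prod_atlas_def)
    with * show ?thesis by (force simp: mem_Times_iff)
  qed
  moreover have "open (U \<times> V) \<and> inj_on (map_prod \<phi> \<psi>) (U \<times> V) \<and>
      (\<forall>W. open W \<longrightarrow> open (map_prod \<phi> \<psi> ` (U \<times> V \<inter> W)))" if "(U, \<phi>) \<in> A" "(V, \<psi>) \<in> B" for U \<phi> V \<psi>
  proof (intro conjI allI impI)
    note U = open_chartsD[OF assms(1) that(1)] and V = open_chartsD[OF assms(2) that(2)]
    show "open (U \<times> V)" using U V open_Times by blast
    show "inj_on (map_prod \<phi> \<psi>) (U \<times> V)" using U V by (simp add: map_prod_inj_on)
    fix W :: "('a \<times> 'c) set" assume W: "open W"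
    show "open (map_prod \<phi> \<psi> ` (U \<times> V \<inter> W))"
      unfolding open_prod_def
    proof
      fix z assume "z \<in> map_prod \<phi> \<psi> ` (U \<times> V \<inter> W)"
      then obtain u v where uv: "z = (\<phi> u, \<psi> v)" "u \<in> U" "v \<in> V" "(u, v) \<in> W" by auto
      then obtain X Y where XY: "open X" "open Y" "(u, v) \<in> X \<times> Y" "X \<times> Y \<subseteq> W"
        using W unfolding open_prod_def by metis
      have "\<phi> ` (U \<inter> X) \<times> \<psi> ` (V \<inter> Y) \<subseteq> map_prod \<phi> \<psi> ` (U \<times> V \<inter> W)"
        using XY(4) by (force simp: image_iff)
      then show "\<exists>A B. open A \<and> open B \<and> z \<in> A \<times> B \<and> A \<times> B \<subseteq> map_prod \<phi> \<psi> ` (U \<times> V \<inter> W)"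
        using U(3)[OF XY(1)] V(3)[OF XY(2)] uv XY(3) by blast
    qed
  qed
  ultimately show ?thesis by (auto simp: open_charts_def prod_atlas_def)
qed

lemma smooth_map_chart:
  "smooth_map A B f \<Longrightarrow> (U, \<phi>) \<in> A \<Longrightarrow> (V, \<psi>) \<in> B
    \<Longrightarrow> smooth_on (\<phi> ` (U \<inter> f -` V)) (\<lambda>x. \<psi> (f (inv_into U \<phi> x)))"
  by (auto simp: smooth_map_def comp_def)

lemma smooth_map_continuous: "smooth_map A B f \<Longrightarrow> continuous_on UNIV f"
  by (simp add: smooth_map_def)

lemma smooth_map_open_vimage: "smooth_map A B f \<Longrightarrow> open V \<Longrightarrow> open (f -` V)"
  using smooth_map_continuous open_vimage by blast

text \<open>
  The function \<open>k\<close> is smooth on the open set \<open>W\<close> only, as a chart or a local inverse is. Near each point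
  the composite factors through a chart of the manifold in between.
\<close>

lemma smooth_on_chart_compose:
  assumes A: "open_charts A" and B: "open_charts B" and f: "smooth_map A B f" and W: "open W"
    and c: "(U, \<phi>) \<in> A"
    and k: "\<And>V \<psi>. (V, \<psi>) \<in> B \<Longrightarrow> smooth_on (\<psi> ` (V \<inter> W)) (\<lambda>y. k (inv_into V \<psi> y))"
  shows "smooth_on (\<phi> ` (U \<inter> f -` W)) (\<lambda>x. k (f (inv_into U \<phi> x)))"
proof (rule smooth_on_local)
  note U = open_chartsD[OF A c]
  fix x assume "x \<in> \<phi> ` (U \<inter> f -` W)"
  then obtain p where p: "p \<in> U" "f p \<in> W" "x = \<phi> p" by auto
  obtain V \<psi> where V: "(V, \<psi>) \<in> B" "f p \<in> V" using open_charts_cover[OF B] .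
  note V' = open_chartsD[OF B V(1)]
  let ?Z = "\<phi> ` (U \<inter> f -` (V \<inter> W))"
  have oZ: "open ?Z" using U(3) smooth_map_open_vimage[OF f] V'(1) W by (metis open_Int)
  have "smooth_on ?Z (\<lambda>x. k (inv_into V \<psi> (\<psi> (f (inv_into U \<phi> x)))))"
  proof (rule smooth_on_compose[OF oZ _ _ _ k[OF V(1)]])
    show "open (\<psi> ` (V \<inter> W))" using V'(3) W by blast
    show "smooth_on ?Z (\<lambda>x. \<psi> (f (inv_into U \<phi> x)))"
      by (rule smooth_on_subset[OF smooth_map_chart[OF f c V(1)]]) auto
    show "(\<lambda>x. \<psi> (f (inv_into U \<phi> x))) ` ?Z \<subseteq> \<psi> ` (V \<inter> W)"
      using U(2) by (auto simp: inv_into_f_f)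
  qed
  then have "smooth_on ?Z (\<lambda>x. k (f (inv_into U \<phi> x)))"
    by (rule smooth_on_cong_imp[OF oZ, rotated]) (use U(2) V'(2) in \<open>auto simp: inv_into_f_f\<close>)
  then show "\<exists>Z. open Z \<and> x \<in> Z \<and> smooth_on Z (\<lambda>x. k (f (inv_into U \<phi> x)))"
    using oZ p V(2) by blast
qed

lemma smooth_map_compose:
  assumes "open_charts A" "open_charts B" "open_charts C" "smooth_map A B f" "smooth_map B C g"
  shows "smooth_map A C (\<lambda>x. g (f x))"
  unfolding smooth_map_def
proof safe
  show "continuous_on UNIV (\<lambda>x. g (f x))"
    using continuous_on_compose2[OF smooth_map_continuous[OF assms(5)] smooth_map_continuous[OF assms(4)]] by simp
  fix U \<phi> W \<eta> assume c: "(U, \<phi>) \<in> A" "(W, \<eta>) \<in> C"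
  have "smooth_on (\<phi> ` (U \<inter> f -` (g -` W))) (\<lambda>x. \<eta> (g (f (inv_into U \<phi> x))))"
    by (rule smooth_on_chart_compose[OF assms(1,2,4) _ c(1), where k = "\<lambda>y. \<eta> (g y)"])
      (use smooth_map_chart[OF assms(5) _ c(2)] smooth_map_open_vimage[OF assms(5)]
        open_chartsD[OF assms(3) c(2)] in auto)
  then show "smooth_on (\<phi> ` (U \<inter> (\<lambda>x. g (f x)) -` W)) (\<eta> \<circ> (\<lambda>x. g (f x)) \<circ> inv_into U \<phi>)"
    by (simp add: comp_def vimage_def)
qed

lemma smooth_map_id:
  assumes "smooth_atlas A" shows "smooth_map A A (\<lambda>x. x)"
  using assms by (force simp: smooth_map_def smooth_atlas_def comp_def)

lemma smooth_map_const:
  assumes "open_charts A" shows "smooth_map A B (\<lambda>x. c)"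
  unfolding smooth_map_def
proof safe
  fix U \<phi> V \<psi> assume c: "(U, \<phi>) \<in> A" "(V, \<psi>) \<in> B"
  then have "open (\<phi> ` (U \<inter> (\<lambda>x. c) -` V))"
    using open_chartsD(3)[OF assms c(1), of "if c \<in> V then UNIV else {}"]
    by (auto simp: vimage_def split: if_splits)
  then show "smooth_on (\<phi> ` (U \<inter> (\<lambda>x. c) -` V)) (\<psi> \<circ> (\<lambda>x. c) \<circ> inv_into U \<phi>)"
    by (simp add: comp_def smooth_on_const)
qed simp

lemma smooth_map_Pair:
  fixes B :: "('q::topological_space, 'b::euclidean_space) chart set"
    and C :: "('r::topological_space, 'c::euclidean_space) chart set"
  assumes "open_charts A" "open_charts B" "open_charts C" "smooth_map A B f" "smooth_map A C g"
  shows "smooth_map A (prod_atlas B C) (\<lambda>x. (f x, g x))"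
  unfolding smooth_map_def
proof safe
  show "continuous_on UNIV (\<lambda>x. (f x, g x))" by (intro continuous_on_Pair smooth_map_continuous[OF assms(4)] smooth_map_continuous[OF assms(5)])
next
  fix U \<phi> VW \<psi>\<eta> assume c: "(U, \<phi>) \<in> A" "(VW, \<psi>\<eta>) \<in> prod_atlas B C"
  then obtain V \<psi> W \<eta> where cd: "(U, \<phi>) \<in> A" "(V, \<psi>) \<in> B" "(W, \<eta>) \<in> C"
    "VW = V \<times> W" "\<psi>\<eta> = map_prod \<psi> \<eta>"
    by (auto simp: prod_atlas_def)
  let ?Z = "\<phi> ` (U \<inter> (\<lambda>x. (f x, g x)) -` (V \<times> W))"
  have Z: "?Z = \<phi> ` (U \<inter> (f -` V \<inter> g -` W))" by auto
  have "open ?Z" unfolding Z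
    using smooth_map_open_vimage[OF assms(4)] smooth_map_open_vimage[OF assms(5)] cd
      open_chartsD(1)[OF assms(2)] open_chartsD(1)[OF assms(3)]
    by (intro open_chartsD(3)[OF assms(1)] open_Int) auto
  then have "smooth_on ?Z (\<lambda>x. (\<psi> (f (inv_into U \<phi> x)), \<eta> (g (inv_into U \<phi> x))))"
    by (rule smooth_on_Pair)
      (use smooth_map_chart[OF assms(4) cd(1,2)] smooth_map_chart[OF assms(5) cd(1,3)]
        in \<open>auto elim!: smooth_on_subset\<close>)
  then show "smooth_on (\<phi> ` (U \<inter> (\<lambda>x. (f x, g x)) -` VW)) (\<psi>\<eta> \<circ> (\<lambda>x. (f x, g x)) \<circ> inv_into U \<phi>)"
    by (simp add: cd comp_def)
qed

lemma smooth_map_vector_vector: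
  "smooth_map (vector_atlas :: ('a::euclidean_space, 'a) chart set) vector_atlas f \<longleftrightarrow> smooth_on UNIV f"
proof -
  have "inv_into UNIV id = (id :: 'a \<Rightarrow> 'a)" by (rule inv_id)
  then show ?thesis
    by (auto simp: smooth_map_def vector_atlas_def smooth_on_imp_continuous_on)
qed

lemma smooth_map_from_vector:
  assumes "smooth_map (vector_atlas :: ('a::euclidean_space, 'a) chart set) B f" "(V, \<psi>) \<in> B"
  shows "smooth_on (f -` V) (\<lambda>x. \<psi> (f x))"
proof -
  have "inv_into UNIV id = (id :: 'a \<Rightarrow> 'a)" by (rule inv_id)
  then show ?thesis using smooth_map_chart[OF assms(1) _ assms(2), of UNIV id]
    by (simp add: vector_atlas_def)
qed

section \<open>The exponential map as a chart at the identity\<close>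

locale lie_group_algebra =
  fixes G :: "('g::{t2_space,second_countable_topology}) monoid" (structure)
    and A :: "('g, 'a::euclidean_space) chart set" and ex :: "'a \<Rightarrow> 'g" and br :: "'a \<Rightarrow> 'a \<Rightarrow> 'a"
  assumes lie_group_with_algebra: "lie_group_with_algebra G A ex br"
    and lie_algebra: "lie_algebra br"
begin

lemma lie_group: "lie_group G A"
  using lie_group_with_algebra by (simp add: lie_group_with_algebra_def)

sublocale group G
  using lie_group by (simp add: lie_group_def)

lemma carrier_UNIV [simp]: "carrier G = UNIV"
  using lie_group by (simp add: lie_group_def)

lemma smooth_atlas: "smooth_atlas A"
  using lie_group by (simp add: lie_group_def)

lemma charts: "open_charts A"
  using smooth_atlas by (rule smooth_atlas_open_charts)

lemma smooth_mult:
  assumes "open_charts B" "smooth_map B A f" "smooth_map B A g"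
  shows "smooth_map B A (\<lambda>x. f x \<otimes> g x)"
  using smooth_map_compose[OF assms(1) open_charts_prod[OF charts charts] charts
      smooth_map_Pair[OF assms(1) charts charts assms(2,3)], of "\<lambda>(g, h). g \<otimes> h"] lie_group
  by (simp add: lie_group_def)

lemma smooth_inv:
  assumes "open_charts B" "smooth_map B A f"
  shows "smooth_map B A (\<lambda>x. inv (f x))"
  using smooth_map_compose[OF assms(1) charts charts assms(2), of "\<lambda>g. inv g"] lie_group
  by (simp add: lie_group_def)

lemma smooth_ex: "smooth_map vector_atlas A ex"
  using lie_group_with_algebra by (simp add: lie_group_with_algebra_def)

lemma smooth_ex_compose:
  fixes f :: "'e::euclidean_space \<Rightarrow> 'a"
  assumes "smooth_on UNIV f" shows "smooth_map vector_atlas A (\<lambda>x. ex (f x))"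
  using smooth_map_compose[OF vector_atlas_open vector_atlas_open charts _ smooth_ex] assms
  by (simp add: smooth_map_vector_vector)

lemma smooth_ex_linear:
  fixes f :: "'e::euclidean_space \<Rightarrow> 'a"
  shows "linear f \<Longrightarrow> smooth_map vector_atlas A (\<lambda>x. ex (f x))"
  by (rule smooth_ex_compose) (simp add: smooth_on_linear)

lemma smooth_constant: "open_charts B \<Longrightarrow> smooth_map B A (\<lambda>x. c)"
  by (rule smooth_map_const)

lemma smooth_left: "smooth_map A A (\<lambda>h. g \<otimes> h)"
  and smooth_right: "smooth_map A A (\<lambda>h. h \<otimes> g)"
  using smooth_mult[OF charts smooth_map_const[OF charts] smooth_map_id[OF smooth_atlas]]
    smooth_mult[OF charts smooth_map_id[OF smooth_atlas] smooth_map_const[OF charts]] by auto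

lemma smooth_function_compose:
  fixes f :: "'g \<Rightarrow> 'v::real_normed_vector" and F :: "'e::euclidean_space \<Rightarrow> 'g"
  assumes "smooth_map A vector_atlas f" "smooth_map vector_atlas A F"
  shows "smooth_on UNIV (\<lambda>x. f (F x))"
  using smooth_map_compose[OF vector_atlas_open charts vector_atlas_open assms(2,1)]
  by (simp add: smooth_map_vector_vector)

lemma ex_add: "ex ((a + b) *\<^sub>R x) = ex (a *\<^sub>R x) \<otimes> ex (b *\<^sub>R x)"
  using lie_group_with_algebra by (simp add: lie_group_with_algebra_def)

lemma ex_0 [simp]: "ex 0 = \<one>"
  using ex_add[of 0 0 0] r_cancel_one'[of "ex 0" "ex 0"] by simp

lemma ex_minus: "ex (- x) = inv (ex x)"
proof -
  have "ex (- x) \<otimes> ex x = \<one>" using ex_add[of "-1" 1 x] by simp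
  then show ?thesis by (simp add: inv_equality)
qed

lemma bilinear_br: "bilinear br"
  using lie_algebra by (simp add: lie_algebra_def)

lemma br_self [simp]: "br x x = 0"
  using lie_algebra by (simp add: lie_algebra_def)

lemma br_jacobi: "br x (br y z) + br y (br z x) + br z (br x y) = 0"
  using lie_algebra by (simp add: lie_algebra_def)

lemma linear_br_right: "linear (br x)" and linear_br_left: "linear (\<lambda>x. br x y)"
  using bilinear_br by (auto simp: bilinear_def)

lemmas br_add_right = linear_add[OF linear_br_right] and br_add_left = linear_add[OF linear_br_left]
  and br_scale_right = linear_scale[OF linear_br_right] and br_scale_left = linear_scale[OF linear_br_left]
  and br_minus_right = linear_neg[OF linear_br_right] and br_minus_left = linear_neg[OF linear_br_left]
  and br_zero_right [simp] = linear_0[OF linear_br_right] and br_zero_left [simp] = linear_0[OF linear_br_left]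

lemma br_swap: "br x y = - br y x"
proof -
  have "br x y + br y x = br (x + y) (x + y)" unfolding br_add_left br_add_right by simp
  then have "br x y + br y x = 0" by simp
  then show ?thesis by (simp add: eq_neg_iff_add_eq_0)
qed

text \<open>
  A smooth inverse of \<open>F\<close> near \<open>F 0\<close>, with its domains; for smooth \<open>F\<close> it is a chart of the
  maximal atlas.
\<close>

definition inverse_chart :: "('a \<Rightarrow> 'g) \<Rightarrow> 'a set \<Rightarrow> 'g set \<Rightarrow> ('g \<Rightarrow> 'a) \<Rightarrow> bool" where
  "inverse_chart F V W q \<longleftrightarrow> open V \<and> 0 \<in> V \<and> open W \<and> homeomorphism V W F q \<and>
     (\<forall>U \<phi>. (U, \<phi>) \<in> A \<longrightarrow> smooth_on (\<phi> ` (U \<inter> W)) (\<lambda>x. q (inv_into U \<phi> x)))"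

lemma inverse_chartD:
  assumes "inverse_chart F V W q"
  shows "open V" "0 \<in> V" "open W" "F 0 \<in> W" "continuous_on W q"
    "x \<in> V \<Longrightarrow> F x \<in> W" "x \<in> V \<Longrightarrow> q (F x) = x" "g \<in> W \<Longrightarrow> q g \<in> V" "g \<in> W \<Longrightarrow> F (q g) = g"
    "(U, \<phi>) \<in> A \<Longrightarrow> smooth_on (\<phi> ` (U \<inter> W)) (\<lambda>x. q (inv_into U \<phi> x))"
  using assms by (auto simp: inverse_chart_def homeomorphism_def)

text \<open>
  The inverse function theorem is applied to \<open>F\<close> read in a chart; the smooth transition maps of the
  atlas make the resulting local inverse smooth in all charts.
\<close>

lemma inverse_chart_exists:
  assumes F: "smooth_map vector_atlas A F" and c0: "(U0, \<phi>0) \<in> A" "F 0 \<in> U0"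
    and bij: "bij (frechet_derivative (\<lambda>x. \<phi>0 (F x)) (at 0))"
  obtains V W q where "inverse_chart F V W q"
proof -
  note U0 = open_chartsD[OF charts c0(1)]
  obtain V V' \<gamma> where V: "open V" "V \<subseteq> F -` U0" "0 \<in> V" "open V'"
      "homeomorphism V V' (\<lambda>x. \<phi>0 (F x)) \<gamma>" "smooth_on V' \<gamma>"
    by (rule smooth_inverse_function[OF smooth_map_open_vimage[OF F U0(1)] _ smooth_map_from_vector[OF F c0(1)] bij])
      (use c0(2) in auto)
  have \<gamma>: "x \<in> V \<Longrightarrow> \<phi>0 (F x) \<in> V'" "x \<in> V \<Longrightarrow> \<gamma> (\<phi>0 (F x)) = x" "y \<in> V' \<Longrightarrow> \<gamma> y \<in> V"
      "y \<in> V' \<Longrightarrow> \<phi>0 (F (\<gamma> y)) = y" "continuous_on V' \<gamma>" for x y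
    using V(5) by (auto simp: homeomorphism_def)
  define W where "W = U0 \<inter> \<phi>0 -` V'"
  have cont: "continuous_on U0 \<phi>0"
    using smooth_atlas c0(1) by (auto simp: smooth_atlas_def homeomorphism_def)
  have oW: "open W" unfolding W_def using continuous_open_preimage[OF cont U0(1) V(4)] .
  have "homeomorphism V W F (\<lambda>g. \<gamma> (\<phi>0 g))"
  proof (rule homeomorphismI)
    show "continuous_on V F"
      using smooth_map_continuous[OF F] continuous_on_subset by blast
    show "continuous_on W (\<lambda>g. \<gamma> (\<phi>0 g))"
      by (rule continuous_on_compose2[OF \<gamma>(5) continuous_on_subset[OF cont]]) (auto simp: W_def)
    show "F (\<gamma> (\<phi>0 g)) = g" if "g \<in> W" for g
      by (rule inj_onD[OF U0(2)]) (use that \<gamma>(3,4) V(2) in \<open>auto simp: W_def\<close>)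
  qed (use \<gamma> V(2) in \<open>auto simp: W_def\<close>)
  moreover have "smooth_on (\<phi> ` (U \<inter> W)) (\<lambda>x. \<gamma> (\<phi>0 (inv_into U \<phi> x)))" if c: "(U, \<phi>) \<in> A" for U \<phi>
  proof (rule smooth_on_compose[OF _ V(4) _ _ V(6)])
    note U = open_chartsD[OF charts c]
    show "open (\<phi> ` (U \<inter> W))" using U oW by blast
    show "(\<lambda>x. \<phi>0 (inv_into U \<phi> x)) ` \<phi> ` (U \<inter> W) \<subseteq> V'" using U(2) by (auto simp: W_def inv_into_f_f)
    have "smooth_on (\<phi> ` (U \<inter> U0)) (\<lambda>x. \<phi>0 (inv_into U \<phi> x))"
      using smooth_atlas c c0(1) by (force simp: smooth_atlas_def comp_def)
    then show "smooth_on (\<phi> ` (U \<inter> W)) (\<lambda>x. \<phi>0 (inv_into U \<phi> x))"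
      by (rule smooth_on_subset) (auto simp: W_def)
  qed
  ultimately have "inverse_chart F V W (\<lambda>g. \<gamma> (\<phi>0 g))" using V oW by (simp add: inverse_chart_def)
  then show ?thesis by (rule that)
qed

lemma diff_id_chart:
  assumes "(U, \<phi>) \<in> A" "\<one> \<in> U"
  shows "((\<lambda>x. \<phi> (ex x)) has_derivative diff_id ex \<phi>) (at 0)" "bij (diff_id ex \<phi>)"
  using smooth_on_has_derivative[OF smooth_map_from_vector[OF smooth_ex assms(1)], of 0] assms
    lie_group_with_algebra
  by (auto simp: diff_id_def comp_def lie_group_with_algebra_def)

lemma log_chart_exists: obtains V W lg where "inverse_chart ex V W lg"
proof -
  obtain U0 \<phi>0 where c0: "(U0, \<phi>0) \<in> A" "\<one> \<in> U0" using open_charts_cover[OF charts] .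
  show ?thesis
    by (rule inverse_chart_exists[OF smooth_ex c0(1)])
      (use c0(2) diff_id_chart(2)[OF c0] that in \<open>auto simp: diff_id_def comp_def\<close>)
qed

end

text \<open>
  The logarithm \<open>lg\<close> is fixed as a chart at the identity, because the exponential map is the identity
  in it: tangent vectors at the identity become elements of the Lie algebra.
\<close>

locale lie_group_log = lie_group_algebra +
  fixes V :: "'b::euclidean_space set" and W :: "'a::{t2_space,second_countable_topology} set" and lg :: "'a \<Rightarrow> 'b"
  assumes log_chart: "inverse_chart ex V W lg"
begin

lemma log_open: "open V" "open W" and log_in: "0 \<in> V" "\<one> \<in> W"
  and lg_ex [simp]: "x \<in> V \<Longrightarrow> lg (ex x) = x" and ex_lg [simp]: "g \<in> W \<Longrightarrow> ex (lg g) = g"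
  using inverse_chartD[OF log_chart] by auto

lemma lg_one [simp]: "lg \<one> = 0"
  using lg_ex[OF log_in(1)] by simp

lemma smooth_lg:
  assumes "smooth_map vector_atlas A F"
  shows "smooth_on (F -` W) (\<lambda>e. lg (F e))"
proof -
  have "inv_into UNIV id = (id :: 'e \<Rightarrow> 'e)" by (rule inv_id)
  then show ?thesis
    using smooth_on_chart_compose[OF vector_atlas_open charts assms log_open(2), of UNIV id lg]
      inverse_chartD(10)[OF log_chart] by (simp add: vector_atlas_def)
qed

text \<open>
  The velocity of \<open>F\<close> at \<open>e\<close> when \<open>F e\<close> is the identity, as an element of the Lie algebra.
\<close>

definition tangent :: "('e::euclidean_space \<Rightarrow> 'a) \<Rightarrow> 'e \<Rightarrow> 'e \<Rightarrow> 'b" where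
  "tangent F e = frechet_derivative (\<lambda>x. lg (F x)) (at e)"

lemma tangent_derivative:
  assumes "smooth_map vector_atlas A F" "F e \<in> W"
  shows "((\<lambda>x. lg (F x)) has_derivative tangent F e) (at e)"
  unfolding tangent_def using smooth_on_has_derivative[OF smooth_lg[OF assms(1)]] assms(2) by auto

lemma tangent_eqI: "((\<lambda>x. lg (F x)) has_derivative L) (at e) \<Longrightarrow> tangent F e = L"
  by (simp add: tangent_def frechet_derivative_eqI)

lemma linear_tangent:
  assumes "smooth_map vector_atlas A F" "F e \<in> W" shows "linear (tangent F e)"
  using tangent_derivative[OF assms] has_derivative_linear by blast

text \<open>Every function sees a map into the group through its tangent only.\<close>

lemma derivative_via_tangent:
  assumes F: "smooth_map vector_atlas A F" "F e = \<one>"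
    and f: "((\<lambda>x. f (ex x)) has_derivative D) (at 0)"
  shows "((\<lambda>x. f (F x)) has_derivative (\<lambda>h. D (tangent F e h))) (at e)"
proof (rule has_derivative_transform_within_open)
  have "((\<lambda>x. lg (F x)) has_derivative tangent F e) (at e)"
    using tangent_derivative[OF F(1)] F(2) log_in by simp
  from has_derivative_compose[OF this, of "\<lambda>x. f (ex x)"]
  show "((\<lambda>x. f (ex (lg (F x)))) has_derivative (\<lambda>h. D (tangent F e h))) (at e)"
    using f F(2) by simp
  show "open (F -` W)" using smooth_map_open_vimage[OF F(1) log_open(2)] .
qed (use F log_in in auto)

lemma tangent_ex:
  assumes "smooth_on UNIV f" "f e = 0" "(f has_derivative D) (at e)"
  shows "tangent (\<lambda>x. ex (f x)) e = D"
proof (rule tangent_eqI, rule has_derivative_transform_within_open[OF assms(3)])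
  show "open (f -` V)" using smooth_on_imp_continuous_on[OF assms(1)] log_open(1) open_vimage by blast
qed (use assms(2) log_in in auto)

lemma tangent_ex_0: "tangent ex 0 = (\<lambda>h. h)"
  using tangent_ex[of "\<lambda>x. x" 0 "\<lambda>h. h"] by (simp add: smooth_on_linear linear_ident)

text \<open>
  The product read in the logarithmic chart has the identity as both partial derivatives at the
  origin, since \<open>\<one>\<close> is a unit.
\<close>

lemma tangent_mult:
  assumes F1: "smooth_map vector_atlas A F1" "F1 e = \<one>" and F2: "smooth_map vector_atlas A F2" "F2 e = \<one>"
  shows "tangent (\<lambda>x. F1 x \<otimes> F2 x) e = (\<lambda>h. tangent F1 e h + tangent F2 e h)"
proof (rule tangent_eqI)
  let ?m = "\<lambda>z. ex (fst z) \<otimes> ex (snd z)"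
  have m: "smooth_map vector_atlas A ?m"
    by (intro smooth_mult vector_atlas_open smooth_ex_linear linear_fst linear_snd)
  let ?D = "tangent ?m (0, 0)"
  have m0: "((\<lambda>z. lg (?m z)) has_derivative ?D) (at (0, 0))"
    by (rule tangent_derivative[OF m]) (simp add: log_in)
  have lin: "linear ?D" using m0 has_derivative_linear by blast
  have 1: "?D (x, 0) = x" for x
  proof -
    have "((\<lambda>x. lg (?m (x, 0))) has_derivative (\<lambda>h. ?D (h, 0))) (at 0)"
      by (rule has_derivative_compose[of "\<lambda>x. (x, 0)" "\<lambda>h. (h, 0)" 0 UNIV "\<lambda>z. lg (?m z)" ?D])
        (auto intro!: derivative_eq_intros m0)
    then have "tangent ex 0 = (\<lambda>h. ?D (h, 0))" by (intro tangent_eqI) simp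
    then show ?thesis unfolding tangent_ex_0 by (rule fun_cong[symmetric])
  qed
  have 2: "?D (0, x) = x" for x
  proof -
    have "((\<lambda>x. lg (?m (0, x))) has_derivative (\<lambda>h. ?D (0, h))) (at 0)"
      by (rule has_derivative_compose[of "\<lambda>x. (0, x)" "\<lambda>h. (0, h)" 0 UNIV "\<lambda>z. lg (?m z)" ?D])
        (auto intro!: derivative_eq_intros m0)
    then have "tangent ex 0 = (\<lambda>h. ?D (0, h))" by (intro tangent_eqI) simp
    then show ?thesis unfolding tangent_ex_0 by (rule fun_cong[symmetric])
  qed
  have D: "?D (x, y) = x + y" for x y
    using linear_add[OF lin, of "(x, 0)" "(0, y)"] by (simp add: 1 2)
  have "((\<lambda>x. (lg (F1 x), lg (F2 x))) has_derivative (\<lambda>h. (tangent F1 e h, tangent F2 e h))) (at e)"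
    using F1 F2 log_in by (intro has_derivative_Pair tangent_derivative) auto
  from has_derivative_compose[OF this, of "\<lambda>z. lg (?m z)" ?D] m0 F1(2) F2(2)
  have "((\<lambda>x. lg (ex (lg (F1 x)) \<otimes> ex (lg (F2 x)))) has_derivative (\<lambda>h. tangent F1 e h + tangent F2 e h)) (at e)"
    by (simp add: D)
  then show "((\<lambda>x. lg (F1 x \<otimes> F2 x)) has_derivative (\<lambda>h. tangent F1 e h + tangent F2 e h)) (at e)"
  proof (rule has_derivative_transform_within_open)
    show "open (F1 -` W \<inter> F2 -` W)"
      using smooth_map_open_vimage[OF F1(1) log_open(2)] smooth_map_open_vimage[OF F2(1) log_open(2)] by blast
  qed (use F1 F2 log_in in auto)
qed

text \<open>
  A curve whose left logarithmic derivative vanishes is constant: in the chart around any of its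
  points it has derivative zero, so it is locally constant.
\<close>

lemma constant_curve:
  fixes c :: "real \<Rightarrow> 'a"
  assumes c: "smooth_map vector_atlas A c" and tan: "\<And>t h. tangent (\<lambda>x. inv (c t) \<otimes> c x) t h = 0"
  shows "c t = c 0"
proof -
  have sm: "smooth_map vector_atlas A (\<lambda>x. g \<otimes> c x)" for g
    by (intro smooth_mult vector_atlas_open smooth_constant c)
  have loc: "\<exists>e>0. \<forall>t\<in>ball t0 e. c t = c t0" for t0
  proof -
    let ?O = "(\<lambda>x. inv (c t0) \<otimes> c x) -` W"
    have "open ?O" by (rule smooth_map_open_vimage[OF sm log_open(2)])
    moreover have "t0 \<in> ?O" using log_in by simp
    ultimately obtain e where e: "e > 0" "ball t0 e \<subseteq> ?O" using open_contains_ball by metis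
    have der: "((\<lambda>x. lg (inv (c t0) \<otimes> c x)) has_derivative (\<lambda>h. 0)) (at t1)" if "t1 \<in> ball t0 e" for t1
    proof -
      let ?h = "inv (c t0) \<otimes> c t1"
      let ?f = "\<lambda>g. lg (?h \<otimes> g)"
      have hW: "?h \<in> W" using that e by auto
      have sme: "smooth_map vector_atlas A (\<lambda>x. ?h \<otimes> ex x)"
        by (intro smooth_mult vector_atlas_open smooth_constant smooth_ex)
      have D: "((\<lambda>x. ?f (ex x)) has_derivative tangent (\<lambda>x. ?h \<otimes> ex x) 0) (at 0)"
        by (rule tangent_derivative[OF sme]) (use hW in simp)
      have "((\<lambda>x. ?f (inv (c t1) \<otimes> c x)) has_derivative (\<lambda>h. tangent (\<lambda>x. ?h \<otimes> ex x) 0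
          (tangent (\<lambda>x. inv (c t1) \<otimes> c x) t1 h))) (at t1)"
        by (rule derivative_via_tangent[OF sm _ D]) simp
      moreover have "?f (inv (c t1) \<otimes> c x) = lg (inv (c t0) \<otimes> c x)" for x
        using m_assoc[of "inv (c t0) \<otimes> c t1" "inv (c t1)" "c x"] m_assoc[of "inv (c t0)" "c t1" "inv (c t1)"] by simp
      ultimately show ?thesis
        using linear_0[OF linear_tangent[OF sme]] hW by (simp add: tan)
    qed
    have "c t = c t0" if t: "t \<in> ball t0 e" for t
    proof -
      have "\<exists>k. \<forall>x\<in>ball t0 e. lg (inv (c t0) \<otimes> c x) = k"
        by (rule has_derivative_zero_constant) (simp, rule has_derivative_at_withinI[OF der])
      then have "lg (inv (c t0) \<otimes> c t) = lg (inv (c t0) \<otimes> c t0)" using t e(1) by (metis centre_in_ball)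
      then have "inv (c t0) \<otimes> c t = \<one>" using ex_lg[of "inv (c t0) \<otimes> c t"] t e(2) by auto
      then show ?thesis by (metis carrier_UNIV UNIV_I inv_inv inv_comm inv_equality)
    qed
    with e(1) show ?thesis by blast
  qed
  have "open {t. c t = c 0}" "open {t. c t \<noteq> c 0}"
    unfolding open_contains_ball using loc by (metis (mono_tags, lifting) mem_Collect_eq subsetI)+
  then have "open {t. c t = c 0}" "closed {t. c t = c 0}"
    by (auto simp: closed_def Collect_neg_eq)
  then have "{t. c t = c 0} = {} \<or> {t. c t = c 0} = UNIV"
    using connected_clopen[of "UNIV :: real set"] by (metis connected_UNIV closed_closedin open_openin topspace_euclidean_subtopology subtopology_UNIV)
  then show ?thesis by blast
qed

end

section \<open>The adjoint representation\<close>

context lie_group_log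
begin

abbreviation AD :: "'a \<Rightarrow> 'b \<Rightarrow> 'b" where "AD \<equiv> Ad G A ex"

lemma smooth_conj:
  "open_charts B \<Longrightarrow> smooth_map B A F \<Longrightarrow> smooth_map B A (\<lambda>x. g \<otimes> F x \<otimes> inv g)"
  by (intro smooth_mult smooth_constant)

lemma group_simps [simp]:
  "\<one> \<otimes> g = g" "g \<otimes> \<one> = g" "inv g \<otimes> g = \<one>" "g \<otimes> inv g = \<one>" "inv (inv g) = g"
  "inv (g \<otimes> h) = inv h \<otimes> inv g" "g \<otimes> (inv g \<otimes> h) = h" "inv g \<otimes> (g \<otimes> h) = h" "a \<otimes> b \<otimes> c = a \<otimes> (b \<otimes> c)"
  by (simp_all add: inv_mult_group m_assoc) (simp_all flip: m_assoc)

text \<open>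
  Read in the logarithmic chart, the implicit description of \<open>Ad\<close> becomes an actual derivative.
\<close>

lemma AD_eq_tangent: "AD g = tangent (\<lambda>x. g \<otimes> ex x \<otimes> inv g) 0"
proof
  fix x
  let ?K = "\<lambda>x. g \<otimes> ex x \<otimes> inv g"
  have K: "smooth_map vector_atlas A ?K" by (intro smooth_conj vector_atlas_open smooth_ex)
  have chart: "(((\<lambda>x. \<phi> (ex x)) has_derivative diff_id ex \<phi>) (at 0)) \<and> diff_id ex (\<lambda>h. \<phi> (g \<otimes> h \<otimes> inv g)) y
      = diff_id ex \<phi> (tangent ?K 0 y)" if c: "(U, \<phi>) \<in> A" "\<one> \<in> U" for U \<phi> y
  proof
    show D: "((\<lambda>x. \<phi> (ex x)) has_derivative diff_id ex \<phi>) (at 0)" by (rule diff_id_chart(1)[OF c])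
    have "((\<lambda>x. \<phi> (?K x)) has_derivative (\<lambda>h. diff_id ex \<phi> (tangent ?K 0 h))) (at 0)"
      by (rule derivative_via_tangent[OF K _ D]) simp
    then show "diff_id ex (\<lambda>h. \<phi> (g \<otimes> h \<otimes> inv g)) y = diff_id ex \<phi> (tangent ?K 0 y)"
      unfolding diff_id_def comp_def by (simp add: frechet_derivative_eqI)
  qed
  (* One chart at the identity determines the value of Ad, since the differential is injective. *)
  obtain U0 \<phi>0 where c0: "(U0, \<phi>0) \<in> A" "\<one> \<in> U0" using open_charts_cover[OF charts] .
  have inj: "inj (diff_id ex \<phi>0)" using diff_id_chart(2)[OF c0] by (simp add: bij_is_inj)
  show "AD g x = tangent ?K 0 x"
    unfolding Ad_def
  proof (rule the_equality)
    show "\<forall>(U, \<phi>)\<in>A. \<one> \<in> U \<longrightarrow>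
         diff_id ex \<phi> (tangent ?K 0 x) = diff_id ex (\<lambda>h. \<phi> (g \<otimes> h \<otimes> inv g)) x"
      using chart by fastforce
    fix y assume "\<forall>(U, \<phi>)\<in>A. \<one> \<in> U \<longrightarrow> diff_id ex \<phi> y = diff_id ex (\<lambda>h. \<phi> (g \<otimes> h \<otimes> inv g)) x"
    then have "diff_id ex \<phi>0 y = diff_id ex \<phi>0 (tangent ?K 0 x)" using chart[OF c0] c0 by fastforce
    then show "y = tangent ?K 0 x" using inj by (simp add: inj_eq)
  qed
qed

lemma lg_conj_derivative: "((\<lambda>x. lg (g \<otimes> ex x \<otimes> inv g)) has_derivative AD g) (at 0)"
  unfolding AD_eq_tangent
  by (rule tangent_derivative) (intro smooth_conj vector_atlas_open smooth_ex, simp add: log_in)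

lemma linear_AD: "linear (AD g)"
  using lg_conj_derivative has_derivative_linear by blast

lemma tangent_conj:
  assumes "smooth_map vector_atlas A F" "F e = \<one>"
  shows "tangent (\<lambda>x. g \<otimes> F x \<otimes> inv g) e = (\<lambda>h. AD g (tangent F e h))"
  using derivative_via_tangent[OF assms lg_conj_derivative] by (rule tangent_eqI)

lemma AD_mult: "AD (g \<otimes> h) x = AD g (AD h x)"
proof -
  have "AD (g \<otimes> h) = tangent (\<lambda>x. g \<otimes> (h \<otimes> ex x \<otimes> inv h) \<otimes> inv g) 0"
    unfolding AD_eq_tangent by simp
  also have "\<dots> = (\<lambda>x. AD g (AD h x))"
    unfolding AD_eq_tangent[of h]
    by (rule tangent_conj) (intro smooth_conj vector_atlas_open smooth_ex, simp)
  finally show ?thesis by simp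
qed

lemma AD_one [simp]: "AD \<one> x = x"
  by (simp add: AD_eq_tangent tangent_ex_0)

lemma AD_inv [simp]: "AD (inv g) (AD g x) = x" "AD g (AD (inv g) x) = x"
  by (simp_all flip: AD_mult)

text \<open>
  The curve \<open>\<gamma> t \<otimes> ex (- t y)\<close> has vanishing left logarithmic derivative: seen from the point at \<open>t0\<close> it is
  a conjugate of \<open>\<gamma> h \<otimes> ex (- h y)\<close>, where the two velocities cancel.
\<close>

lemma one_parameter_subgroup:
  fixes \<gamma> :: "real \<Rightarrow> 'a"
  assumes g: "smooth_map vector_atlas A \<gamma>" and add: "\<And>a b. \<gamma> (a + b) = \<gamma> a \<otimes> \<gamma> b"
    and tan: "tangent \<gamma> 0 1 = y"
  shows "\<gamma> t = ex (t *\<^sub>R y)"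
proof -
  have g0: "\<gamma> 0 = \<one>" using add[of 0 0] r_cancel_one'[of "\<gamma> 0" "\<gamma> 0"] by simp
  have gm: "inv (\<gamma> a) = \<gamma> (- a)" for a
    using add[of "-a" a] g0 by (intro inv_equality) auto
  define c where "c t = \<gamma> t \<otimes> ex (- (t *\<^sub>R y))" for t
  have lin: "linear (\<lambda>t. - (t *\<^sub>R y))" by (auto intro!: linearI simp: algebra_simps)
  have c: "smooth_map vector_atlas A c"
    unfolding c_def[abs_def] by (intro smooth_mult vector_atlas_open g smooth_ex_linear lin)
  have "c t = c 0"
  proof (rule constant_curve[OF c])
    fix t0 h
    let ?F1 = "\<lambda>t. \<gamma> (t - t0)" and ?F2 = "\<lambda>t. ex (- ((t - t0) *\<^sub>R y))"
    have sub: "smooth_on UNIV (\<lambda>t. t - t0)"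
      by (intro smooth_on_diff smooth_on_linear smooth_on_const) (auto intro: linear_ident)
    have F1: "smooth_map vector_atlas A ?F1"
      by (rule smooth_map_compose[OF vector_atlas_open vector_atlas_open charts _ g])
        (simp add: smooth_map_vector_vector sub)
    have F2s: "smooth_on UNIV (\<lambda>t. - ((t - t0) *\<^sub>R y))"
      by (rule smooth_on_compose[OF open_UNIV open_UNIV _ sub smooth_on_linear[OF open_UNIV lin]]) simp
    have T1: "tangent ?F1 t0 = (\<lambda>h. h *\<^sub>R y)"
    proof -
      have d: "((\<lambda>t. lg (\<gamma> t)) has_derivative tangent \<gamma> 0) (at (t0 - t0))"
        using tangent_derivative[OF g] g0 log_in by simp
      have "((\<lambda>t. lg (\<gamma> (t - t0))) has_derivative tangent \<gamma> 0) (at t0)"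
        by (rule has_derivative_compose[of "\<lambda>t. t - t0" "\<lambda>h. h" t0 UNIV "\<lambda>t. lg (\<gamma> t)"])
          (auto intro!: derivative_eq_intros simp: d[simplified])
      moreover have "tangent \<gamma> 0 = (\<lambda>h. h *\<^sub>R y)"
      proof
        show "tangent \<gamma> 0 h = h *\<^sub>R y" for h
        using linear_scale[OF linear_tangent[OF g], of 0 h 1] g0 log_in tan by simp
      qed
      ultimately show ?thesis by (intro tangent_eqI) simp
    qed
    have T2: "tangent ?F2 t0 = (\<lambda>h. - (h *\<^sub>R y))"
      by (rule tangent_ex[OF F2s]) (auto intro!: derivative_eq_intros)
    have T12: "tangent (\<lambda>t. ?F1 t \<otimes> ?F2 t) t0 = (\<lambda>h. 0)"
      by (subst tangent_mult[OF F1 _ smooth_ex_compose[OF F2s]]) (auto simp: g0 T1 T2)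
    have "inv (c t0) \<otimes> c t = ex (t0 *\<^sub>R y) \<otimes> (?F1 t \<otimes> ?F2 t) \<otimes> inv (ex (t0 *\<^sub>R y))" for t
    proof -
      have "(t0 - t) *\<^sub>R y = - ((t - t0) *\<^sub>R y)" "(- t0) *\<^sub>R y = - (t0 *\<^sub>R y)" by (simp_all add: algebra_simps)
      then have 1: "ex (- (t *\<^sub>R y)) = ex (- ((t - t0) *\<^sub>R y)) \<otimes> inv (ex (t0 *\<^sub>R y))"
        using ex_add[of "t0 - t" "- t0" y] by (simp add: ex_minus)
      have 2: "inv (\<gamma> t0) \<otimes> \<gamma> t = \<gamma> (t - t0)" using add[of "- t0" t] by (simp add: gm)
      have "inv (c t0) \<otimes> c t = ex (t0 *\<^sub>R y) \<otimes> (inv (\<gamma> t0) \<otimes> \<gamma> t) \<otimes> ex (- (t *\<^sub>R y))"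
        by (simp add: c_def ex_minus)
      then show ?thesis unfolding 1 2 by simp
    qed
    then have "tangent (\<lambda>x. inv (c t0) \<otimes> c x) t0 =
        tangent (\<lambda>t. ex (t0 *\<^sub>R y) \<otimes> (?F1 t \<otimes> ?F2 t) \<otimes> inv (ex (t0 *\<^sub>R y))) t0" by presburger
    also have "\<dots> = (\<lambda>h. AD (ex (t0 *\<^sub>R y)) (tangent (\<lambda>t. ?F1 t \<otimes> ?F2 t) t0 h))"
      by (rule tangent_conj) (intro smooth_mult vector_atlas_open F1 smooth_ex_compose[OF F2s], simp add: g0)
    finally show "tangent (\<lambda>x. inv (c t0) \<otimes> c x) t0 h = 0"
      unfolding T12 by (simp add: linear_0[OF linear_AD])
  qed
  then have "\<gamma> t \<otimes> inv (ex (t *\<^sub>R y)) = \<one>" by (simp add: c_def g0 ex_minus)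
  then show ?thesis by (metis carrier_UNIV UNIV_I inv_equality inv_inv)
qed

lemma conj_ex: "g \<otimes> ex x \<otimes> inv g = ex (AD g x)"
proof -
  have "g \<otimes> ex (1 *\<^sub>R x) \<otimes> inv g = ex (1 *\<^sub>R AD g x)"
  proof (rule one_parameter_subgroup)
    have lin: "linear (\<lambda>t. t *\<^sub>R x)" by (auto intro!: linearI simp: algebra_simps)
    have sm: "smooth_map vector_atlas A (\<lambda>t. ex (t *\<^sub>R x))" by (rule smooth_ex_linear[OF lin])
    show "smooth_map vector_atlas A (\<lambda>t. g \<otimes> ex (t *\<^sub>R x) \<otimes> inv g)"
      by (intro smooth_conj vector_atlas_open sm)
    have "tangent (\<lambda>t. ex (t *\<^sub>R x)) 0 = (\<lambda>t. t *\<^sub>R x)"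
      by (rule tangent_ex) (auto simp: smooth_on_linear lin intro!: derivative_eq_intros)
    then show "tangent (\<lambda>t. g \<otimes> ex (t *\<^sub>R x) \<otimes> inv g) 0 1 = AD g x"
      by (subst tangent_conj[OF sm]) auto
    show "g \<otimes> ex ((a + b) *\<^sub>R x) \<otimes> inv g = g \<otimes> ex (a *\<^sub>R x) \<otimes> inv g \<otimes> (g \<otimes> ex (b *\<^sub>R x) \<otimes> inv g)" for a b
      by (simp add: ex_add)
  qed
  then show ?thesis by simp
qed

text \<open>
  By its description as a tangent, \<open>AD (F e) x\<close> is a partial derivative of a smooth function of two
  variables.
\<close>

lemma smooth_AD:
  fixes F :: "'e::euclidean_space \<Rightarrow> 'a"
  assumes F: "smooth_map vector_atlas A F"
  shows "smooth_on UNIV (\<lambda>e. AD (F e) x)"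
proof -
  let ?K = "\<lambda>z. F (fst z) \<otimes> ex (snd z) \<otimes> inv (F (fst z))"
  have Ff: "smooth_map vector_atlas A (\<lambda>z::'e \<times> 'b. F (fst z))"
    by (rule smooth_map_compose[OF vector_atlas_open vector_atlas_open charts _ F])
      (simp add: smooth_map_vector_vector smooth_on_linear linear_fst)
  have K: "smooth_map vector_atlas A ?K"
    by (intro smooth_mult vector_atlas_open Ff smooth_inv smooth_ex_linear linear_snd)
  have K0: "?K (e, 0) = \<one>" for e by simp
  have "smooth_on UNIV (\<lambda>e. frechet_derivative (\<lambda>z. lg (?K z)) (at (e, 0)) (0, x))"
  proof (rule smooth_on_compose[where f = "\<lambda>e. (e, 0)" and V = "?K -` W"])
    show "open (?K -` W)" using smooth_map_open_vimage[OF K log_open(2)] .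
    show "(\<lambda>e. (e, 0)) ` UNIV \<subseteq> ?K -` W" using log_in by auto
    show "smooth_on UNIV (\<lambda>e::'e. (e, 0::'b))"
      by (rule smooth_on_bounded_linear) (auto intro: bounded_linear_Pair bounded_linear_ident bounded_linear_zero)
    show "smooth_on (?K -` W) (\<lambda>z. frechet_derivative (\<lambda>z. lg (?K z)) (at z) (0, x))"
      by (rule smooth_on_directional[OF smooth_lg[OF K]])
  qed simp
  moreover have "frechet_derivative (\<lambda>z. lg (?K z)) (at (e, 0)) (0, x) = AD (F e) x" for e
  proof -
    have d: "((\<lambda>z. lg (?K z)) has_derivative tangent ?K (e, 0)) (at (e, 0))"
      by (rule tangent_derivative[OF K]) (simp add: log_in)
    have "((\<lambda>y. lg (?K (e, y))) has_derivative (\<lambda>h. tangent ?K (e, 0) (0, h))) (at 0)"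
      by (rule has_derivative_compose[of "\<lambda>y. (e, y)" "\<lambda>h. (0, h)" 0 UNIV "\<lambda>z. lg (?K z)"])
        (auto intro!: derivative_eq_intros simp: d[simplified])
    then have "AD (F e) = (\<lambda>h. tangent ?K (e, 0) (0, h))"
      using has_derivative_unique lg_conj_derivative by simp blast
    then show ?thesis by (simp add: tangent_def)
  qed
  ultimately show ?thesis by simp
qed

lemma AD_derivative:
  "((\<lambda>t. AD (ex (t *\<^sub>R x)) y) has_vector_derivative AD (ex (t *\<^sub>R x)) (br x y)) (at t)"
  "((\<lambda>t. AD (ex (t *\<^sub>R x)) y) has_vector_derivative br x (AD (ex (t *\<^sub>R x)) y)) (at t)"
proof -
  have d: "((\<lambda>t. AD (ex (t *\<^sub>R x)) y) has_vector_derivative br x y) (at (t - t))" for y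
    using lie_group_with_algebra by (simp add: lie_group_with_algebra_def)
  have s: "((\<lambda>u. u - t) has_vector_derivative 1) (at t)"
    by (auto intro!: derivative_eq_intros)
  have sh: "((\<lambda>u. AD (ex ((u - t) *\<^sub>R x)) y) has_vector_derivative br x y) (at t)" for y
    using vector_diff_chain_at[OF s d] by (simp add: comp_def)
  have left: "(\<lambda>u. AD (ex (u *\<^sub>R x)) y) = (\<lambda>u. AD (ex (t *\<^sub>R x)) (AD (ex ((u - t) *\<^sub>R x)) y))"
  proof
    fix u
    have "ex (t *\<^sub>R x) \<otimes> ex ((u - t) *\<^sub>R x) = ex (u *\<^sub>R x)" using ex_add[of t "u - t" x] by simp
    then show "AD (ex (u *\<^sub>R x)) y = AD (ex (t *\<^sub>R x)) (AD (ex ((u - t) *\<^sub>R x)) y)"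
      by (simp flip: AD_mult)
  qed
  show "((\<lambda>t. AD (ex (t *\<^sub>R x)) y) has_vector_derivative AD (ex (t *\<^sub>R x)) (br x y)) (at t)"
    by (subst left, rule bounded_linear.has_vector_derivative[OF _ sh])
      (simp add: linear_AD flip: linear_conv_bounded_linear)
  have right: "(\<lambda>u. AD (ex (u *\<^sub>R x)) y) = (\<lambda>u. AD (ex ((u - t) *\<^sub>R x)) (AD (ex (t *\<^sub>R x)) y))"
  proof
    fix u
    have "ex ((u - t) *\<^sub>R x) \<otimes> ex (t *\<^sub>R x) = ex (u *\<^sub>R x)" using ex_add[of "u - t" t x] by simp
    then show "AD (ex (u *\<^sub>R x)) y = AD (ex ((u - t) *\<^sub>R x)) (AD (ex (t *\<^sub>R x)) y)"
      by (simp flip: AD_mult)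
  qed
  show "((\<lambda>t. AD (ex (t *\<^sub>R x)) y) has_vector_derivative br x (AD (ex (t *\<^sub>R x)) y)) (at t)"
    by (subst right, rule sh)
qed

text \<open>
  Both sides are the velocity at \<open>t = 0\<close> of \<open>AD (g \<otimes> ex (t x)) y\<close>.
\<close>

lemma AD_br: "AD g (br x y) = br (AD g x) (AD g y)"
proof -
  have *: "((\<lambda>t. AD (ex (t *\<^sub>R x)) y) has_vector_derivative br x y) (at 0)" for x y
    using lie_group_with_algebra by (simp add: lie_group_with_algebra_def)
  have "AD g (AD (ex (t *\<^sub>R x)) y) = AD (ex (t *\<^sub>R AD g x)) (AD g y)" for t
  proof -
    have "g \<otimes> ex (t *\<^sub>R x) \<otimes> inv g \<otimes> g = ex (t *\<^sub>R AD g x) \<otimes> g"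
      unfolding conj_ex by (simp add: linear_scale[OF linear_AD])
    then have "g \<otimes> ex (t *\<^sub>R x) = ex (t *\<^sub>R AD g x) \<otimes> g" by simp
    then show ?thesis by (simp flip: AD_mult)
  qed
  then have "((\<lambda>t. AD g (AD (ex (t *\<^sub>R x)) y)) has_vector_derivative br (AD g x) (AD g y)) (at 0)"
    using *[of "AD g x" "AD g y"] by simp
  moreover have "((\<lambda>t. AD g (AD (ex (t *\<^sub>R x)) y)) has_vector_derivative AD g (br x y)) (at 0)"
    by (rule bounded_linear.has_vector_derivative[OF _ *]) (simp add: linear_AD flip: linear_conv_bounded_linear)
  ultimately show ?thesis using vector_derivative_unique_at by blast
qed

lemma constant_of_zero_derivative:
  fixes f :: "real \<Rightarrow> 'v::real_normed_vector"
  assumes "\<And>t. (f has_vector_derivative 0) (at t)" shows "f t = f 0"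
proof -
  have "\<exists>k. \<forall>t\<in>UNIV. f t = k"
    by (intro has_derivative_zero_constant) (use assms in \<open>auto simp: has_vector_derivative_def\<close>)
  then show ?thesis by (metis UNIV_I)
qed

lemma AD_ex_fixed: assumes "br x y = 0" shows "AD (ex x) y = y"
  using constant_of_zero_derivative[of "\<lambda>t. AD (ex (t *\<^sub>R x)) y" 1] AD_derivative(1)[of x y] assms
  by (simp add: linear_0[OF linear_AD])

text \<open>
  If \<open>br x y = 0\<close>, then \<open>AD (ex x)\<close> fixes \<open>y\<close>, so the two one-parameter subgroups commute and their
  product is a one-parameter subgroup with velocity \<open>x + y\<close>.
\<close>

lemma ex_commute:
  assumes "br x y = 0" shows "ex x \<otimes> ex y = ex (x + y)"
proof -
  have com: "ex (a *\<^sub>R x) \<otimes> ex (b *\<^sub>R y) = ex (b *\<^sub>R y) \<otimes> ex (a *\<^sub>R x)" for a b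
  proof -
    have "ex (a *\<^sub>R x) \<otimes> ex (b *\<^sub>R y) \<otimes> inv (ex (a *\<^sub>R x)) = ex (b *\<^sub>R y)"
      unfolding conj_ex by (subst AD_ex_fixed) (auto simp: br_scale_left br_scale_right assms)
    then have "ex (a *\<^sub>R x) \<otimes> ex (b *\<^sub>R y) \<otimes> inv (ex (a *\<^sub>R x)) \<otimes> ex (a *\<^sub>R x) = ex (b *\<^sub>R y) \<otimes> ex (a *\<^sub>R x)"
      by presburger
    then show ?thesis by simp
  qed
  have lin: "linear (\<lambda>t. t *\<^sub>R z)" for z :: 'b by (auto intro!: linearI simp: algebra_simps)
  have sm: "smooth_map vector_atlas A (\<lambda>t. ex (t *\<^sub>R z))" for z by (rule smooth_ex_linear[OF lin])
  have tan: "tangent (\<lambda>t. ex (t *\<^sub>R z)) 0 = (\<lambda>t. t *\<^sub>R z)" for z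
    by (rule tangent_ex) (auto simp: smooth_on_linear lin intro!: derivative_eq_intros)
  have "ex (1 *\<^sub>R x) \<otimes> ex (1 *\<^sub>R y) = ex (1 *\<^sub>R (x + y))"
  proof (rule one_parameter_subgroup)
    show "smooth_map vector_atlas A (\<lambda>t. ex (t *\<^sub>R x) \<otimes> ex (t *\<^sub>R y))"
      by (intro smooth_mult vector_atlas_open sm)
    show "tangent (\<lambda>t. ex (t *\<^sub>R x) \<otimes> ex (t *\<^sub>R y)) 0 1 = x + y"
      by (subst tangent_mult[OF sm _ sm]) (auto simp: tan)
    fix a b
    have "ex (b *\<^sub>R x) \<otimes> (ex (a *\<^sub>R y) \<otimes> ex (b *\<^sub>R y)) = ex (a *\<^sub>R y) \<otimes> (ex (b *\<^sub>R x) \<otimes> ex (b *\<^sub>R y))"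
      using com[of b a] by (metis group_simps(9))
    then show "ex ((a + b) *\<^sub>R x) \<otimes> ex ((a + b) *\<^sub>R y) = ex (a *\<^sub>R x) \<otimes> ex (a *\<^sub>R y) \<otimes> (ex (b *\<^sub>R x) \<otimes> ex (b *\<^sub>R y))"
      by (simp add: ex_add)
  qed
  then show ?thesis by simp
qed

end

section \<open>Coverings of simply connected spaces\<close>

text \<open>
  Pulling back to a subset of a normed space makes the lifting theorems for normed spaces available
  for coverings of arbitrary spaces.
\<close>

lemma covering_space_pullback:
  fixes p :: "'a::topological_space \<Rightarrow> 'b::topological_space" and f :: "'c::topological_space \<Rightarrow> 'b"
  assumes cov: "covering_space C p S" and f: "continuous_on U f" "f \<in> U \<rightarrow> S"
  shows "covering_space {z \<in> U \<times> C. f (fst z) = p (snd z)} fst U"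
proof
  let ?E = "{z \<in> U \<times> C. f (fst z) = p (snd z)}"
  show "continuous_on ?E fst" by (intro continuous_intros)
  have "p ` C = S" using cov by (rule covering_space_imp_surjective)
  then show "fst ` ?E = U" using f(2) by (force simp: image_iff Pi_iff)
  fix x assume x: "x \<in> U"
  then obtain T v where T: "f x \<in> T" "openin (top_of_set S) T" "\<Union>v = C \<inter> p -` T"
      "\<And>u. u \<in> v \<Longrightarrow> openin (top_of_set C) u" "pairwise disjnt v"
      "\<And>u. u \<in> v \<Longrightarrow> \<exists>q. homeomorphism u T p q"
    using cov f(2) unfolding covering_space_def Pi_iff by metis
  let ?T = "U \<inter> f -` T" and ?sh = "\<lambda>u. {z \<in> ?E. fst z \<in> U \<inter> f -` T \<and> snd z \<in> u}"
  show "\<exists>T. x \<in> T \<and> openin (top_of_set U) T \<and>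
      (\<exists>v. \<Union>v = ?E \<inter> fst -` T \<and> (\<forall>u\<in>v. openin (top_of_set ?E) u) \<and> pairwise disjnt v \<and>
        (\<forall>u\<in>v. \<exists>q. homeomorphism u T fst q))"
  proof (intro exI[of _ ?T] conjI exI[of _ "?sh ` v"] ballI)
    show "x \<in> ?T" using x T(1) by simp
    show oT: "openin (top_of_set U) ?T"
      using continuous_openin_preimage[OF f T(2)] .
    show "\<Union>(?sh ` v) = ?E \<inter> fst -` ?T"
    proof (intro equalityI subsetI)
      fix z assume z: "z \<in> ?E \<inter> fst -` ?T"
      then have "snd z \<in> C \<inter> p -` T" by auto
      then obtain u where "u \<in> v" "snd z \<in> u" using T(3) by blast
      then show "z \<in> \<Union>(?sh ` v)" using z by auto
    qed auto
    show "pairwise disjnt (?sh ` v)"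
      using T(5) unfolding pairwise_def disjnt_def by blast
    fix s assume "s \<in> ?sh ` v"
    then obtain u where u: "u \<in> v" "s = ?sh u" by blast
    have o1: "openin (top_of_set ?E) (?E \<inter> fst -` ?T)"
      by (rule continuous_openin_preimage[OF _ _ oT]) (auto intro: continuous_intros)
    have o2: "openin (top_of_set ?E) (?E \<inter> snd -` u)"
      by (rule continuous_openin_preimage[OF _ _ T(4)[OF u(1)]]) (auto intro: continuous_intros)
    have s: "s = (?E \<inter> fst -` ?T) \<inter> (?E \<inter> snd -` u)" using u(2) by blast
    show "openin (top_of_set ?E) s" unfolding s by (rule openin_Int[OF o1 o2])
    obtain q where q: "homeomorphism u T p q" using T(6)[OF u(1)] by blast
    have uC: "u \<subseteq> C" using T(3) u(1) by blast
    have q1: "continuous_on T q" "\<And>t. t \<in> T \<Longrightarrow> q t \<in> u" "\<And>t. t \<in> T \<Longrightarrow> p (q t) = t"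
        "\<And>y. y \<in> u \<Longrightarrow> p y \<in> T" "\<And>y. y \<in> u \<Longrightarrow> q (p y) = y"
      using q by (auto simp: homeomorphism_def)
    have "homeomorphism s ?T fst (\<lambda>x. (x, q (f x)))"
    proof (rule homeomorphismI)
      show "continuous_on s fst" by (intro continuous_intros)
      have fT: "continuous_on ?T f" by (rule continuous_on_subset[OF f(1)]) simp
      have "continuous_on ?T (\<lambda>x. q (f x))" by (rule continuous_on_compose2[OF q1(1) fT]) blast
      then show "continuous_on ?T (\<lambda>x. (x, q (f x)))"
        by (rule continuous_on_Pair[OF continuous_on_id])
      show "(\<lambda>x. (x, q (f x))) ` ?T \<subseteq> s"
        using q1(2,3) uC u(2) by auto
    qed (use q1 u(2) in auto)
    then show "\<exists>q. homeomorphism s ?T fst q" by blast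
  qed
qed

text \<open>
  A path joining two points of one fibre projects to a loop. A contraction of the loop is a map of
  the unit square; the covering pulled back to the square has a section, and uniqueness of lifts
  along the four edges of the square identifies the two endpoints of the path.
\<close>

lemma simply_connected_covering_injective:
  fixes p :: "'a::real_normed_vector \<Rightarrow> 'b::topological_space"
  assumes cov: "covering_space C p S" and C: "path_connected C" and S: "simply_connected S"
  shows "inj_on p C"
proof (rule inj_onI)
  fix x y assume xy: "x \<in> C" "y \<in> C" "p x = p y"
  let ?I = "{0..1::real}"
  obtain \<gamma> where \<gamma>: "path \<gamma>" "path_image \<gamma> \<subseteq> C" "pathstart \<gamma> = x" "pathfinish \<gamma> = y"
    using C xy unfolding path_connected_def by blast
  have cp: "continuous_on C p" and pC: "p ` C = S"
    using cov covering_space_imp_continuous covering_space_imp_surjective by blast+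
  have "path (p \<circ> \<gamma>)" using path_continuous_image[OF \<gamma>(1) continuous_on_subset[OF cp \<gamma>(2)]] .
  moreover have "path_image (p \<circ> \<gamma>) \<subseteq> S" using \<gamma>(2) pC by (auto simp: path_image_compose)
  moreover have "pathfinish (p \<circ> \<gamma>) = pathstart (p \<circ> \<gamma>)" using \<gamma> xy by (simp add: pathfinish_compose pathstart_compose)
  moreover have "path (\<lambda>t. p x)" "path_image (\<lambda>t. p x) \<subseteq> S" "pathfinish (\<lambda>t. p x) = pathstart (\<lambda>t. p x)"
    using xy pC by (auto simp: path_def path_image_def pathfinish_def pathstart_def)
  ultimately have "homotopic_loops S (p \<circ> \<gamma>) (\<lambda>t. p x)"
    using S unfolding simply_connected_def by blast
  then obtain h :: "real \<times> real \<Rightarrow> 'b" where h: "continuous_on (?I \<times> ?I) h" "h ` (?I \<times> ?I) \<subseteq> S"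
      "\<And>t. t \<in> ?I \<Longrightarrow> h (0, t) = p (\<gamma> t)" "\<And>t. t \<in> ?I \<Longrightarrow> h (1, t) = p x"
      "\<And>t. t \<in> ?I \<Longrightarrow> h (t, 1) = h (t, 0)"
    unfolding homotopic_loops by (auto simp: pathfinish_def pathstart_def image_subset_iff_funcset)
  let ?E = "{z \<in> (?I \<times> ?I) \<times> C. h (fst z) = p (snd z)}"
  have covE: "covering_space ?E fst (?I \<times> ?I)"
    by (rule covering_space_pullback[OF cov h(1)]) (use h(2) in auto)
  have conv: "convex (?I \<times> ?I)" by (intro convex_Times) auto
  have start: "((0, 0), x) \<in> ?E" using h(3)[of 0] xy \<gamma>(3) by (simp add: pathstart_def)
  obtain g where g: "continuous_on (?I \<times> ?I) g" "g \<in> ?I \<times> ?I \<rightarrow> ?E" "g (0, 0) = ((0, 0), x)"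
      "\<And>z. z \<in> ?I \<times> ?I \<Longrightarrow> fst (g z) = z"
    by (rule covering_space_lift_strong[OF covE start, of "(0, 0)" "?I \<times> ?I" "\<lambda>z. z"])
      (use conv in \<open>auto intro!: convex_imp_simply_connected convex_imp_locally_path_connected\<close>)
  define \<sigma> where "\<sigma> z = snd (g z)" for z
  have \<sigma>: "continuous_on (?I \<times> ?I) \<sigma>" "\<And>z. z \<in> ?I \<times> ?I \<Longrightarrow> \<sigma> z \<in> C" "\<And>z. z \<in> ?I \<times> ?I \<Longrightarrow> h z = p (\<sigma> z)"
  proof -
    show "continuous_on (?I \<times> ?I) \<sigma>" unfolding \<sigma>_def by (intro continuous_intros g(1))
    fix z assume z: "z \<in> ?I \<times> ?I"
    then have "g z \<in> ?E" using g(2) by blast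
    then show "\<sigma> z \<in> C" "h z = p (\<sigma> z)" using g(4)[OF z] by (auto simp: \<sigma>_def)
  qed
  have edge: "continuous_on ?I (\<lambda>t. k (c t))" if "continuous_on (?I \<times> ?I) k" "continuous_on ?I c" "c ` ?I \<subseteq> ?I \<times> ?I"
    for k :: "real \<times> real \<Rightarrow> 'd::topological_space" and c
    using continuous_on_compose2[OF that] .
  have I: "connected ?I" by simp
  have hS: "h (t, u) \<in> S" if "t \<in> ?I" "u \<in> ?I" for t u using h(2) that by blast
  have "\<sigma> (0, 1) = \<gamma> 1"
  proof (rule covering_space_lift_unique[OF cov, where T = "?I" and a = 0 and f = "\<lambda>t. h (0, t)"
        and ?g1.0 = "\<lambda>t. \<sigma> (0, t)" and ?g2.0 = \<gamma> and x = 1])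
    show "(\<lambda>t. h (0, t)) \<in> ?I \<rightarrow> S" by (rule Pi_I, rule hS) simp_all
    show "\<sigma> (0, 0) = \<gamma> 0" using g(3) \<gamma>(3) by (simp add: \<sigma>_def pathstart_def)
    show "continuous_on ?I \<gamma>" using \<gamma>(1) by (simp add: path_def)
    show "\<gamma> \<in> ?I \<rightarrow> C" using \<gamma>(2) by (auto simp: path_image_def)
  qed (use h \<sigma> in \<open>auto intro!: edge[OF h(1)] edge[OF \<sigma>(1)] continuous_intros\<close>)
  moreover have e: "\<sigma> (1, 1) = \<sigma> (1, 0)"
  proof (rule covering_space_lift_unique[OF cov, where T = "?I" and a = 0 and f = "\<lambda>t. h (1, t)"
        and ?g1.0 = "\<lambda>t. \<sigma> (1, t)" and ?g2.0 = "\<lambda>t. \<sigma> (1, 0)" and x = 1])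
    show "(\<lambda>t. h (1, t)) \<in> ?I \<rightarrow> S" by (rule Pi_I, rule hS) simp_all
    show "h (1, t) = p (\<sigma> (1, 0))" if "t \<in> ?I" for t using h(4)[OF that] h(4)[of 0] \<sigma>(3)[of "(1, 0)"] by simp
  qed (use h \<sigma> in \<open>auto intro!: edge[OF h(1)] edge[OF \<sigma>(1)] continuous_intros\<close>)
  moreover have "\<sigma> (0, 0) = \<sigma> (0, 1)"
  proof (rule covering_space_lift_unique[OF cov, where T = "?I" and a = 1 and f = "\<lambda>t. h (t, 0)"
        and ?g1.0 = "\<lambda>t. \<sigma> (t, 0)" and ?g2.0 = "\<lambda>t. \<sigma> (t, 1)" and x = 0])
    show "\<sigma> (1, 0) = \<sigma> (1, 1)" using e by simp
    show "(\<lambda>t. h (t, 0)) \<in> ?I \<rightarrow> S" by (rule Pi_I, rule hS) simp_all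
    show "h (t, 0) = p (\<sigma> (t, 1))" if "t \<in> ?I" for t using h(5)[OF that] that \<sigma>(3)[of "(t, 1)"] by simp
  qed (use h \<sigma> in \<open>auto intro!: edge[OF h(1)] edge[OF \<sigma>(1)] continuous_intros\<close>)
  ultimately show "x = y" using g(3) \<gamma>(4) by (simp add: \<sigma>_def pathfinish_def)
qed

section \<open>Global coordinates on the simply connected group\<close>

lemma simply_connected_imp_connected_top:
  fixes S :: "'t::topological_space set"
  assumes "simply_connected S" shows "connected S"
proof -
  have "path_component S x y" if "x \<in> S" "y \<in> S" for x y
  proof -
    have "path (\<lambda>t. z)" "path_image (\<lambda>t. z) \<subseteq> S" "pathfinish (\<lambda>t. z) = pathstart (\<lambda>t. z)" if "z \<in> S" for z :: 't
      using that by (auto simp: path_def path_image_def pathfinish_def pathstart_def)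
    then have "homotopic_loops S (\<lambda>t. x) (\<lambda>t. y)"
      using assms that unfolding simply_connected_def by simp
    from homotopic_loops_imp_path_component_value[OF this, of 0] show ?thesis by simp
  qed
  then show ?thesis
    by (intro path_connected_imp_connected) (simp add: path_connected_component)
qed

text \<open>
  The Lie algebra is split as a vector space into two abelian subalgebras, given as the ranges of the
  projections \<open>ps\<close> and \<open>pn\<close>; the second contains all brackets and is thus an ideal.
\<close>

locale lie_group_split = lie_group_log +
  fixes ps pn :: "'b \<Rightarrow> 'b"
  assumes linear_ps: "linear ps" and linear_pn: "linear pn"
    and split: "ps x + pn x = x" and ps_ps [simp]: "ps (ps x) = ps x"
    and ps_abelian: "br (ps x) (ps y) = 0" and pn_abelian: "br (pn x) (pn y) = 0"
    and ps_br [simp]: "ps (br x y) = 0"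
    and simply_connected_group: "simply_connected (UNIV :: 'a set)"
begin

lemma pn_eq: "pn x = x - ps x"
  using split[of x] by (simp add: algebra_simps)

lemma ps_pn [simp]: "ps (pn x) = 0"
  by (simp add: pn_eq linear_diff[OF linear_ps])

lemma pn_ps [simp]: "pn (ps x) = 0"
  by (simp add: pn_eq)

lemma pn_pn [simp]: "pn (pn x) = pn x"
  by (simp add: pn_eq[of "pn x"])

lemma ps_simps [simp]:
  "ps 0 = 0" "pn 0 = 0" "ps (x + y) = ps x + ps y" "pn (x + y) = pn x + pn y"
  "ps (x - y) = ps x - ps y" "pn (x - y) = pn x - pn y" "ps (- x) = - ps x" "pn (- x) = - pn x"
  "ps (c *\<^sub>R x) = c *\<^sub>R ps x" "pn (c *\<^sub>R x) = c *\<^sub>R pn x"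
  using linear_ps linear_pn
  by (simp_all add: linear_0 linear_add linear_diff linear_neg linear_scale)

lemma ps_AD_ex [simp]: "ps (AD (ex x) y) = ps y"
proof -
  have "((\<lambda>t. ps (AD (ex (t *\<^sub>R x)) y)) has_vector_derivative 0) (at t)" for t
    using bounded_linear.has_vector_derivative[OF _ AD_derivative(2), of ps] linear_ps
    by (simp add: linear_conv_bounded_linear)
  from constant_of_zero_derivative[OF this, of 1] show ?thesis by simp
qed

lemma pn_AD_ex: "pn (AD (ex x) (pn y)) = AD (ex x) (pn y)"
  by (simp add: pn_eq[of "AD (ex x) (pn y)"])

definition pt :: "'b \<Rightarrow> 'a" where "pt x = ex (pn x) \<otimes> ex (ps x)"

text \<open>
  With the factor in the abelian normal subgroup on the left, left translations become affine maps
  in these coordinates.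
\<close>

definition ltrans :: "'b \<Rightarrow> 'b \<Rightarrow> 'b" where "ltrans k y = k + (ps y + AD (ex (ps k)) (pn y))"

lemma ps_ltrans: "ps (ltrans k y) = ps k + ps y"
  by (simp add: ltrans_def)

lemma pn_ltrans: "pn (ltrans k y) = pn k + AD (ex (ps k)) (pn y)"
  by (simp add: ltrans_def pn_AD_ex)

lemma ex_ps_add: "ex (ps x) \<otimes> ex (ps y) = ex (ps x + ps y)"
  by (rule ex_commute[OF ps_abelian])

lemma ex_pn_add: "ex (pn x) \<otimes> ex (pn y) = ex (pn x + pn y)"
  by (rule ex_commute[OF pn_abelian])

lemma pt_ltrans: "pt (ltrans k y) = pt k \<otimes> pt y"
proof -
  have "pt (ltrans k y) = ex (pn k) \<otimes> ex (AD (ex (ps k)) (pn y)) \<otimes> (ex (ps k) \<otimes> ex (ps y))"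
    using ex_pn_add[of k "AD (ex (ps k)) (pn y)"]
    by (simp add: pt_def ps_ltrans pn_ltrans ex_ps_add pn_AD_ex)
  also have "\<dots> = pt k \<otimes> pt y"
    unfolding conj_ex[symmetric] pt_def by simp
  finally show ?thesis .
qed

lemma ltrans_0 [simp]: "ltrans k 0 = k"
  by (simp add: ltrans_def linear_0[OF linear_AD])

lemma smooth_pt: "smooth_map vector_atlas A pt"
  unfolding pt_def[abs_def] by (intro smooth_mult vector_atlas_open smooth_ex_linear linear_ps linear_pn)

lemma pt_0 [simp]: "pt 0 = \<one>"
  by (simp add: pt_def)

text \<open>
  The coordinates \<open>pt\<close> and the exponential map induce the same identification of tangent spaces.
\<close>

lemma tangent_pt: "tangent pt 0 = (\<lambda>h. h)"
proof -
  have "tangent (\<lambda>x. ex (ps x)) 0 = ps" "tangent (\<lambda>x. ex (pn x)) 0 = pn"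
    by (intro tangent_ex; simp add: smooth_on_linear linear_ps linear_pn linear_imp_has_derivative)+
  then have "tangent (\<lambda>x. ex (pn x) \<otimes> ex (ps x)) 0 = (\<lambda>h. pn h + ps h)"
    by (subst tangent_mult) (auto intro: smooth_ex_linear linear_ps linear_pn)
  moreover have "pn h + ps h = h" for h using split[of h] by (simp add: add.commute)
  ultimately show ?thesis by (simp add: pt_def[abs_def])
qed

lemma linear_affine_part: "linear (\<lambda>y. ps y + AD (ex (ps k)) (pn y))"
  by (intro linear_compose_add linear_ps linear_compose[OF linear_pn linear_AD, unfolded comp_def])

lemma smooth_ltrans: "smooth_on UNIV (ltrans k)"
  unfolding ltrans_def[abs_def]
  by (intro smooth_on_add smooth_on_const open_UNIV smooth_on_linear[OF open_UNIV linear_affine_part])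

definition ltrans_inv :: "'b \<Rightarrow> 'b \<Rightarrow> 'b" where
  "ltrans_inv k z = ps (z - k) + AD (ex (- ps k)) (pn (z - k))"

lemma ltrans_inverse: "ltrans k (ltrans_inv k z) = z" "ltrans_inv k (ltrans k y) = y"
proof -
  have *: "AD (ex a) (AD (ex (- a)) x) = x" "AD (ex (- a)) (AD (ex a) x) = x" for a x
    by (simp_all add: ex_minus)
  have "ltrans k (ps w + AD (ex (- ps k)) (pn w)) = k + w" for w
    using split[of w] by (simp add: ltrans_def pn_AD_ex *)
  then show "ltrans k (ltrans_inv k z) = z" by (simp add: ltrans_inv_def del: ps_simps)
  show "ltrans_inv k (ltrans k y) = y"
    using split[of y] by (simp add: ltrans_inv_def ps_ltrans pn_ltrans *)
qed

lemma linear_continuous: "linear (L :: 'b \<Rightarrow> 'b) \<Longrightarrow> continuous_on X L"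
  by (simp add: linear_continuous_on linear_conv_bounded_linear)

lemma homeomorphism_ltrans: "homeomorphism UNIV UNIV (ltrans k) (ltrans_inv k)"
proof (rule homeomorphismI)
  show "continuous_on UNIV (ltrans k)" by (rule smooth_on_imp_continuous_on[OF smooth_ltrans])
  have lin: "linear (\<lambda>y. ps y + AD (ex (- ps k)) (pn y))" using linear_affine_part[of "- k"] by simp
  show "continuous_on UNIV (ltrans_inv k)"
    unfolding ltrans_inv_def[abs_def]
    by (rule continuous_on_compose2[OF linear_continuous[OF lin, of UNIV]]) (auto intro: continuous_intros)
qed (auto simp: ltrans_inverse)

lemma ltrans_solve: obtains k where "ltrans k v = y"
proof -
  have "ltrans (ps y - ps v + (pn y - AD (ex (ps y - ps v)) (pn v))) v = y"
    using split[of y] by (simp add: ltrans_def)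
  then show ?thesis using that by blast
qed

lemma ltrans_left_cancel: assumes "ltrans k v = ltrans k' v" shows "k = k'"
proof -
  have "ps k = ps k'" using arg_cong[OF assms, of ps] by (simp add: ps_ltrans)
  then show ?thesis using assms by (simp add: ltrans_def)
qed

lemma pt_inverse_chart: obtains V1 W1 q where "inverse_chart pt V1 W1 q"
proof -
  obtain U0 \<phi>0 where c0: "(U0, \<phi>0) \<in> A" "\<one> \<in> U0" using open_charts_cover[OF charts] .
  have "((\<lambda>x. \<phi>0 (pt x)) has_derivative diff_id ex \<phi>0) (at 0)"
    using derivative_via_tangent[OF smooth_pt pt_0 diff_id_chart(1)[OF c0]] by (simp add: tangent_pt)
  then have "bij (frechet_derivative (\<lambda>x. \<phi>0 (pt x)) (at 0))"
    using diff_id_chart(2)[OF c0] by (simp add: frechet_derivative_eqI)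
  then show ?thesis using inverse_chart_exists[OF smooth_pt c0(1)] c0(2) that by auto
qed

lemma continuous_left: "continuous_on X (\<lambda>h. g \<otimes> h)"
  using smooth_map_continuous[OF smooth_left] continuous_on_subset by blast

lemma open_left_vimage: "open X \<Longrightarrow> open ((\<lambda>h. g \<otimes> h) -` X)"
  using smooth_map_open_vimage[OF smooth_left] .

text \<open>
  Since \<open>pt\<close> intertwines the translations \<open>ltrans\<close> with those of the group, a neighbourhood of \<open>0\<close> on
  which it is injective is carried to evenly covered neighbourhoods of all points. The range is an
  open subgroup: the equation \<open>ltrans k v = y\<close> can be solved for \<open>k\<close>, which replaces inverses. As the
  group is connected, the range is everything.
\<close>

lemma covering_pt: "covering_space UNIV pt (UNIV :: 'a set)"
proof -
  obtain V1 W1 q where q0: "inverse_chart pt V1 W1 q" by (rule pt_inverse_chart)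
  note V1 = inverse_chartD(1-3)[OF q0] and q = inverse_chartD(6-9,5)[OF q0]
  have W1: "\<one> \<in> W1" using inverse_chartD(4)[OF q0] by simp
  have nbhd: "open ((\<lambda>h. inv g \<otimes> h) -` W1)" "g \<in> (\<lambda>h. inv g \<otimes> h) -` W1" for g
    using open_left_vimage[OF V1(3)] W1 by auto
  have coset: "\<exists>k v. v \<in> V1 \<and> ltrans k v = y \<and> pt k = g" if "inv g \<otimes> pt y \<in> W1" for g y
  proof -
    from q(3)[OF that] q(4)[OF that] obtain v where v: "v \<in> V1" "pt v = inv g \<otimes> pt y" by blast
    obtain k where k: "ltrans k v = y" by (rule ltrans_solve)
    then have "pt k \<otimes> (inv g \<otimes> pt y) = pt y" using pt_ltrans[of k v] v by simp
    then have "pt k \<otimes> (inv g \<otimes> pt y) \<otimes> inv (pt y) = pt y \<otimes> inv (pt y)" by presburger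
    then have "pt k \<otimes> inv g = \<one>" by simp
    then have "pt k = g" using inv_equality[of "pt k" "inv g"] by simp
    with v k show ?thesis by blast
  qed
  have "range pt = UNIV"
  proof -
    have "open (range pt)"
    proof (subst open_subopen, rule ballI)
      fix g assume "g \<in> range pt"
      then obtain k where k: "g = pt k" by blast
      have "(\<lambda>h. inv (pt k) \<otimes> h) -` W1 \<subseteq> range pt"
      proof
        fix h assume "h \<in> (\<lambda>h. inv (pt k) \<otimes> h) -` W1"
        then have "pt (q (inv (pt k) \<otimes> h)) = inv (pt k) \<otimes> h" using q(4) by simp
        then obtain v where "pt v = inv (pt k) \<otimes> h" by blast
        then have "pt (ltrans k v) = h" by (simp add: pt_ltrans)
        then show "h \<in> range pt" by blast
      qed
      then show "\<exists>T. open T \<and> g \<in> T \<and> T \<subseteq> range pt"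
        using nbhd[of g] k by (intro exI[of _ "(\<lambda>h. inv g \<otimes> h) -` W1"]) simp
    qed
    moreover have "open (- range pt)"
    proof (subst open_subopen, rule ballI)
      fix g assume g: "g \<in> - range pt"
      have "(\<lambda>h. inv g \<otimes> h) -` W1 \<subseteq> - range pt"
      proof (rule subsetI, rule ComplI)
        fix h assume "h \<in> (\<lambda>h. inv g \<otimes> h) -` W1" "h \<in> range pt"
        then obtain y where "inv g \<otimes> pt y \<in> W1" by auto
        then show False using coset g by blast
      qed
      then show "\<exists>T. open T \<and> g \<in> T \<and> T \<subseteq> - range pt"
        using nbhd[of g] by (intro exI[of _ "(\<lambda>h. inv g \<otimes> h) -` W1"]) simp
    qed
    moreover have "connected (UNIV :: 'a set)"
      by (rule simply_connected_imp_connected_top[OF simply_connected_group])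
    then have "\<forall>T :: 'a set. open T \<and> closed T \<longrightarrow> T = {} \<or> T = UNIV"
      by (simp add: connected_clopen)
    ultimately show ?thesis by (metis UNIV_not_empty closed_def image_is_empty)
  qed
  moreover have "\<exists>T. g \<in> T \<and> openin (top_of_set UNIV) T \<and> (\<exists>v. \<Union>v = UNIV \<inter> pt -` T \<and>
      (\<forall>u\<in>v. openin (top_of_set UNIV) u) \<and> pairwise disjnt v \<and> (\<forall>u\<in>v. \<exists>q. homeomorphism u T pt q))" for g
  proof (intro exI[of _ "(\<lambda>h. inv g \<otimes> h) -` W1"] exI[of _ "(\<lambda>k. ltrans k ` V1) ` (pt -` {g})"] conjI ballI)
    let ?T = "(\<lambda>h. inv g \<otimes> h) -` W1" and ?v = "(\<lambda>k. ltrans k ` V1) ` (pt -` {g})"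
    show "g \<in> ?T" "openin (top_of_set UNIV) ?T" using nbhd[of g] by auto
    have in_T: "pt (ltrans k v) \<in> ?T" if "v \<in> V1" "pt k = g" for k v
      using that q by (auto simp: pt_ltrans)
    show "\<Union>?v = UNIV \<inter> pt -` ?T"
    proof (intro equalityI subsetI)
      fix y assume "y \<in> UNIV \<inter> pt -` ?T"
      then obtain k v where "v \<in> V1" "ltrans k v = y" "pt k = g" using coset[of g y] by auto
      then show "y \<in> \<Union>?v" by auto
    qed (use in_T in auto)
    show "pairwise disjnt ?v"
    proof -
      have "k = k'" if "pt k = g" "pt k' = g" "v \<in> V1" "v' \<in> V1" "ltrans k v = ltrans k' v'" for k k' v v'
      proof -
        have "g \<otimes> pt v = g \<otimes> pt v'" using pt_ltrans[of k v] pt_ltrans[of k' v'] that by simp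
        then have "pt v = pt v'" by (metis group_simps(8))
        then have "v = v'" using that q(2) by metis
        then show ?thesis using that ltrans_left_cancel by blast
      qed
      then show ?thesis unfolding pairwise_def disjnt_def by blast
    qed
    fix u assume "u \<in> ?v"
    then obtain k where k: "pt k = g" "u = ltrans k ` V1" by auto
    show "openin (top_of_set UNIV) u"
      using homeomorphism_imp_open_map[OF homeomorphism_ltrans, of V1 k] V1(1) k(2) by simp
    have "homeomorphism u ?T pt (\<lambda>h. ltrans k (q (inv g \<otimes> h)))"
    proof (rule homeomorphismI)
      show "continuous_on u pt" using smooth_map_continuous[OF smooth_pt] continuous_on_subset by blast
      have "continuous_on ?T (\<lambda>h. q (inv g \<otimes> h))"
        by (rule continuous_on_compose2[OF _ continuous_left, of W1]) (use q in auto)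
      then show "continuous_on ?T (\<lambda>h. ltrans k (q (inv g \<otimes> h)))"
        by (rule continuous_on_compose2[OF smooth_on_imp_continuous_on[OF smooth_ltrans]]) auto
      show "pt ` u \<subseteq> ?T" using in_T k by auto
      show "(\<lambda>h. ltrans k (q (inv g \<otimes> h))) ` ?T \<subseteq> u" using q k(2) by auto
      show "ltrans k (q (inv g \<otimes> pt x)) = x" if "x \<in> u" for x
        using that k q by (auto simp: pt_ltrans)
      show "pt (ltrans k (q (inv g \<otimes> h))) = h" if "h \<in> ?T" for h
        using that k q by (simp add: pt_ltrans)
    qed
    then show "\<exists>q. homeomorphism u ?T pt q" by blast
  qed
  ultimately show ?thesis
    using smooth_map_continuous[OF smooth_pt] by (intro covering_spaceI) auto
qed

lemma surj_pt: "\<exists>x. g = pt x"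
  using covering_space_imp_surjective[OF covering_pt] by (metis UNIV_I imageE)

lemma inj_pt: "inj pt"
  by (rule simply_connected_covering_injective[OF covering_pt _ simply_connected_group])
    (simp add: convex_imp_path_connected)

lemma pt_eq_iff [simp]: "pt x = pt y \<longleftrightarrow> x = y"
  using inj_pt by (simp add: inj_eq)

lemma open_pt:
  assumes "open X" shows "open (pt ` X)"
proof (subst open_subopen, rule ballI)
  fix g assume "g \<in> pt ` X"
  then obtain x where x: "x \<in> X" "g = pt x" by blast
  obtain T u q where *: "x \<in> T" "open T" "pt x \<in> u" "open u" "homeomorphism T u pt q"
    using covering_space_local_homeomorphism[OF covering_pt UNIV_I[of x]] by auto
  have "openin (top_of_set T) (T \<inter> X)" using assms by (simp add: openin_open_Int)
  then have "open (pt ` (T \<inter> X))"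
    using homeomorphism_imp_open_map[OF *(5)] *(4) openin_open_eq by blast
  then show "\<exists>T. open T \<and> g \<in> T \<and> T \<subseteq> pt ` X" using x *(1) by blast
qed

text \<open>
  The inverse of \<open>pt\<close> is smooth near the identity, and translations carry this to all other points; so
  smoothness can be tested in the global coordinates.
\<close>

lemma smooth_function_iff:
  fixes f :: "'a \<Rightarrow> 'v::real_normed_vector"
  shows "smooth_map A vector_atlas f \<longleftrightarrow> smooth_on UNIV (\<lambda>x. f (pt x))"
proof
  assume "smooth_map A vector_atlas f"
  then show "smooth_on UNIV (\<lambda>x. f (pt x))" by (rule smooth_function_compose[OF _ smooth_pt])
next
  assume f: "smooth_on UNIV (\<lambda>x. f (pt x))"
  obtain V1 W1 q where q: "inverse_chart pt V1 W1 q" by (rule pt_inverse_chart)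
  note W1 = inverse_chartD(3,4)[OF q]
  have "continuous_on UNIV f"
    unfolding continuous_on_open_vimage[OF open_UNIV]
  proof safe
    fix X :: "'v set" assume "open X"
    then have "open ((\<lambda>x. f (pt x)) -` X)"
      using smooth_on_imp_continuous_on[OF f] open_vimage by blast
    then have "open (pt ` ((\<lambda>x. f (pt x)) -` X))" by (rule open_pt)
    moreover have "pt ` ((\<lambda>x. f (pt x)) -` X) = f -` X"
      using surj_pt by (auto simp: image_iff vimage_def) metis
    ultimately show "open (f -` X \<inter> UNIV)" by simp
  qed
  moreover have "smooth_on (\<phi> ` U) (\<lambda>z. f (inv_into U \<phi> z))" if c: "(U, \<phi>) \<in> A" for U \<phi>
  proof (rule smooth_on_local)
    note U = open_chartsD[OF charts c]
    fix z assume "z \<in> \<phi> ` U"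
    then obtain g where g: "g \<in> U" "z = \<phi> g" by blast
    obtain k where k: "g = pt k" using surj_pt by blast
    let ?F = "\<lambda>h. inv g \<otimes> h"
    let ?Z = "\<phi> ` (U \<inter> ?F -` W1)"
    have oZ: "open ?Z" using U(3)[OF open_left_vimage[OF W1(1)]] .
    have 2: "smooth_on ?Z (\<lambda>z. q (?F (inv_into U \<phi> z)))"
      by (rule smooth_on_chart_compose[OF charts charts smooth_left W1(1) c]) (rule inverse_chartD(10)[OF q])
    have 3: "smooth_on UNIV (\<lambda>x. f (pt (ltrans k x)))"
      by (rule smooth_on_compose[OF open_UNIV open_UNIV _ smooth_ltrans f]) simp
    have "smooth_on ?Z (\<lambda>z. f (pt (ltrans k (q (?F (inv_into U \<phi> z))))))"
      by (rule smooth_on_compose[OF oZ open_UNIV _ 2 3]) simp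
    then have "smooth_on ?Z (\<lambda>z. f (inv_into U \<phi> z))"
      by (rule smooth_on_cong_imp[OF oZ, rotated]) (use U(2) inverse_chartD(9)[OF q] k in \<open>auto simp: pt_ltrans\<close>)
    then show "\<exists>Z. open Z \<and> z \<in> Z \<and> smooth_on Z (\<lambda>z. f (inv_into U \<phi> z))"
      using oZ g W1(2) by (intro exI[of _ ?Z]) auto
  qed
  ultimately show "smooth_map A vector_atlas f"
    by (auto simp: smooth_map_def vector_atlas_def comp_def)
qed

end

section \<open>Bivectors in coordinates\<close>

abbreviation ev :: "'a::euclidean_space bilin \<Rightarrow> 'a dual \<Rightarrow> 'a dual \<Rightarrow> real" where
  "ev r \<alpha> \<beta> \<equiv> blinfun_apply (blinfun_apply r \<alpha>) \<beta>"

lemma ev_simps [simp]: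
  "ev (r + r') \<alpha> \<beta> = ev r \<alpha> \<beta> + ev r' \<alpha> \<beta>" "ev (r - r') \<alpha> \<beta> = ev r \<alpha> \<beta> - ev r' \<alpha> \<beta>"
  "ev (- r) \<alpha> \<beta> = - ev r \<alpha> \<beta>" "ev (c *\<^sub>R r) \<alpha> \<beta> = c * ev r \<alpha> \<beta>" "ev 0 \<alpha> \<beta> = 0"
  "ev r (\<alpha> + \<alpha>') \<beta> = ev r \<alpha> \<beta> + ev r \<alpha>' \<beta>" "ev r \<alpha> (\<beta> + \<beta>') = ev r \<alpha> \<beta> + ev r \<alpha> \<beta>'"
  "ev r (\<alpha> - \<alpha>') \<beta> = ev r \<alpha> \<beta> - ev r \<alpha>' \<beta>" "ev r \<alpha> (\<beta> - \<beta>') = ev r \<alpha> \<beta> - ev r \<alpha> \<beta>'"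
  "ev r (- \<alpha>) \<beta> = - ev r \<alpha> \<beta>" "ev r \<alpha> (- \<beta>) = - ev r \<alpha> \<beta>"
  "ev r (c *\<^sub>R \<alpha>) \<beta> = c * ev r \<alpha> \<beta>" "ev r \<alpha> (c *\<^sub>R \<beta>) = c * ev r \<alpha> \<beta>"
  "ev r 0 \<beta> = 0" "ev r \<alpha> 0 = 0"
  by (simp_all add: blinfun.bilinear_simps)

lemma bilin_eqI: "(\<And>\<alpha> \<beta>. ev r \<alpha> \<beta> = ev r' \<alpha> \<beta>) \<Longrightarrow> r = r'"
  by (intro blinfun_eqI) auto

lemma ev_sum: "ev (\<Sum>i\<in>I. f i) \<alpha> \<beta> = (\<Sum>i\<in>I. ev (f i) \<alpha> \<beta>)"
  by (induction I rule: infinite_finite_induct) auto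

lemma ev_sum_left: "ev r (\<Sum>i\<in>I. f i) \<beta> = (\<Sum>i\<in>I. ev r (f i) \<beta>)"
  and ev_sum_right: "ev r \<beta> (\<Sum>i\<in>I. f i) = (\<Sum>i\<in>I. ev r \<beta> (f i))"
  by (induction I rule: infinite_finite_induct) auto

lemma dual_expand:
  fixes \<alpha> :: "'a::euclidean_space dual"
  shows "\<alpha> = (\<Sum>i\<in>Basis. blinfun_apply \<alpha> i *\<^sub>R blinfun_inner_left i)"
proof (rule blinfun_eqI)
  fix x
  have "blinfun_apply \<alpha> x = (\<Sum>i\<in>Basis. (x \<bullet> i) *\<^sub>R blinfun_apply \<alpha> i)"
    by (rule linear_expand_Basis) (simp add: blinfun.bounded_linear_right bounded_linear.linear)
  then show "blinfun_apply \<alpha> x = blinfun_apply (\<Sum>i\<in>Basis. blinfun_apply \<alpha> i *\<^sub>R blinfun_inner_left i) x"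
    by (simp add: blinfun.sum_left blinfun.scaleR_left blinfun_inner_left.rep_eq mult.commute)
qed

lemma ev_expand:
  fixes r :: "'a::euclidean_space bilin"
  shows "ev r \<alpha> \<beta> = (\<Sum>i\<in>Basis. \<Sum>j\<in>Basis. blinfun_apply \<alpha> i * blinfun_apply \<beta> j *
     ev r (blinfun_inner_left i) (blinfun_inner_left j))"
  by (subst (1) dual_expand[of \<alpha>], subst (1) dual_expand[of \<beta>])
    (simp add: ev_sum_left ev_sum_right sum_distrib_left ac_simps, rule sum.swap)

definition unit_bilin :: "'a::euclidean_space \<Rightarrow> 'a \<Rightarrow> 'a bilin" where
  "unit_bilin u v = mk_bilin (\<lambda>\<alpha> \<beta>. blinfun_apply \<alpha> u * blinfun_apply \<beta> v)"

lemma bilin_expand: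
  fixes r :: "'a::euclidean_space bilin"
  shows "r = (\<Sum>i\<in>Basis. \<Sum>j\<in>Basis. ev r (blinfun_inner_left i) (blinfun_inner_left j) *\<^sub>R unit_bilin i j)"
proof (rule bilin_eqI)
  fix \<alpha> \<beta>
  have "ev (unit_bilin u v) \<alpha> \<beta> = blinfun_apply \<alpha> u * blinfun_apply \<beta> v" for u v :: 'a
    unfolding unit_bilin_def by (rule mk_bilin_apply, rule bounded_bilinear.comp[OF bounded_bilinear_mult
          blinfun.bounded_linear_left blinfun.bounded_linear_left])
  then show "ev r \<alpha> \<beta> = ev (\<Sum>i\<in>Basis. \<Sum>j\<in>Basis. ev r (blinfun_inner_left i) (blinfun_inner_left j) *\<^sub>R unit_bilin i j) \<alpha> \<beta>"
    by (subst ev_expand) (simp add: ev_sum ac_simps)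
qed

text \<open>
  A bilinear form on the dual is determined by finitely many coefficients; continuity of linear maps,
  smoothness and derivatives are reduced to these.
\<close>

lemma bounded_linear_bilin:
  fixes L :: "'a::euclidean_space bilin \<Rightarrow> 'v::real_normed_vector"
  assumes L: "linear L" shows "bounded_linear L"
proof -
  have "bounded_linear (\<lambda>r. ev r \<alpha> \<beta>)" for \<alpha> \<beta> :: "'a dual"
    by (intro bounded_linear_compose[OF blinfun.bounded_linear_left blinfun.bounded_linear_left])
  then have bl: "bounded_linear (\<lambda>r. \<Sum>i\<in>Basis. \<Sum>j\<in>Basis.
      ev r (blinfun_inner_left i) (blinfun_inner_left j) *\<^sub>R L (unit_bilin i j))"
    by (intro bounded_linear_sum bounded_linear_compose[OF bounded_linear_scaleR_left]) auto
  have eq: "L = (\<lambda>r. \<Sum>i\<in>Basis. \<Sum>j\<in>Basis. ev r (blinfun_inner_left i) (blinfun_inner_left j) *\<^sub>R L (unit_bilin i j))"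
    by (rule ext, subst (1) bilin_expand) (simp add: linear_sum[OF L] linear_scale[OF L])
  show ?thesis by (subst eq) (rule bl)
qed

lemma smooth_on_bilin:
  fixes f :: "'e::euclidean_space \<Rightarrow> 'a::euclidean_space bilin"
  assumes "open U" "\<And>\<alpha> \<beta>. smooth_on U (\<lambda>x. ev (f x) \<alpha> \<beta>)"
  shows "smooth_on U f"
proof -
  have "smooth_on U (\<lambda>x. \<Sum>i\<in>Basis. \<Sum>j\<in>Basis. ev (f x) (blinfun_inner_left i) (blinfun_inner_left j) *\<^sub>R unit_bilin i j)"
    by (intro smooth_on_sum smooth_on_scaleR smooth_on_const assms)
  then show ?thesis by (simp flip: bilin_expand)
qed

lemma has_vector_derivative_bilin:
  fixes f :: "real \<Rightarrow> 'a::euclidean_space bilin"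
  assumes "\<And>\<alpha> \<beta>. ((\<lambda>t. ev (f t) \<alpha> \<beta>) has_vector_derivative ev D \<alpha> \<beta>) (at t)"
  shows "(f has_vector_derivative D) (at t)"
proof -
  have "((\<lambda>t. \<Sum>i\<in>Basis. \<Sum>j\<in>Basis. ev (f t) (blinfun_inner_left i) (blinfun_inner_left j) *\<^sub>R unit_bilin i j)
     has_vector_derivative (\<Sum>i\<in>Basis. \<Sum>j\<in>Basis. ev D (blinfun_inner_left i) (blinfun_inner_left j) *\<^sub>R unit_bilin i j)) (at t)"
    by (intro has_vector_derivative_sum bounded_linear.has_vector_derivative[OF bounded_linear_scaleR_left] assms)
  then show ?thesis by (simp flip: bilin_expand)
qed

lemma has_vector_derivative_dual:
  fixes f :: "real \<Rightarrow> 'a::euclidean_space dual"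
  assumes "\<And>x. ((\<lambda>t. blinfun_apply (f t) x) has_vector_derivative blinfun_apply D x) (at t)"
  shows "(f has_vector_derivative D) (at t)"
proof -
  have "((\<lambda>t. \<Sum>i\<in>Basis. blinfun_apply (f t) i *\<^sub>R blinfun_inner_left i)
     has_vector_derivative (\<Sum>i\<in>Basis. blinfun_apply D i *\<^sub>R blinfun_inner_left i)) (at t)"
    by (intro has_vector_derivative_sum bounded_linear.has_vector_derivative[OF bounded_linear_scaleR_left] assms)
  then show ?thesis by (simp flip: dual_expand)
qed

lemma bivectors_skew: "r \<in> bivectors \<Longrightarrow> ev r \<alpha> \<beta> = - ev r \<beta> \<alpha>"
proof -
  assume r: "r \<in> bivectors"
  then have "ev r (\<alpha> + \<beta>) (\<alpha> + \<beta>) = 0" "ev r \<alpha> \<alpha> = 0" "ev r \<beta> \<beta> = 0"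
    unfolding bivectors_def by blast+
  then show ?thesis by simp
qed

lemma bivectors_arith:
  "r \<in> bivectors \<Longrightarrow> r' \<in> bivectors \<Longrightarrow> r + r' \<in> bivectors"
  "r \<in> bivectors \<Longrightarrow> r' \<in> bivectors \<Longrightarrow> r - r' \<in> bivectors"
  "r \<in> bivectors \<Longrightarrow> c *\<^sub>R r \<in> bivectors"
  by (auto simp: bivectors_def)

lemma ext_mult_bivectors: "linear T \<Longrightarrow> r \<in> bivectors \<Longrightarrow> ext_mult T r \<in> bivectors"
  by (simp add: bivectors_def ext_mult_apply)

lemma ext_deriv_bivectors: "linear T \<Longrightarrow> r \<in> bivectors \<Longrightarrow> ext_deriv T r \<in> bivectors"
proof -
  assume "linear T" and r: "r \<in> bivectors"
  then show "ext_deriv T r \<in> bivectors"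
    using bivectors_skew[OF r, of "transpose_map T \<alpha>" \<alpha> for \<alpha>]
    unfolding bivectors_def by (simp add: ext_deriv_apply)
qed

lemma transpose_map_compose:
  assumes "linear S" "linear T"
  shows "transpose_map T (transpose_map S \<alpha>) = transpose_map (\<lambda>x. S (T x)) \<alpha>"
  using linear_compose[OF assms(2,1)] assms by (intro blinfun_eqI) (simp add: transpose_map_apply comp_def)

lemma linear_ext_mult: assumes "linear T" shows "linear (ext_mult T)"
  by (rule linearI; rule bilin_eqI) (simp_all add: ext_mult_apply assms)

lemma linear_ext_deriv: assumes "linear T" shows "linear (ext_deriv T)"
  by (rule linearI; rule bilin_eqI) (simp_all add: ext_deriv_apply assms algebra_simps)

section \<open>Group cocycles\<close>

lemma has_vector_derivative_shift:
  assumes "(f has_vector_derivative D) (at 0)"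
  shows "((\<lambda>u. f (u - t)) has_vector_derivative D) (at t)"
proof -
  have "((\<lambda>u. u - t) has_vector_derivative 1 - 0) (at t)"
    by (rule has_vector_derivative_diff[OF has_vector_derivative_id has_vector_derivative_const])
  then show ?thesis using vector_diff_chain_at[of "\<lambda>u. u - t" 1 t f D] assms by (simp add: comp_def)
qed

context lie_group_log
begin

abbreviation ADB :: "'a \<Rightarrow> 'b bilin \<Rightarrow> 'b bilin" where "ADB g \<equiv> ext_mult (AD g)"
abbreviation adb :: "'b \<Rightarrow> 'b bilin \<Rightarrow> 'b bilin" where "adb x \<equiv> ext_deriv (br x)"

lemmas linear_ADB = linear_ext_mult[OF linear_AD] and linear_adb_right = linear_ext_deriv[OF linear_br_right]

lemma linear_adb_left: "linear (\<lambda>x. adb x r)"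
proof -
  have "transpose_map (br (x + y)) \<alpha> = transpose_map (br x) \<alpha> + transpose_map (br y) \<alpha>"
      "transpose_map (br (c *\<^sub>R x)) \<alpha> = c *\<^sub>R transpose_map (br x) \<alpha>" for x y c \<alpha>
    by (rule blinfun_eqI, simp add: transpose_map_apply linear_br_right br_add_left br_scale_left
        blinfun.bilinear_simps)+
  then show ?thesis
    by (intro linearI bilin_eqI) (simp_all add: ext_deriv_apply linear_br_right algebra_simps)
qed

lemma ADB_one [simp]: "ADB \<one> r = r"
proof -
  have "transpose_map (AD \<one>) \<alpha> = \<alpha>" for \<alpha>
    by (rule blinfun_eqI) (simp add: transpose_map_apply linear_AD)
  then show ?thesis by (intro bilin_eqI) (simp add: ext_mult_apply linear_AD)
qed

lemma ADB_mult: "ADB (g \<otimes> h) r = ADB g (ADB h r)"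
  by (rule bilin_eqI) (simp add: ext_mult_apply linear_AD transpose_map_compose AD_mult[symmetric])

lemma ADB_inv [simp]: "ADB g (ADB (inv g) r) = r"
  by (simp flip: ADB_mult)

lemma ADB_adb: "ADB g (adb x r) = adb (AD g x) (ADB g r)"
  by (rule bilin_eqI)
    (simp add: ext_mult_apply ext_deriv_apply linear_AD linear_br_right transpose_map_compose AD_br)

text \<open>
  The product rule for the action on a moving bivector; it serves to integrate infinitesimal
  equivariance.
\<close>

lemma ADB_curve_derivative:
  assumes "(r has_vector_derivative r') (at t)"
  shows "((\<lambda>t. ADB (ex (t *\<^sub>R x)) (r t)) has_vector_derivative ADB (ex (t *\<^sub>R x)) (r' + adb x (r t))) (at t)"
proof (rule has_vector_derivative_bilin)
  fix \<alpha> \<beta>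
  let ?T = "\<lambda>t. transpose_map (AD (ex (t *\<^sub>R x)))"
  let ?T' = "\<lambda>\<alpha>. transpose_map (br x) (?T t \<alpha>)"
  have T: "((\<lambda>t. ?T t \<alpha>) has_vector_derivative ?T' \<alpha>) (at t)" for \<alpha>
  proof (rule has_vector_derivative_dual)
    fix y
    have "((\<lambda>t. blinfun_apply \<alpha> (AD (ex (t *\<^sub>R x)) y)) has_vector_derivative
        blinfun_apply \<alpha> (AD (ex (t *\<^sub>R x)) (br x y))) (at t)"
      by (rule bounded_linear.has_vector_derivative[OF blinfun.bounded_linear_right AD_derivative(1)])
    then show "((\<lambda>t. blinfun_apply (?T t \<alpha>) y) has_vector_derivative blinfun_apply (?T' \<alpha>) y) (at t)"
      by (simp add: transpose_map_apply linear_AD linear_br_right)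
  qed
  have "((\<lambda>t. ev (r t) (?T t \<alpha>) (?T t \<beta>)) has_vector_derivative
      (blinfun_apply (blinfun_apply (r t) (?T t \<alpha>)) (?T' \<beta>) +
       blinfun_apply (blinfun_apply (r t) (?T' \<alpha>) + blinfun_apply r' (?T t \<alpha>)) (?T t \<beta>))) (at t)"
    by (intro bounded_bilinear.has_vector_derivative[OF bounded_bilinear_blinfun_apply] T assms)
  then show "((\<lambda>t. ev (ADB (ex (t *\<^sub>R x)) (r t)) \<alpha> \<beta>) has_vector_derivative
      ev (ADB (ex (t *\<^sub>R x)) (r' + adb x (r t))) \<alpha> \<beta>) (at t)"
    by (simp add: ext_mult_apply ext_deriv_apply linear_AD linear_br_right blinfun.add_left ac_simps)
qed

lemma ADB_derivative:
  "((\<lambda>t. ADB (ex (t *\<^sub>R x)) r) has_vector_derivative ADB (ex (t *\<^sub>R x)) (adb x r)) (at t)"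
  using ADB_curve_derivative[where r = "\<lambda>t. r" and r' = 0] by simp

lemma ADB_ex_fixed: assumes "adb x r = 0" shows "ADB (ex x) r = r"
  using constant_of_zero_derivative[of "\<lambda>t. ADB (ex (t *\<^sub>R x)) r" 1] ADB_derivative[of x r] assms
  by (simp add: linear_0[OF linear_ADB])

lemma ADB_ex_nilpotent: assumes "adb x (adb x r) = 0" shows "ADB (ex x) r = r + adb x r"
proof -
  have fixed: "ADB (ex (t *\<^sub>R x)) (adb x r) = adb x r" for t
    by (rule ADB_ex_fixed) (simp add: assms linear_scale[OF linear_adb_left])
  have "((\<lambda>t. ADB (ex (t *\<^sub>R x)) r - t *\<^sub>R adb x r) has_vector_derivative 0) (at t)" for t
    using ADB_derivative[of x r t] by (auto simp: fixed intro!: derivative_eq_intros)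
  from constant_of_zero_derivative[OF this, of 1] show ?thesis by (simp add: algebra_simps)
qed

lemma group_cocycleD:
  assumes "group_cocycle G A ex \<Phi>"
  shows "smooth_map A vector_atlas \<Phi>" "\<Phi> g \<in> bivectors" "\<Phi> (g \<otimes> h) = \<Phi> g + ADB g (\<Phi> h)" "\<Phi> \<one> = 0"
proof -
  show *: "smooth_map A vector_atlas \<Phi>" "\<Phi> g \<in> bivectors" "\<Phi> (g \<otimes> h) = \<Phi> g + ADB g (\<Phi> h)" for g h
    using assms by (auto simp: group_cocycle_def)
  show "\<Phi> \<one> = 0" using *(3)[of \<one> \<one>] by simp
qed

lemma diff_id_derivative:
  fixes f :: "'a \<Rightarrow> 'v::real_normed_vector"
  assumes "smooth_map A vector_atlas f"
  shows "((\<lambda>x. f (ex x)) has_derivative diff_id ex f) (at 0)"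
  using smooth_on_has_derivative[OF smooth_function_compose[OF assms smooth_ex], of 0]
  by (simp add: diff_id_def comp_def)

lemma diff_id_along:
  fixes f :: "'a \<Rightarrow> 'v::real_normed_vector"
  assumes "smooth_map A vector_atlas f"
  shows "((\<lambda>t. f (ex (t *\<^sub>R x))) has_vector_derivative diff_id ex f x) (at 0)"
proof -
  have "((\<lambda>t. t *\<^sub>R x) has_derivative (\<lambda>h. h *\<^sub>R x)) (at (0::real))"
    by (auto intro!: derivative_eq_intros)
  from has_derivative_compose[OF this, of "\<lambda>x. f (ex x)" "diff_id ex f"] diff_id_derivative[OF assms]
  show ?thesis
    using linear_scale[OF has_derivative_linear[OF diff_id_derivative[OF assms]]]
    by (simp add: has_vector_derivative_def)
qed

lemma integrates_iff:
  assumes "smooth_map A vector_atlas \<Phi>"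
  shows "integrates ex \<Phi> \<xi> \<longleftrightarrow> (\<forall>x. ((\<lambda>t. \<Phi> (ex (t *\<^sub>R x))) has_vector_derivative \<xi> x) (at 0))"
proof -
  have "integrates ex \<Phi> \<xi> \<longleftrightarrow> diff_id ex \<Phi> = \<xi>"
    unfolding integrates_def comp_def
    using diff_id_derivative[OF assms] has_derivative_unique by blast
  also have "\<dots> \<longleftrightarrow> (\<forall>x. ((\<lambda>t. \<Phi> (ex (t *\<^sub>R x))) has_vector_derivative \<xi> x) (at 0))"
    using diff_id_along[OF assms] vector_derivative_unique_at by (auto simp: fun_eq_iff) blast
  finally show ?thesis .
qed

text \<open>
  Expand \<open>\<Phi> (ex (h x) \<otimes> g') = \<Phi> (ex (h x)) + ADB (ex (h x)) (\<Phi> g')\<close> to first order in \<open>h\<close>.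
\<close>

lemma cocycle_left_derivative:
  assumes "group_cocycle G A ex \<Phi>" "integrates ex \<Phi> \<xi>"
  shows "((\<lambda>t. \<Phi> (ex (t *\<^sub>R x) \<otimes> g)) has_vector_derivative
     \<xi> x + adb x (\<Phi> (ex (t *\<^sub>R x) \<otimes> g))) (at t)"
proof -
  note \<Phi> = group_cocycleD[OF assms(1)]
  let ?g = "ex (t *\<^sub>R x) \<otimes> g"
  have 1: "((\<lambda>u. \<Phi> (ex (u *\<^sub>R x) \<otimes> ?g)) has_vector_derivative \<xi> x + adb x (\<Phi> ?g)) (at 0)"
    unfolding \<Phi>(3)
    by (intro has_vector_derivative_add)
      (use assms(2) integrates_iff[OF \<Phi>(1)] ADB_derivative[of x "\<Phi> ?g" 0] \<Phi>(3) in auto)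
  have "((\<lambda>u. \<Phi> (ex ((u - t) *\<^sub>R x) \<otimes> ?g)) has_vector_derivative \<xi> x + adb x (\<Phi> ?g)) (at t)"
    using has_vector_derivative_shift[OF 1] .
  moreover have "ex ((u - t) *\<^sub>R x) \<otimes> ?g = ex (u *\<^sub>R x) \<otimes> g" for u
    using ex_add[of "u - t" t x] by simp
  ultimately show ?thesis by simp
qed

text \<open>
  The difference \<open>D\<close> of the two cocycles is a cocycle whose derivative at the identity is zero. Since
  \<open>D (g \<otimes> h) = D g + ADB g (D h)\<close>, it is constant along one-parameter subgroups.
\<close>

lemma cocycles_agree_on_exponentials:
  assumes "group_cocycle G A ex \<Phi>" "integrates ex \<Phi> \<xi>" "group_cocycle G A ex \<Psi>" "integrates ex \<Psi> \<xi>"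
  shows "\<Phi> (ex x) = \<Psi> (ex x)"
proof -
  note \<Phi> = group_cocycleD[OF assms(1)] and \<Psi> = group_cocycleD[OF assms(3)]
  let ?D = "\<lambda>g. \<Phi> g - \<Psi> g"
  have D: "((\<lambda>u. ?D (ex (u *\<^sub>R x))) has_vector_derivative 0) (at 0)"
  proof -
    have "((\<lambda>u. \<Phi> (ex (u *\<^sub>R x))) has_vector_derivative \<xi> x) (at 0)"
        "((\<lambda>u. \<Psi> (ex (u *\<^sub>R x))) has_vector_derivative \<xi> x) (at 0)"
      using assms(2,4) by (simp_all add: integrates_iff[OF \<Phi>(1)] integrates_iff[OF \<Psi>(1)])
    from has_vector_derivative_diff[OF this] show ?thesis by simp
  qed
  have "((\<lambda>u. ?D (ex (u *\<^sub>R x))) has_vector_derivative 0) (at t)" for t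
  proof -
    let ?g = "ex (t *\<^sub>R x)"
    have "((\<lambda>u. ?D (ex ((u - t) *\<^sub>R x))) has_vector_derivative 0) (at t)"
      using has_vector_derivative_shift[OF D] .
    from bounded_linear.has_vector_derivative[OF bounded_linear_bilin[OF linear_ADB] this]
    have "((\<lambda>u. ADB ?g (?D (ex ((u - t) *\<^sub>R x)))) has_vector_derivative 0) (at t)"
      by (simp only: linear_0[OF linear_ADB])
    from has_vector_derivative_add[OF has_vector_derivative_const this]
    have der: "((\<lambda>u. ?D ?g + ADB ?g (?D (ex ((u - t) *\<^sub>R x)))) has_vector_derivative 0) (at t)" by simp
    have eq: "(\<lambda>u. ?D (ex (u *\<^sub>R x))) = (\<lambda>u. ?D ?g + ADB ?g (?D (ex ((u - t) *\<^sub>R x))))"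
    proof
      fix u
      have "ex (u *\<^sub>R x) = ?g \<otimes> ex ((u - t) *\<^sub>R x)" using ex_add[of t "u - t" x] by simp
      then have "?D (ex (u *\<^sub>R x)) = ?D (?g \<otimes> ex ((u - t) *\<^sub>R x))" by (rule arg_cong)
      also have "\<dots> = ?D ?g + ADB ?g (?D (ex ((u - t) *\<^sub>R x)))"
        unfolding \<Phi>(3) \<Psi>(3) by (simp add: linear_diff[OF linear_ADB])
      finally show "?D (ex (u *\<^sub>R x)) = ?D ?g + ADB ?g (?D (ex ((u - t) *\<^sub>R x)))" .
    qed
    show ?thesis by (subst eq) (rule der)
  qed
  from constant_of_zero_derivative[OF this, of 1] show ?thesis by (simp add: \<Phi>(4) \<Psi>(4))
qed

end

context lie_group_split
begin

lemma cocycle_unique: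
  assumes "group_cocycle G A ex \<Phi>" "integrates ex \<Phi> \<xi>" "group_cocycle G A ex \<Psi>" "integrates ex \<Psi> \<xi>"
  shows "\<Phi> = \<Psi>"
proof
  fix g
  obtain x where g: "g = pt x" using surj_pt by blast
  show "\<Phi> g = \<Psi> g"
    unfolding g pt_def group_cocycleD(3)[OF assms(1)] group_cocycleD(3)[OF assms(3)]
    by (simp add: cocycles_agree_on_exponentials[OF assms])
qed

lemma diff_id_pt:
  fixes f :: "'a \<Rightarrow> 'v::real_normed_vector"
  assumes "smooth_map A vector_atlas f"
  shows "((\<lambda>x. f (pt x)) has_derivative diff_id ex f) (at 0)"
  using derivative_via_tangent[OF smooth_pt pt_0 diff_id_derivative[OF assms]] by (simp add: tangent_pt)

lemma coboundary_cocycle: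
  assumes r: "r \<in> bivectors"
  shows "group_cocycle G A ex (\<lambda>g. ADB g r - r)" "integrates ex (\<lambda>g. ADB g r - r) (\<lambda>x. adb x r)"
proof -
  have sm: "smooth_map A vector_atlas (\<lambda>g. ADB g r - r)"
    unfolding smooth_function_iff
  proof (intro smooth_on_diff smooth_on_const open_UNIV smooth_on_bilin)
    fix \<alpha> \<beta>
    have "smooth_on UNIV (\<lambda>x. \<Sum>i\<in>Basis. \<Sum>j\<in>Basis. blinfun_apply \<alpha> (AD (pt x) i) * blinfun_apply \<beta> (AD (pt x) j) *
        ev r (blinfun_inner_left i) (blinfun_inner_left j))"
      by (intro smooth_on_sum smooth_on_mult smooth_on_const open_UNIV
          smooth_on_linear_compose[OF open_UNIV blinfun.bounded_linear_right] smooth_AD smooth_pt)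
    then show "smooth_on UNIV (\<lambda>x. ev (ADB (pt x) r) \<alpha> \<beta>)"
      by (subst ext_mult_apply[OF linear_AD], subst ev_expand) (simp add: transpose_map_apply[OF linear_AD])
  qed
  then show "group_cocycle G A ex (\<lambda>g. ADB g r - r)"
    using r by (auto simp: group_cocycle_def ext_mult_bivectors linear_AD bivectors_arith ADB_mult
        linear_diff[OF linear_ADB])
  show "integrates ex (\<lambda>g. ADB g r - r) (\<lambda>x. adb x r)"
    unfolding integrates_iff[OF sm]
  proof
    fix x
    from has_vector_derivative_diff[OF ADB_derivative[of x r 0] has_vector_derivative_const[of r]]
    show "((\<lambda>t. ADB (ex (t *\<^sub>R x)) r - r) has_vector_derivative adb x r) (at 0)" by simp
  qed
qed

end

section \<open>The cocycle integrating a normalized cocycle\<close>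

text \<open>
  For a normalized cocycle, \<open>R\<close> takes invariant values on the complement, and its values on the ideal
  are killed by two elements of the ideal acting in succession.
\<close>

locale lie_group_cocycle = lie_group_split +
  fixes R :: "'b \<Rightarrow> 'b bilin"
  assumes cocycle: "cocycle br R"
    and R_invariant [simp]: "adb x (R (ps y)) = 0"
    and R_nilpotent: "adb (pn x) (adb (pn y) (R (pn z))) = 0"
begin

lemma linear_R: "linear R"
  and R_bivector: "R x \<in> bivectors"
  and R_br: "R (br x y) = adb x (R y) - adb y (R x)"
  using cocycle by (auto simp: cocycle_def)

lemmas R_simps = linear_add[OF linear_R] linear_scale[OF linear_R] linear_0[OF linear_R]
lemmas adb_simps = linear_add[OF linear_adb_right] linear_scale[OF linear_adb_right]
  linear_add[OF linear_adb_left] linear_scale[OF linear_adb_left]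
  linear_0[OF linear_adb_right] linear_0[OF linear_adb_left]

lemma ADB_R_ps [simp]: "ADB g (R (ps y)) = R (ps y)"
proof -
  obtain x where g: "g = pt x" using surj_pt by blast
  show ?thesis unfolding g pt_def ADB_mult by (simp add: ADB_ex_fixed)
qed

text \<open>
  Invariance of \<open>R\<close> on the abelian complement makes \<open>R\<close> commute with \<open>ad\<close> of the complement,
  hence with its exponential.
\<close>

lemma R_equivariant: "R (AD (ex (ps a)) v) = ADB (ex (ps a)) (R v)"
proof -
  let ?f = "\<lambda>t. R (AD (ex (t *\<^sub>R ps a)) v)"
  have "((\<lambda>t. ADB (ex (t *\<^sub>R (- ps a))) (?f t)) has_vector_derivative 0) (at t)" for t
  proof -
    let ?w = "AD (ex (t *\<^sub>R ps a)) v"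
    have "(?f has_vector_derivative R (br (ps a) ?w)) (at t)"
      by (rule bounded_linear.has_vector_derivative[OF _ AD_derivative(2)])
        (simp add: linear_R flip: linear_conv_bounded_linear)
    from ADB_curve_derivative[OF this, of "- ps a"]
    show ?thesis by (simp add: R_br linear_neg[OF linear_adb_left] linear_0[OF linear_ADB])
  qed
  from constant_of_zero_derivative[OF this, of 1]
  have "ADB (ex (- ps a)) (R (AD (ex (ps a)) v)) = R v" by simp
  then have "ADB (ex (ps a)) (ADB (inv (ex (ps a))) (R (AD (ex (ps a)) v))) = ADB (ex (ps a)) (R v)"
    by (simp only: ex_minus)
  then show ?thesis by simp
qed

text \<open>
  On the ideal the series \<open>\<Sum>k. ad\<^sup>k (R u) / (k + 1)!\<close>, which solves the differential equation of a
  cocycle along \<open>ex (t u)\<close>, has only two terms.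
\<close>

definition PhiN :: "'b \<Rightarrow> 'b bilin" where "PhiN u = R u + (1/2) *\<^sub>R adb u (R u)"

definition PhiR :: "'a \<Rightarrow> 'b bilin" where
  "PhiR g = (let x = inv_into UNIV pt g in R (ps x) + PhiN (pn x))"

lemma PhiR_pt: "PhiR (pt x) = R (ps x) + PhiN (pn x)"
  by (simp add: PhiR_def inv_into_f_f[OF inj_pt])

text \<open>
  On the abelian ideal the exponential series of \<open>ad\<close> stops after the linear term, and the mixed
  terms agree because \<open>R\<close> vanishes on brackets of the ideal.
\<close>

lemma PhiN_add: "PhiN (pn u + pn v) = PhiN (pn u) + ADB (ex (pn u)) (PhiN (pn v))"
proof -
  have comm: "adb (pn u) (R (pn v)) = adb (pn v) (R (pn u))"
    using R_br[of "pn u" "pn v"] by (simp add: pn_abelian R_simps)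
  have "ADB (ex (pn u)) (PhiN (pn v)) = PhiN (pn v) + adb (pn u) (PhiN (pn v))"
    by (rule ADB_ex_nilpotent) (simp add: PhiN_def adb_simps R_nilpotent)
  also have "\<dots> = PhiN (pn v) + adb (pn u) (R (pn v))"
    by (simp add: PhiN_def adb_simps R_nilpotent)
  finally show ?thesis
    by (simp add: PhiN_def adb_simps R_simps comm scaleR_add_right)
      (simp add: comm flip: scaleR_add_left)
qed

lemma PhiN_equivariant: "PhiN (AD (ex (ps a)) u) = ADB (ex (ps a)) (PhiN u)"
  by (simp add: PhiN_def R_equivariant ADB_adb linear_add[OF linear_ADB] linear_scale[OF linear_ADB])

text \<open>
  Moving the factor in the complement of \<open>g\<close> past the factor in the ideal of \<open>h\<close> conjugates the latter.
  The cocycle identity then reduces to equivariance of \<open>PhiN\<close> under the complement and to \<open>PhiN_add\<close>.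
\<close>

lemma PhiR_mult: "PhiR (g \<otimes> h) = PhiR g + ADB g (PhiR h)"
proof -
  obtain x y where gh: "g = pt x" "h = pt y" using surj_pt by metis
  let ?w = "AD (ex (ps x)) (pn y)"
  have w: "pn ?w = ?w" by (rule pn_AD_ex)
  have "PhiR (g \<otimes> h) = R (ps x) + R (ps y) + PhiN (pn x + pn ?w)"
    unfolding gh pt_ltrans[symmetric] PhiR_pt by (simp add: ps_ltrans pn_ltrans R_simps w)
  also have "\<dots> = R (ps x) + R (ps y) + PhiN (pn x) + ADB (ex (pn x)) (PhiN ?w)"
    unfolding PhiN_add by (simp add: w)
  also have "\<dots> = PhiR g + ADB g (PhiR h)"
    unfolding gh PhiR_pt linear_add[OF linear_ADB] ADB_R_ps
    by (simp add: pt_def ADB_mult PhiN_equivariant)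
  finally show ?thesis .
qed

lemma PhiR_pt_expand:
  "PhiR (pt x) = R x + (1/2) *\<^sub>R (\<Sum>i\<in>Basis. (pn x \<bullet> i) *\<^sub>R adb i (R (pn x)))"
proof -
  have "R x = R (ps x) + R (pn x)" using split[of x] linear_add[OF linear_R] by metis
  then show ?thesis
    using linear_expand_Basis[OF linear_adb_left[of "R (pn x)"], of "pn x"] by (simp add: PhiR_pt PhiN_def)
qed

lemma PhiR_cocycle: "group_cocycle G A ex PhiR"
proof -
  have lin: "linear (\<lambda>x. adb i (R (pn x)))" for i
    using linear_compose[OF linear_compose[OF linear_pn linear_R] linear_adb_right] by (simp add: comp_def)
  have "smooth_map A vector_atlas PhiR"
    unfolding smooth_function_iff PhiR_pt_expand
    by (intro smooth_on_add smooth_on_scaleR smooth_on_sum smooth_on_const open_UNIV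
        smooth_on_linear[OF open_UNIV linear_R] smooth_on_linear[OF open_UNIV lin]
        smooth_on_linear_compose[OF open_UNIV bounded_linear_inner_left] smooth_on_linear[OF open_UNIV linear_pn])
  moreover have "PhiR g \<in> bivectors" for g
    using surj_pt[of g] by (auto simp: PhiR_pt PhiN_def intro!: bivectors_arith R_bivector
        ext_deriv_bivectors linear_br_right)
  ultimately show ?thesis by (auto simp: group_cocycle_def PhiR_mult)
qed

lemma PhiR_integrates: "integrates ex PhiR R"
proof -
  note sm = group_cocycleD(1)[OF PhiR_cocycle]
  have lin: "linear (\<lambda>x. adb i (R (pn x)))" for i
    using linear_compose[OF linear_compose[OF linear_pn linear_R] linear_adb_right] by (simp add: comp_def)
  have "((\<lambda>x. R x + (1/2) *\<^sub>R (\<Sum>i\<in>Basis. (pn x \<bullet> i) *\<^sub>R adb i (R (pn x)))) has_derivative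
     (\<lambda>h. R h + (1/2) *\<^sub>R (\<Sum>i\<in>Basis. (pn 0 \<bullet> i) *\<^sub>R adb i (R (pn h)) + (pn h \<bullet> i) *\<^sub>R adb i (R (pn 0))))) (at 0)"
    by (intro has_derivative_add has_derivative_scaleR_right has_derivative_sum has_derivative_scaleR
        has_derivative_inner_left linear_imp_has_derivative linear_R linear_pn lin)
  then have "((\<lambda>x. PhiR (pt x)) has_derivative R) (at 0)"
    unfolding PhiR_pt_expand by (simp add: R_simps adb_simps)
  then have "diff_id ex PhiR = R"
    using diff_id_pt[OF sm] has_derivative_unique by blast
  then show ?thesis using diff_id_derivative[OF sm] by (simp add: integrates_def comp_def)
qed

lemma PhiR_ex_ps: "PhiR (ex (ps x)) = R (ps x)"
  using PhiR_pt[of "ps x"] by (simp add: pt_def PhiN_def R_simps adb_simps)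

lemma PhiR_ex_pn: "PhiR (ex (pn x)) = PhiN (pn x)"
  using PhiR_pt[of "pn x"] by (simp add: pt_def R_simps)

end

section \<open>Symmetry of second derivatives\<close>

text \<open>
  The second difference is symmetric in the two directions; applying the mean value theorem first in
  one direction and then in the other expresses it through one of the two mixed derivatives.
\<close>

lemma second_difference_mean_value:
  fixes f :: "'e::euclidean_space \<Rightarrow> real"
  assumes f: "smooth_on UNIV f" and h: "0 < h"
  obtains s t where "0 < s" "s < h" "0 < t" "t < h"
    "f (z + h *\<^sub>R a + h *\<^sub>R b) - f (z + h *\<^sub>R a) - f (z + h *\<^sub>R b) + f z
     = h * h * frechet_derivative (\<lambda>z. frechet_derivative f (at z) a) (at (z + s *\<^sub>R a + t *\<^sub>R b)) b"
proof -
  let ?fa = "\<lambda>z. frechet_derivative f (at z) a"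
  let ?fab = "\<lambda>z. frechet_derivative ?fa (at z) b"
  have along: "((\<lambda>s. g (w + s *\<^sub>R c)) has_real_derivative frechet_derivative g (at (w + s *\<^sub>R c)) c) (at s)"
    if "smooth_on UNIV g" for g :: "'e \<Rightarrow> real" and w c s
  proof -
    note g = smooth_on_has_derivative[OF that UNIV_I, of "w + s *\<^sub>R c"]
    have "((\<lambda>s. w + s *\<^sub>R c) has_derivative (\<lambda>h. h *\<^sub>R c)) (at s)" by (auto intro!: derivative_eq_intros)
    from has_derivative_compose[OF this g]
    show ?thesis
      by (rule has_derivative_imp_has_field_derivative)
        (simp add: linear_scale[OF has_derivative_linear[OF g]])
  qed
  have "((\<lambda>s. f (z + h *\<^sub>R b + s *\<^sub>R a) - f (z + s *\<^sub>R a)) has_real_derivative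
      ?fa (z + h *\<^sub>R b + s *\<^sub>R a) - ?fa (z + s *\<^sub>R a)) (at s)" for s
    by (intro DERIV_diff along f)
  from MVT2[OF h this] obtain s where s: "0 < s" "s < h"
    "f (z + h *\<^sub>R b + h *\<^sub>R a) - f (z + h *\<^sub>R a) - (f (z + h *\<^sub>R b) - f z)
      = h * (?fa (z + h *\<^sub>R b + s *\<^sub>R a) - ?fa (z + s *\<^sub>R a))"
    by auto
  from MVT2[OF h along[OF smooth_on_directional[OF f, of a], of "z + s *\<^sub>R a" b]]
  obtain t where t: "0 < t" "t < h"
    "?fa (z + s *\<^sub>R a + h *\<^sub>R b) - ?fa (z + s *\<^sub>R a) = h * ?fab (z + s *\<^sub>R a + t *\<^sub>R b)"
    by auto
  have "z + h *\<^sub>R b + h *\<^sub>R a = z + h *\<^sub>R a + h *\<^sub>R b" "z + h *\<^sub>R b + s *\<^sub>R a = z + s *\<^sub>R a + h *\<^sub>R b"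
    by (simp_all add: algebra_simps)
  with s t show ?thesis by (intro that[of s t]) (simp_all add: mult.assoc)
qed

lemma second_derivative_symmetric:
  fixes f :: "'e::euclidean_space \<Rightarrow> real"
  assumes f: "smooth_on UNIV f"
  shows "frechet_derivative (\<lambda>z. frechet_derivative f (at z) a) (at z) b
    = frechet_derivative (\<lambda>z. frechet_derivative f (at z) b) (at z) a"
proof -
  let ?D = "\<lambda>a b z. frechet_derivative (\<lambda>z. frechet_derivative f (at z) a) (at z) b"
  have cont: "isCont (?D a b) z" for a b
    using smooth_on_imp_continuous_on[OF smooth_on_directional[OF smooth_on_directional[OF f]]]
    by (simp add: continuous_on_eq_continuous_at)
  have "\<bar>?D a b z - ?D b a z\<bar> < e" if e: "e > 0" for e :: real
  proof -
    obtain d1 where d1: "d1 > 0" "\<And>w. dist w z < d1 \<Longrightarrow> dist (?D a b w) (?D a b z) < e / 2"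
      using cont[of a b] e unfolding continuous_at_eps_delta by (metis half_gt_zero)
    obtain d2 where d2: "d2 > 0" "\<And>w. dist w z < d2 \<Longrightarrow> dist (?D b a w) (?D b a z) < e / 2"
      using cont[of b a] e unfolding continuous_at_eps_delta by (metis half_gt_zero)
    (* The 1 in the denominator covers the case that both directions vanish. *)
    define h where "h = min d1 d2 / (norm a + norm b + 1)"
    have pos: "norm a + norm b + 1 > 0" by (simp add: add_nonneg_pos)
    have h: "h > 0" using d1(1) d2(1) pos by (simp add: h_def)
    have hd: "h * (norm a + norm b + 1) = min d1 d2" using pos by (simp add: h_def)
    have small: "dist (z + s *\<^sub>R a + t *\<^sub>R b) z < min d1 d2" if "0 < s" "s < h" "0 < t" "t < h" for s t
    proof -
      have "dist (z + s *\<^sub>R a + t *\<^sub>R b) z = norm (s *\<^sub>R a + t *\<^sub>R b)" by (simp add: dist_norm)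
      also have "\<dots> \<le> s * norm a + t * norm b" using that norm_triangle_ineq[of "s *\<^sub>R a" "t *\<^sub>R b"] by simp
      also have "\<dots> \<le> h * norm a + h * norm b" using that by (intro add_mono mult_right_mono) auto
      also have "\<dots> < h * (norm a + norm b + 1)" using h by (simp add: algebra_simps)
      finally show ?thesis unfolding hd .
    qed
    obtain s t where st: "0 < s" "s < h" "0 < t" "t < h"
      "f (z + h *\<^sub>R a + h *\<^sub>R b) - f (z + h *\<^sub>R a) - f (z + h *\<^sub>R b) + f z = h * h * ?D a b (z + s *\<^sub>R a + t *\<^sub>R b)"
      by (rule second_difference_mean_value[OF f h])
    obtain s' t' where st': "0 < s'" "s' < h" "0 < t'" "t' < h"
      "f (z + h *\<^sub>R b + h *\<^sub>R a) - f (z + h *\<^sub>R b) - f (z + h *\<^sub>R a) + f z = h * h * ?D b a (z + s' *\<^sub>R b + t' *\<^sub>R a)"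
      by (rule second_difference_mean_value[OF f h])
    have swap: "z + h *\<^sub>R b + h *\<^sub>R a = z + h *\<^sub>R a + h *\<^sub>R b" by (simp add: algebra_simps)
    have "h * h * ?D a b (z + s *\<^sub>R a + t *\<^sub>R b) = h * h * ?D b a (z + s' *\<^sub>R b + t' *\<^sub>R a)"
      using st(5) st'(5) unfolding swap by linarith
    then have "?D a b (z + s *\<^sub>R a + t *\<^sub>R b) = ?D b a (z + s' *\<^sub>R b + t' *\<^sub>R a)" using h by simp
    also have "z + s' *\<^sub>R b + t' *\<^sub>R a = z + t' *\<^sub>R a + s' *\<^sub>R b" by (simp add: algebra_simps)
    finally have "?D a b (z + s *\<^sub>R a + t *\<^sub>R b) = ?D b a (z + t' *\<^sub>R a + s' *\<^sub>R b)" .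
    moreover have "dist (?D a b (z + s *\<^sub>R a + t *\<^sub>R b)) (?D a b z) < e / 2"
      using d1(2) small[OF st(1-4)] by simp
    moreover have "dist (?D b a (z + t' *\<^sub>R a + s' *\<^sub>R b)) (?D b a z) < e / 2"
      using d2(2) small[OF st'(3,4,1,2)] by simp
    ultimately show ?thesis unfolding dist_real_def by linarith
  qed
  from this[of "\<bar>?D a b z - ?D b a z\<bar>"] show ?thesis by fastforce
qed

section \<open>Right-invariant vector fields\<close>

context lie_group_split
begin

abbreviation smooth_fun :: "('a \<Rightarrow> real) \<Rightarrow> bool" where "smooth_fun \<equiv> smooth_map A vector_atlas"

text \<open>
  The differential of \<open>f\<close> at \<open>g\<close> after right trivialization; \<open>dR f g x\<close> is the derivative of \<open>f\<close> along the
  right-invariant vector field with value \<open>x\<close> at the identity.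
\<close>

definition dR :: "('a \<Rightarrow> real) \<Rightarrow> 'a \<Rightarrow> 'b dual" where
  "dR f g = Blinfun (diff_id ex (f \<circ> (\<lambda>x. x \<otimes> g)))"

lemma smooth_fun_right: "smooth_fun f \<Longrightarrow> smooth_fun (f \<circ> (\<lambda>x. x \<otimes> g))"
  and smooth_fun_left: "smooth_fun f \<Longrightarrow> smooth_fun (f \<circ> (\<lambda>x. g \<otimes> x))"
  using smooth_map_compose[OF charts charts vector_atlas_open smooth_right]
    smooth_map_compose[OF charts charts vector_atlas_open smooth_left] by (auto simp: comp_def)

lemma Blinfun_diff_id: "smooth_fun f \<Longrightarrow> blinfun_apply (Blinfun (diff_id ex f)) = diff_id ex f"
  using diff_id_derivative[of f] by (auto intro: bounded_linear_Blinfun_apply has_derivative_bounded_linear)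

lemma dR_derivative:
  assumes "smooth_fun f"
  shows "((\<lambda>y. f (ex y \<otimes> g)) has_derivative blinfun_apply (dR f g)) (at 0)"
  using diff_id_derivative[OF smooth_fun_right[OF assms]]
  by (simp add: dR_def Blinfun_diff_id smooth_fun_right[OF assms])

lemma dR_along_0:
  assumes "smooth_fun f"
  shows "((\<lambda>t. f (ex (t *\<^sub>R x) \<otimes> g)) has_vector_derivative dR f g x) (at 0)"
  using diff_id_along[OF smooth_fun_right[OF assms]]
  by (simp add: dR_def Blinfun_diff_id smooth_fun_right[OF assms])

lemma dR_eqI:
  assumes "smooth_fun f" "\<And>x. ((\<lambda>t. f (ex (t *\<^sub>R x) \<otimes> g)) has_vector_derivative blinfun_apply D x) (at 0)"
  shows "dR f g = D"
  using vector_derivative_unique_at[OF dR_along_0[OF assms(1)] assms(2)] by (intro blinfun_eqI)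

lemma smooth_fun_combination:
  assumes "smooth_fun f" "smooth_fun h"
  shows "smooth_fun (\<lambda>x. a * f x + b * h x)" "smooth_fun (\<lambda>x. f x * h x)"
  using assms unfolding smooth_function_iff
  by (auto intro!: smooth_on_add smooth_on_mult smooth_on_const)

lemma dR_combination:
  assumes "smooth_fun f" "smooth_fun h"
  shows "dR (\<lambda>x. a * f x + b * h x) g = a *\<^sub>R dR f g + b *\<^sub>R dR h g"
    "dR (\<lambda>x. f x * h x) g = f g *\<^sub>R dR h g + h g *\<^sub>R dR f g"
proof -
  note d = dR_along_0[OF assms(1), unfolded has_real_derivative_iff_has_vector_derivative[symmetric]]
    dR_along_0[OF assms(2), unfolded has_real_derivative_iff_has_vector_derivative[symmetric]]
  show "dR (\<lambda>x. a * f x + b * h x) g = a *\<^sub>R dR f g + b *\<^sub>R dR h g"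
    by (rule dR_eqI[OF smooth_fun_combination(1)[OF assms]],
        unfold has_real_derivative_iff_has_vector_derivative[symmetric])
      (auto intro!: derivative_eq_intros d simp: blinfun.bilinear_simps)
  show "dR (\<lambda>x. f x * h x) g = f g *\<^sub>R dR h g + h g *\<^sub>R dR f g"
    by (rule dR_eqI[OF smooth_fun_combination(2)[OF assms]],
        unfold has_real_derivative_iff_has_vector_derivative[symmetric])
      (auto intro!: derivative_eq_intros d simp: blinfun.bilinear_simps)
qed

lemma smooth_two_factors:
  fixes F :: "'e::euclidean_space \<Rightarrow> 'a"
  assumes "smooth_fun f" "smooth_map vector_atlas A F"
  shows "smooth_on UNIV (\<lambda>z::'b \<times> 'e. f (ex (fst z) \<otimes> F (snd z)))"
proof (rule smooth_function_compose[OF assms(1)])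
  have "smooth_map vector_atlas A (\<lambda>z::'b \<times> 'e. F (snd z))"
    by (rule smooth_map_compose[OF vector_atlas_open vector_atlas_open charts _ assms(2)])
      (simp add: smooth_map_vector_vector smooth_on_linear linear_snd)
  then show "smooth_map vector_atlas A (\<lambda>z::'b \<times> 'e. ex (fst z) \<otimes> F (snd z))"
    by (intro smooth_mult vector_atlas_open smooth_ex_linear linear_fst)
qed

lemma dR_partial:
  fixes F :: "'e::euclidean_space \<Rightarrow> 'a"
  assumes "smooth_fun f" "smooth_map vector_atlas A F"
  shows "frechet_derivative (\<lambda>z. f (ex (fst z) \<otimes> F (snd z))) (at (0, e)) (x, 0) = dR f (F e) x"
proof -
  let ?K = "\<lambda>z. f (ex (fst z) \<otimes> F (snd z))"
  note K = smooth_on_has_derivative[OF smooth_two_factors[OF assms] UNIV_I, of "(0, e)"]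
  have "((\<lambda>y. ?K (y, e)) has_derivative (\<lambda>h. frechet_derivative ?K (at (0, e)) (h, 0))) (at 0)"
    by (rule has_derivative_compose[of "\<lambda>y. (y, e)" "\<lambda>h. (h, 0)" 0 UNIV ?K])
      (auto intro!: derivative_eq_intros K)
  from has_derivative_unique[OF dR_derivative[OF assms(1), of "F e"]] this
  show ?thesis by simp
qed

lemma smooth_dR:
  assumes "smooth_fun f" shows "smooth_fun (\<lambda>g. dR f g x)"
  unfolding smooth_function_iff
proof -
  let ?K = "\<lambda>z. f (ex (fst z) \<otimes> pt (snd z))"
  have "smooth_on UNIV (\<lambda>e. frechet_derivative ?K (at (0, e)) (x, 0))"
    by (rule smooth_on_compose[where f = "\<lambda>e. (0, e)" and V = UNIV, OF _ _ _ _
          smooth_on_directional[OF smooth_two_factors[OF assms smooth_pt]]])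
      (auto intro!: smooth_on_bounded_linear bounded_linear_Pair bounded_linear_ident bounded_linear_zero)
  then show "smooth_on UNIV (\<lambda>e. dR f (pt e) x)" by (simp add: dR_partial[OF assms smooth_pt])
qed

lemma dR_expand: "blinfun_apply (dR f k) w = (\<Sum>i\<in>Basis. (w \<bullet> i) * dR f k i)"
  using linear_expand_Basis[of "blinfun_apply (dR f k)" w]
  by (simp add: blinfun.bounded_linear_right bounded_linear.linear)

lemma dR_dR_expand:
  assumes f: "smooth_fun f"
  shows "dR (\<lambda>g. dR f g y) g x = (\<Sum>i\<in>Basis. (y \<bullet> i) * dR (\<lambda>g. dR f g i) g x)"
proof -
  have "((\<lambda>t. \<Sum>i\<in>Basis. (y \<bullet> i) * dR f (ex (t *\<^sub>R x) \<otimes> g) i) has_vector_derivative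
      (\<Sum>i\<in>Basis. (y \<bullet> i) * dR (\<lambda>g. dR f g i) g x)) (at 0)"
    by (intro has_vector_derivative_sum bounded_linear.has_vector_derivative[OF bounded_linear_mult_right]
        dR_along_0 smooth_dR f)
  then have "((\<lambda>t. dR f (ex (t *\<^sub>R x) \<otimes> g) y) has_vector_derivative
      (\<Sum>i\<in>Basis. (y \<bullet> i) * dR (\<lambda>g. dR f g i) g x)) (at 0)"
    by (simp flip: dR_expand)
  then show ?thesis using vector_derivative_unique_at[OF dR_along_0[OF smooth_dR[OF f]]] by blast
qed

text \<open>
  The flows of right-invariant fields are left translations, so their commutator carries a minus
  sign. The mixed second derivative of \<open>f (ex v \<otimes> ex w \<otimes> g)\<close> is computed in both orders: once directly,
  and once after moving \<open>ex w\<close> to the left of \<open>ex v\<close>, which applies \<open>AD (ex v)\<close> to \<open>w\<close>.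
\<close>

lemma dR_commutator:
  assumes f: "smooth_fun f"
  shows "dR (\<lambda>g. dR f g x) g y = dR f g (br x y) + dR (\<lambda>g. dR f g y) g x"
proof -
  let ?F = "\<lambda>w. ex w \<otimes> g"
  let ?K = "\<lambda>z. f (ex (fst z) \<otimes> ?F (snd z))"
  let ?D = "\<lambda>a b. frechet_derivative (\<lambda>z. frechet_derivative ?K (at z) a) (at (0, 0)) b"
  have F: "smooth_map vector_atlas A ?F" by (intro smooth_mult vector_atlas_open smooth_ex smooth_constant)
  note K = smooth_two_factors[OF f F]
  have Kd: "smooth_on UNIV (\<lambda>z. frechet_derivative ?K (at z) a)" for a
    by (rule smooth_on_directional[OF K])
  have line: "((\<lambda>t. frechet_derivative ?K (at (t *\<^sub>R b)) a) has_vector_derivative ?D a b) (at 0)" for a b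
  proof -
    note d = smooth_on_has_derivative[OF Kd[of a] UNIV_I, of "(0, 0)"]
    have d0: "((\<lambda>t. t *\<^sub>R b) has_derivative (\<lambda>h. h *\<^sub>R b)) (at (0::real))" by (auto intro!: derivative_eq_intros)
    have z: "0 *\<^sub>R b = (0, 0)" by (simp add: zero_prod_def)
    have "((\<lambda>t. frechet_derivative ?K (at (t *\<^sub>R b)) a) has_derivative
        (\<lambda>h. frechet_derivative (\<lambda>z. frechet_derivative ?K (at z) a) (at (0, 0)) (h *\<^sub>R b))) (at 0)"
      by (rule has_derivative_compose[OF d0, unfolded z, OF d])
    then show ?thesis
      unfolding has_vector_derivative_def linear_scale[OF has_derivative_linear[OF d]] .
  qed
  have 1: "?D (x, 0) (0, y) = dR (\<lambda>g. dR f g x) g y" for x y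
  proof -
    have "((\<lambda>t. dR f (ex (t *\<^sub>R y) \<otimes> g) x) has_vector_derivative ?D (x, 0) (0, y)) (at 0)"
      using line[of "(0, y)" "(x, 0)"] by (simp add: dR_partial[OF f F])
    then show ?thesis using dR_along_0[OF smooth_dR[OF f]] vector_derivative_unique_at by blast
  qed
  have second: "frechet_derivative ?K (at (v, 0)) (0, y) = dR f (ex v \<otimes> g) (AD (ex v) y)" for v
  proof -
    note d = smooth_on_has_derivative[OF K UNIV_I, of "(v, 0)"]
    have "((\<lambda>t. (v, t *\<^sub>R y)) has_derivative (\<lambda>h. (0, h *\<^sub>R y))) (at (0::real))"
      by (auto intro!: derivative_eq_intros)
    from has_derivative_compose[OF this, of ?K] d
    have "((\<lambda>t. ?K (v, t *\<^sub>R y)) has_derivative (\<lambda>h. frechet_derivative ?K (at (v, 0)) (0, h *\<^sub>R y))) (at 0)"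
      by simp
    moreover have "frechet_derivative ?K (at (v, 0)) (0, h *\<^sub>R y) = h *\<^sub>R frechet_derivative ?K (at (v, 0)) (0, y)" for h
      using linear_scale[OF has_derivative_linear[OF d], of h "(0, y)"] by simp
    ultimately have "((\<lambda>t. ?K (v, t *\<^sub>R y)) has_vector_derivative frechet_derivative ?K (at (v, 0)) (0, y)) (at 0)"
      by (simp add: has_vector_derivative_def)
    moreover have "?K (v, t *\<^sub>R y) = f (ex (t *\<^sub>R AD (ex v) y) \<otimes> (ex v \<otimes> g))" for t
      using conj_ex[of "ex v" "t *\<^sub>R y", symmetric] by (simp add: linear_scale[OF linear_AD])
    ultimately have "((\<lambda>t. f (ex (t *\<^sub>R AD (ex v) y) \<otimes> (ex v \<otimes> g))) has_vector_derivative
        frechet_derivative ?K (at (v, 0)) (0, y)) (at 0)" by (simp only:)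
    then show ?thesis using dR_along_0[OF f] vector_derivative_unique_at by blast
  qed
  have "?D (0, y) (x, 0) = dR f g (br x y) + dR (\<lambda>g. dR f g y) g x"
  proof -
    have AD0: "((\<lambda>t. AD (ex (t *\<^sub>R x)) y) has_vector_derivative br x y) (at 0)"
      using AD_derivative(2)[of x y 0] by simp
    have pr: "((\<lambda>t. (AD (ex (t *\<^sub>R x)) y \<bullet> i) * dR f (ex (t *\<^sub>R x) \<otimes> g) i) has_vector_derivative
        (AD (ex (0 *\<^sub>R x)) y \<bullet> i) * dR (\<lambda>g. dR f g i) g x + (br x y \<bullet> i) * dR f (ex (0 *\<^sub>R x) \<otimes> g) i) (at 0)" for i
      by (rule bounded_bilinear.has_vector_derivative[OF bounded_bilinear_mult])
        (auto intro!: bounded_linear.has_vector_derivative[OF bounded_linear_inner_left AD0] dR_along_0 smooth_dR f)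
    have "((\<lambda>t. dR f (ex (t *\<^sub>R x) \<otimes> g) (AD (ex (t *\<^sub>R x)) y)) has_vector_derivative
        (\<Sum>i\<in>Basis. (y \<bullet> i) * dR (\<lambda>g. dR f g i) g x + (br x y \<bullet> i) * dR f g i)) (at 0)"
      unfolding dR_expand[of _ _ "AD (ex (_ *\<^sub>R x)) y"]
      using has_vector_derivative_sum[of Basis, OF pr] by simp
    moreover have "((\<lambda>t. frechet_derivative ?K (at (t *\<^sub>R x, 0)) (0, y)) has_vector_derivative ?D (0, y) (x, 0)) (at 0)"
      using line[of "(x, 0)" "(0, y)"] by simp
    ultimately have "?D (0, y) (x, 0) = (\<Sum>i\<in>Basis. (y \<bullet> i) * dR (\<lambda>g. dR f g i) g x + (br x y \<bullet> i) * dR f g i)"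
      unfolding second using vector_derivative_unique_at by blast
    also have "\<dots> = (\<Sum>i\<in>Basis. (y \<bullet> i) * dR (\<lambda>g. dR f g i) g x) + dR f g (br x y)"
      by (simp add: sum.distrib flip: dR_expand)
    also have "(\<Sum>i\<in>Basis. (y \<bullet> i) * dR (\<lambda>g. dR f g i) g x) = dR (\<lambda>g. dR f g y) g x"
      by (rule dR_dR_expand[OF f, symmetric])
    finally show ?thesis by simp
  qed
  moreover have "?D (x, 0) (0, y) = ?D (0, y) (x, 0)" by (rule second_derivative_symmetric[OF K])
  ultimately show ?thesis using 1 by simp
qed

end

section \<open>Multiplicative Poisson tensors\<close>

text \<open>
  The contraction of \<open>r\<close> with \<open>\<alpha>\<close>, as a vector.
\<close>

definition sharp :: "'a::euclidean_space bilin \<Rightarrow> 'a dual \<Rightarrow> 'a" where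
  "sharp r \<alpha> = (\<Sum>i\<in>Basis. ev r \<alpha> (blinfun_inner_left i) *\<^sub>R i)"

lemma sharp_apply: "blinfun_apply \<beta> (sharp r \<alpha>) = ev r \<alpha> \<beta>"
proof -
  have "blinfun_apply \<beta> (sharp r \<alpha>) = ev r \<alpha> (\<Sum>i\<in>Basis. blinfun_apply \<beta> i *\<^sub>R blinfun_inner_left i)"
    by (simp add: sharp_def blinfun.sum_right blinfun.scaleR_right ev_sum_right mult.commute)
  then show ?thesis by (simp flip: dual_expand)
qed

lemma dual_separates:
  fixes x y :: "'a::euclidean_space"
  assumes "\<And>\<beta> :: 'a dual. blinfun_apply \<beta> x = blinfun_apply \<beta> y" shows "x = y"
  by (rule euclidean_eqI) (metis assms blinfun_inner_left.rep_eq)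

lemma sharp_simps:
  "sharp (r + r') \<alpha> = sharp r \<alpha> + sharp r' \<alpha>" "sharp r (\<alpha> + \<alpha>') = sharp r \<alpha> + sharp r \<alpha>'"
  "sharp r (- \<alpha>) = - sharp r \<alpha>" "sharp 0 \<alpha> = 0"
  by (rule dual_separates, simp add: sharp_apply blinfun.bilinear_simps)+

lemma has_vector_derivative_ev:
  fixes r :: "real \<Rightarrow> 'a::euclidean_space bilin"
  assumes "(r has_vector_derivative r') (at t)" "(\<alpha> has_vector_derivative \<alpha>') (at t)" "(\<beta> has_vector_derivative \<beta>') (at t)"
  shows "((\<lambda>t. ev (r t) (\<alpha> t) (\<beta> t)) has_vector_derivative
    ev (r t) (\<alpha> t) \<beta>' + ev (r t) \<alpha>' (\<beta> t) + ev r' (\<alpha> t) (\<beta> t)) (at t)"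
  using bounded_bilinear.has_vector_derivative[OF bounded_bilinear_blinfun_apply
      bounded_bilinear.has_vector_derivative[OF bounded_bilinear_blinfun_apply assms(1,2)] assms(3)]
  by (simp add: blinfun.add_left add.assoc)

lemma has_vector_derivative_sharp:
  fixes r :: "real \<Rightarrow> 'a::euclidean_space bilin"
  assumes "(r has_vector_derivative r') (at t)" "(\<alpha> has_vector_derivative \<alpha>') (at t)"
  shows "((\<lambda>t. sharp (r t) (\<alpha> t)) has_vector_derivative sharp (r t) \<alpha>' + sharp r' (\<alpha> t)) (at t)"
proof -
  have "((\<lambda>t. \<Sum>i\<in>Basis. ev (r t) (\<alpha> t) (blinfun_inner_left i) *\<^sub>R i) has_vector_derivative
     (\<Sum>i\<in>Basis. (ev (r t) (\<alpha> t) 0 + ev (r t) \<alpha>' (blinfun_inner_left i) + ev r' (\<alpha> t) (blinfun_inner_left i)) *\<^sub>R i)) (at t)"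
    by (intro has_vector_derivative_sum bounded_linear.has_vector_derivative[OF bounded_linear_scaleR_left]
        has_vector_derivative_ev assms has_vector_derivative_const)
  then show ?thesis by (simp add: sharp_def scaleR_add_left sum.distrib)
qed

locale lie_group_bialgebra = lie_group_split +
  fixes \<Phi> :: "'a \<Rightarrow> 'b bilin" and \<xi> :: "'b \<Rightarrow> 'b bilin"
  assumes group_cocycle: "group_cocycle G A ex \<Phi>" and integrates: "integrates ex \<Phi> \<xi>"
    and lie_bialgebra: "lie_bialgebra br \<xi>"
begin

lemma linear_xi: "linear \<xi>" and xi_bivector: "\<xi> x \<in> bivectors"
  and xi_br: "\<xi> (br x y) = adb x (\<xi> y) - adb y (\<xi> x)"
  using lie_bialgebra by (auto simp: lie_bialgebra_def cocycle_def)

lemma xi_add: "\<xi> (x + y) = \<xi> x + \<xi> y" and xi_0 [simp]: "\<xi> 0 = 0"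
  using linear_xi by (auto simp: linear_add linear_0)

lemma cobracket_apply: "blinfun_apply (cobracket_transpose \<xi> \<beta> \<gamma>) y = ev (\<xi> y) \<beta> \<gamma>"
proof -
  have "linear (\<lambda>y. ev (\<xi> y) \<beta> \<gamma>)"
    by (auto intro!: linearI simp: linear_add[OF linear_xi] linear_scale[OF linear_xi])
  then show ?thesis
    by (simp add: cobracket_transpose_def bounded_linear_Blinfun_apply linear_conv_bounded_linear)
qed

lemma co_jacobi:
  "ev (\<xi> (sharp (\<xi> x) \<alpha>)) \<beta> \<gamma> + ev (\<xi> (sharp (\<xi> x) \<beta>)) \<gamma> \<alpha> + ev (\<xi> (sharp (\<xi> x) \<gamma>)) \<alpha> \<beta> = 0"
proof -
  let ?c = "cobracket_transpose \<xi>"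
  have "?c \<alpha> (?c \<beta> \<gamma>) + ?c \<beta> (?c \<gamma> \<alpha>) + ?c \<gamma> (?c \<alpha> \<beta>) = 0"
    using lie_bialgebra by (simp add: lie_bialgebra_def lie_algebra_def)
  from arg_cong[OF this, of "\<lambda>\<theta>. blinfun_apply \<theta> x"]
  have "ev (\<xi> x) \<alpha> (?c \<beta> \<gamma>) + ev (\<xi> x) \<beta> (?c \<gamma> \<alpha>) + ev (\<xi> x) \<gamma> (?c \<alpha> \<beta>) = 0"
    by (simp add: blinfun.add_left cobracket_apply)
  then show ?thesis unfolding sharp_apply[symmetric] cobracket_apply .
qed

text \<open>
  The value at \<open>r = \<Phi> g\<close> of the Jacobiator of the bracket defined by \<open>\<Phi>\<close>, as a polynomial in \<open>r\<close>:
  the linear part comes from differentiating \<open>\<Phi>\<close>, the quadratic part is, up to a constant factor, the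
  Schouten bracket \<open>[r, r]\<close>.
\<close>

definition jac :: "'b bilin \<Rightarrow> 'b dual \<Rightarrow> 'b dual \<Rightarrow> 'b dual \<Rightarrow> real" where
  "jac r \<alpha> \<beta> \<gamma> = ev (\<xi> (sharp r \<alpha>)) \<beta> \<gamma> + ev (\<xi> (sharp r \<beta>)) \<gamma> \<alpha> + ev (\<xi> (sharp r \<gamma>)) \<alpha> \<beta>
     + blinfun_apply \<alpha> (br (sharp r \<beta>) (sharp r \<gamma>)) + blinfun_apply \<beta> (br (sharp r \<gamma>) (sharp r \<alpha>))
     + blinfun_apply \<gamma> (br (sharp r \<alpha>) (sharp r \<beta>))"

lemma ev_adb: "ev (adb x r) \<alpha> \<beta> = ev r (transpose_map (br x) \<alpha>) \<beta> + ev r \<alpha> (transpose_map (br x) \<beta>)"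
  by (simp add: ext_deriv_apply linear_br_right)

lemma ev_adb_skew:
  assumes "r \<in> bivectors"
  shows "ev (adb x r) \<beta> \<gamma> = - blinfun_apply \<beta> (br x (sharp r \<gamma>)) + blinfun_apply \<gamma> (br x (sharp r \<beta>))"
proof -
  have "ev r (transpose_map (br x) \<beta>) \<gamma> = - blinfun_apply (transpose_map (br x) \<beta>) (sharp r \<gamma>)"
    using bivectors_skew[OF assms, of "transpose_map (br x) \<beta>" \<gamma>] by (simp add: sharp_apply)
  moreover have "ev r \<beta> (transpose_map (br x) \<gamma>) = blinfun_apply (transpose_map (br x) \<gamma>) (sharp r \<beta>)"
    by (simp add: sharp_apply)
  ultimately show ?thesis by (simp add: ev_adb transpose_map_apply linear_br_right)
qed

lemma sharp_adb: "sharp (adb x r) \<alpha> = sharp r (transpose_map (br x) \<alpha>) + br x (sharp r \<alpha>)"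
proof (rule dual_separates)
  fix \<beta>
  have "blinfun_apply \<beta> (br x (sharp r \<alpha>)) = ev r \<alpha> (transpose_map (br x) \<beta>)"
    by (simp flip: sharp_apply add: transpose_map_apply linear_br_right)
  then show "blinfun_apply \<beta> (sharp (adb x r) \<alpha>) = blinfun_apply \<beta> (sharp r (transpose_map (br x) \<alpha>) + br x (sharp r \<alpha>))"
    by (simp add: sharp_apply ev_adb blinfun.add_right)
qed

text \<open>
  Together with the next lemma this computes the derivative of the summands of \<open>jac\<close> along a curve on
  which \<open>r\<close> moves by \<open>\<xi> x + adb x r\<close> and the covectors move by the coadjoint action. Everything that
  contains \<open>adb x\<close> cancels, by the cocycle identity for \<open>\<xi>\<close> and the Jacobi identity.
\<close>

lemma xi_derivation:
  "ev (\<xi> a) \<beta> (- transpose_map (br x) \<gamma>) + ev (\<xi> a) (- transpose_map (br x) \<beta>) \<gamma>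
     + ev (\<xi> (sharp (\<xi> x) \<alpha> + br x a)) \<beta> \<gamma>
   = ev (\<xi> (sharp (\<xi> x) \<alpha>)) \<beta> \<gamma> + blinfun_apply \<beta> (br a (sharp (\<xi> x) \<gamma>)) - blinfun_apply \<gamma> (br a (sharp (\<xi> x) \<beta>))"
  by (simp add: xi_add xi_br ev_adb[of x "\<xi> a"] ev_adb_skew[OF xi_bivector[of x], of a])

lemma br_derivation:
  "blinfun_apply \<alpha> (br b (wc + br x c) + br (wb + br x b) c) + blinfun_apply (- transpose_map (br x) \<alpha>) (br b c)
   = blinfun_apply \<alpha> (br b wc) + blinfun_apply \<alpha> (br wb c)"
proof -
  have "br x (br b c) = br (br x b) c + br b (br x c)"
    using br_jacobi[of x b c] br_swap[of c "br x b"] br_swap[of c x] br_minus_right[of b "br x c"]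
    by (simp add: algebra_simps)
  then show ?thesis
    by (simp add: blinfun.bilinear_simps transpose_map_apply linear_br_right br_add_left br_add_right)
qed

text \<open>
  What remains of the derivative is the co-Jacobi identity for \<open>\<xi> x\<close> plus pairs of terms that cancel
  because the bracket is alternating.
\<close>

lemma jac_curve_constant:
  fixes x g
  defines "T \<equiv> \<lambda>t. transpose_map (AD (ex (t *\<^sub>R (- x))))" and "r \<equiv> \<lambda>t. \<Phi> (ex (t *\<^sub>R x) \<otimes> g)"
  shows "jac (r t) (T t \<alpha>) (T t \<beta>) (T t \<gamma>) = jac (r 0) (T 0 \<alpha>) (T 0 \<beta>) (T 0 \<gamma>)"
proof (rule constant_of_zero_derivative[where f = "\<lambda>t. jac (r t) (T t \<alpha>) (T t \<beta>) (T t \<gamma>)"])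
  fix t
  have T: "((\<lambda>t. T t \<alpha>) has_vector_derivative - transpose_map (br x) (T t \<alpha>)) (at t)" for \<alpha>
  proof (rule has_vector_derivative_dual)
    fix y
    have "((\<lambda>t. blinfun_apply \<alpha> (AD (ex (t *\<^sub>R (- x))) y)) has_vector_derivative
        blinfun_apply \<alpha> (AD (ex (t *\<^sub>R (- x))) (br (- x) y))) (at t)"
      by (rule bounded_linear.has_vector_derivative[OF blinfun.bounded_linear_right AD_derivative(1)])
    then show "((\<lambda>t. blinfun_apply (T t \<alpha>) y) has_vector_derivative
        blinfun_apply (- transpose_map (br x) (T t \<alpha>)) y) (at t)"
      by (simp add: T_def transpose_map_apply linear_AD linear_br_right br_minus_left
          linear_neg[OF linear_AD] blinfun.bilinear_simps)
  qed
  have r: "(r has_vector_derivative \<xi> x + adb x (r t)) (at t)"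
    unfolding r_def by (rule cocycle_left_derivative[OF group_cocycle integrates])
  (* The motion of the covectors is chosen so that a moves by the bracket with x, up to the term
     coming from \<xi> x. *)
  define a where "a \<alpha> t = sharp (r t) (T t \<alpha>)" for \<alpha> t
  have a: "(a \<alpha> has_vector_derivative sharp (\<xi> x) (T t \<alpha>) + br x (a \<alpha> t)) (at t)" for \<alpha>
    using has_vector_derivative_sharp[OF r T] unfolding a_def[abs_def]
    by (simp add: sharp_simps sharp_adb)
  have xi: "((\<lambda>t. \<xi> (a \<alpha> t)) has_vector_derivative \<xi> (sharp (\<xi> x) (T t \<alpha>) + br x (a \<alpha> t))) (at t)" for \<alpha>
    by (rule bounded_linear.has_vector_derivative[OF _ a]) (simp add: linear_xi flip: linear_conv_bounded_linear)
  have P: "((\<lambda>t. ev (\<xi> (a \<alpha> t)) (T t \<beta>) (T t \<gamma>)) has_vector_derivative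
      ev (\<xi> (sharp (\<xi> x) (T t \<alpha>))) (T t \<beta>) (T t \<gamma>) + blinfun_apply (T t \<beta>) (br (a \<alpha> t) (sharp (\<xi> x) (T t \<gamma>)))
      - blinfun_apply (T t \<gamma>) (br (a \<alpha> t) (sharp (\<xi> x) (T t \<beta>)))) (at t)" for \<alpha> \<beta> \<gamma>
    using has_vector_derivative_ev[OF xi T T] unfolding xi_derivation .
  have Q: "((\<lambda>t. blinfun_apply (T t \<alpha>) (br (a \<beta> t) (a \<gamma> t))) has_vector_derivative
      blinfun_apply (T t \<alpha>) (br (a \<beta> t) (sharp (\<xi> x) (T t \<gamma>))) + blinfun_apply (T t \<alpha>) (br (sharp (\<xi> x) (T t \<beta>)) (a \<gamma> t))) (at t)"
    for \<alpha> \<beta> \<gamma>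
    using bounded_bilinear.has_vector_derivative[OF bounded_bilinear_blinfun_apply T
        bounded_bilinear.has_vector_derivative[OF bilinear_conv_bounded_bilinear[THEN iffD1, OF bilinear_br] a a]]
    unfolding br_derivation .
  have sw: "blinfun_apply \<theta> (br (sharp w \<eta>) y) = - blinfun_apply \<theta> (br y (sharp w \<eta>))" for \<theta> \<eta> :: "'b dual" and w y
    using br_swap[of "sharp w \<eta>" y] by (simp add: blinfun.bilinear_simps)
  show "((\<lambda>t. jac (r t) (T t \<alpha>) (T t \<beta>) (T t \<gamma>)) has_vector_derivative 0) (at t)"
    unfolding jac_def a_def[symmetric]
    using has_vector_derivative_add[OF has_vector_derivative_add[OF has_vector_derivative_add[OF
          has_vector_derivative_add[OF has_vector_derivative_add[OF P[of \<alpha> \<beta> \<gamma>] P[of \<beta> \<gamma> \<alpha>]] P[of \<gamma> \<alpha> \<beta>]]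
            Q[of \<alpha> \<beta> \<gamma>]] Q[of \<beta> \<gamma> \<alpha>]] Q[of \<gamma> \<alpha> \<beta>]]
    by (rule has_vector_derivative_eq_rhs)
      (use co_jacobi[of x "T t \<alpha>" "T t \<beta>" "T t \<gamma>"] in \<open>simp add: sw[of _ "\<xi> x"]\<close>)
qed

lemma jac_transport:
  assumes "\<And>\<alpha> \<beta> \<gamma>. jac (\<Phi> g) \<alpha> \<beta> \<gamma> = 0" shows "jac (\<Phi> (ex x \<otimes> g)) \<alpha> \<beta> \<gamma> = 0"
proof -
  have *: "transpose_map (AD (ex (- x))) (transpose_map (AD (ex x)) \<theta>) = \<theta>" for \<theta>
    by (rule blinfun_eqI) (simp add: transpose_map_apply linear_AD ex_minus)
  show ?thesis
    using jac_curve_constant[where t = 1 and x = x and g = g and \<alpha> = "transpose_map (AD (ex x)) \<alpha>"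
        and \<beta> = "transpose_map (AD (ex x)) \<beta>" and \<gamma> = "transpose_map (AD (ex x)) \<gamma>"]
    by (simp add: * assms)
qed

lemma jac_zero: "jac (\<Phi> g) \<alpha> \<beta> \<gamma> = 0"
proof -
  obtain x where g: "g = ex (pn x) \<otimes> (ex (ps x) \<otimes> \<one>)" using surj_pt[of g] by (auto simp: pt_def)
  have "jac (\<Phi> \<one>) \<alpha> \<beta> \<gamma> = 0" for \<alpha> \<beta> \<gamma>
    by (simp add: jac_def group_cocycleD(4)[OF group_cocycle] sharp_simps)
  then show ?thesis unfolding g by (intro jac_transport)
qed

text \<open>
  The bracket of functions that belongs to the right trivialization of \<open>\<Phi>\<close>.
\<close>

definition poi :: "'a \<Rightarrow> ('a \<Rightarrow> real) \<Rightarrow> ('a \<Rightarrow> real) \<Rightarrow> real" where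
  "poi g f h = ev (\<Phi> g) (dR f g) (dR h g)"

lemma right_trivialized_poi: "right_trivialized_field G ex \<Phi> = poi"
  by (intro ext) (simp add: right_trivialized_field_def pushforward_def bivector_at_one_def poi_def dR_def)

lemma Phi_bivector: "\<Phi> g \<in> bivectors"
  by (rule group_cocycleD(2)[OF group_cocycle])

lemma smooth_poi:
  assumes "smooth_fun f" "smooth_fun h" shows "smooth_fun (\<lambda>g. poi g f h)"
  unfolding smooth_function_iff poi_def
proof -
  have "smooth_on UNIV (\<lambda>x. \<Phi> (pt x))"
    using group_cocycleD(1)[OF group_cocycle] by (simp add: smooth_function_iff)
  then have "smooth_on UNIV (\<lambda>x. ev (\<Phi> (pt x)) \<alpha> \<beta>)" for \<alpha> \<beta>
    by (intro smooth_on_linear_compose[of UNIV "\<lambda>r. ev r \<alpha> \<beta>" "\<lambda>x. \<Phi> (pt x)"] open_UNIV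
        bounded_linear_compose[OF blinfun.bounded_linear_left blinfun.bounded_linear_left])
  moreover have "smooth_on UNIV (\<lambda>x. dR f (pt x) i)" "smooth_on UNIV (\<lambda>x. dR h (pt x) i)" for i
    using smooth_dR assms by (auto simp: smooth_function_iff)
  ultimately show "smooth_on UNIV (\<lambda>x. ev (\<Phi> (pt x)) (dR f (pt x)) (dR h (pt x)))"
    by (subst ev_expand) (intro smooth_on_sum smooth_on_mult open_UNIV)
qed

lemma poi_sharp: "poi g f h = dR h g (sharp (\<Phi> g) (dR f g))"
  by (simp add: poi_def sharp_apply)

text \<open>
  The derivative of \<open>dR h\<close> along the right-invariant field of \<open>x\<close>. It is not symmetric in its two
  directions, because right-invariant fields do not commute.
\<close>

definition d2R :: "('a \<Rightarrow> real) \<Rightarrow> 'b \<Rightarrow> 'a \<Rightarrow> 'b dual" where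
  "d2R h x g = (\<Sum>i\<in>Basis. dR (\<lambda>g. dR h g i) g x *\<^sub>R blinfun_inner_left i)"

lemma d2R_apply:
  assumes "smooth_fun h" shows "d2R h x g y = dR (\<lambda>g. dR h g y) g x"
  unfolding dR_dR_expand[OF assms, of y]
  by (simp add: d2R_def blinfun.sum_left blinfun.scaleR_left blinfun_inner_left.rep_eq mult.commute)

lemma dR_poi:
  assumes "smooth_fun h" "smooth_fun k"
  shows "dR (\<lambda>g. poi g h k) g x = ev (\<Phi> g) (dR h g) (d2R k x g) + ev (\<Phi> g) (d2R h x g) (dR k g)
    + ev (\<xi> x + adb x (\<Phi> g)) (dR h g) (dR k g)"
proof -
  have d: "((\<lambda>t. dR h (ex (t *\<^sub>R x) \<otimes> g)) has_vector_derivative d2R h x g) (at 0)" if "smooth_fun h" for h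
    by (rule has_vector_derivative_dual, unfold d2R_apply[OF that], rule dR_along_0[OF smooth_dR[OF that]])
  have "((\<lambda>t. poi (ex (t *\<^sub>R x) \<otimes> g) h k) has_vector_derivative ev (\<Phi> g) (dR h g) (d2R k x g)
     + ev (\<Phi> g) (d2R h x g) (dR k g) + ev (\<xi> x + adb x (\<Phi> g)) (dR h g) (dR k g)) (at 0)"
    using has_vector_derivative_ev[OF cocycle_left_derivative[OF group_cocycle integrates, of x g 0]
        d[OF assms(1)] d[OF assms(2)]] by (simp add: poi_def)
  then show ?thesis
    using vector_derivative_unique_at dR_along_0[OF smooth_poi[OF assms]] by blast
qed

text \<open>
  Expanding the double brackets, the second derivatives of \<open>f\<close>, \<open>h\<close>, \<open>k\<close> occur only in antisymmetrized form.
  The commutation relation of the right-invariant fields turns them into brackets in the Lie algebra,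
  and the sum becomes \<open>jac\<close>.
\<close>

lemma poi_jacobi:
  assumes f: "smooth_fun f" and h: "smooth_fun h" and k: "smooth_fun k"
  shows "poi g f (\<lambda>x. poi x h k) + poi g h (\<lambda>x. poi x k f) + poi g k (\<lambda>x. poi x f h) = 0"
proof -
  let ?r = "\<Phi> g" and ?\<alpha> = "dR f g" and ?\<beta> = "dR h g" and ?\<gamma> = "dR k g"
  let ?a = "sharp ?r ?\<alpha>" and ?b = "sharp ?r ?\<beta>" and ?c = "sharp ?r ?\<gamma>"
  have one: "poi g f (\<lambda>x. poi x h k) = ev (\<xi> (sharp ?r (dR f g))) (dR h g) (dR k g)
      - dR h g (br (sharp ?r (dR f g)) (sharp ?r (dR k g))) + dR k g (br (sharp ?r (dR f g)) (sharp ?r (dR h g)))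
      - d2R h (sharp ?r (dR f g)) g (sharp ?r (dR k g)) + d2R k (sharp ?r (dR f g)) g (sharp ?r (dR h g))"
    if "smooth_fun h" "smooth_fun k" for f h k
    unfolding poi_sharp[of g f] dR_poi[OF that] bivectors_skew[OF Phi_bivector, of _ "d2R _ _ _" "dR k g"]
      ev_simps(1) ev_adb_skew[OF Phi_bivector]
    by (simp add: sharp_apply)
  have com: "d2R f y g x = dR f g (br x y) + d2R f x g y" if "smooth_fun f" for f x y
    using dR_commutator[OF that, of x g y] by (simp add: d2R_apply[OF that])
  have sw: "dR f g (br x y) = - dR f g (br y x)" for f x y
    using br_swap[of x y] by (simp add: blinfun.bilinear_simps)
  have "poi g f (\<lambda>x. poi x h k) + poi g h (\<lambda>x. poi x k f) + poi g k (\<lambda>x. poi x f h) = jac ?r ?\<alpha> ?\<beta> ?\<gamma>"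
    unfolding one[OF h k] one[OF k f] one[OF f h] jac_def
    using com[OF h, of ?c ?a] com[OF k, of ?a ?b] com[OF f, of ?b ?c]
      sw[of h ?a ?c] sw[of k ?b ?a] sw[of f ?c ?b] by linarith
  then show ?thesis by (simp add: jac_zero)
qed

lemma poisson_tensor_poi:
  assumes "same_bivector_field A \<pi> poi" shows "poisson_tensor A \<pi>"
  unfolding poisson_tensor_def bivector_field_def smooth_functions_def mem_Collect_eq
proof (intro conjI ballI allI; (unfold mem_Collect_eq)?)
  have eq: "\<pi> g f h = poi g f h" if "smooth_fun f" "smooth_fun h" for g f h
    using assms that unfolding same_bivector_field_def smooth_functions_def by blast
  have eqf: "(\<lambda>g. \<pi> g f h) = (\<lambda>g. poi g f h)" if "smooth_fun f" "smooth_fun h" for f h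
    using eq[OF that] by (rule ext)
  fix f h k :: "'a \<Rightarrow> real" and g a b
  assume f: "smooth_fun f" and h: "smooth_fun h"
  show "smooth_fun (\<lambda>g. \<pi> g f h)" unfolding eqf[OF f h] by (rule smooth_poi[OF f h])
  show "\<pi> g f h = - \<pi> g h f" unfolding eq[OF f h] eq[OF h f] poi_def by (rule bivectors_skew[OF Phi_bivector])
  assume k: "smooth_fun k"
  show "\<pi> g (\<lambda>x. a * f x + b * h x) k = a * \<pi> g f k + b * \<pi> g h k"
    unfolding eq[OF smooth_fun_combination(1)[OF f h] k] eq[OF f k] eq[OF h k]
    by (simp add: poi_def dR_combination[OF f h])
  show "\<pi> g (\<lambda>x. f x * h x) k = f g * \<pi> g h k + h g * \<pi> g f k"
    unfolding eq[OF smooth_fun_combination(2)[OF f h] k] eq[OF f k] eq[OF h k]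
    by (simp add: poi_def dR_combination[OF f h])
  show "\<pi> g f (\<lambda>x. \<pi> x h k) + \<pi> g h (\<lambda>x. \<pi> x k f) + \<pi> g k (\<lambda>x. \<pi> x f h) = 0"
    unfolding eqf[OF h k] eqf[OF k f] eqf[OF f h]
      eq[OF f smooth_poi[OF h k]] eq[OF h smooth_poi[OF k f]] eq[OF k smooth_poi[OF f h]]
    by (rule poi_jacobi[OF f h k])
qed

end

context lie_group_split
begin

text \<open>
  Left translation by \<open>g\<close> is conjugation by \<open>g\<close> followed by right translation.
\<close>

lemma dR_left:
  assumes "smooth_fun f"
  shows "Blinfun (diff_id ex (f \<circ> (\<lambda>x. g \<otimes> x))) = transpose_map (AD g) (dR f g)"
proof (rule blinfun_eqI)
  fix x
  have K: "smooth_map vector_atlas A (\<lambda>x. g \<otimes> ex x \<otimes> inv g)"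
    by (intro smooth_conj vector_atlas_open smooth_ex)
  have "((\<lambda>y. f (g \<otimes> ex y \<otimes> inv g \<otimes> g)) has_derivative (\<lambda>h. dR f g (tangent (\<lambda>x. g \<otimes> ex x \<otimes> inv g) 0 h))) (at 0)"
    by (rule derivative_via_tangent[OF K _ dR_derivative[OF assms]]) simp
  then have d: "((\<lambda>y. (f \<circ> (\<lambda>x. g \<otimes> x)) (ex y)) has_derivative (\<lambda>h. dR f g (AD g h))) (at 0)"
    by (simp add: AD_eq_tangent)
  have "diff_id ex (f \<circ> (\<lambda>x. g \<otimes> x)) = (\<lambda>h. dR f g (AD g h))"
    by (rule has_derivative_unique[OF diff_id_derivative[OF smooth_fun_left[OF assms, of g]] d])
  then show "blinfun_apply (Blinfun (diff_id ex (f \<circ> (\<lambda>x. g \<otimes> x)))) x = blinfun_apply (transpose_map (AD g) (dR f g)) x"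
    unfolding Blinfun_diff_id[OF smooth_fun_left[OF assms]] by (simp add: transpose_map_apply linear_AD)
qed

lemma left_invariant_eq:
  assumes "smooth_fun f" "smooth_fun h"
  shows "left_invariant_field G ex r g f h = ev (ADB g r) (dR f g) (dR h g)"
    "right_invariant_field G ex r g f h = ev r (dR f g) (dR h g)"
  by (simp_all add: left_invariant_field_def right_invariant_field_def pushforward_def bivector_at_one_def
      dR_left assms ext_mult_apply linear_AD flip: dR_def)

end

context lie_group_bialgebra
begin

lemma multiplicative_poi:
  assumes "same_bivector_field A \<pi> poi" shows "multiplicative G A \<pi>"
  unfolding multiplicative_def smooth_functions_def
proof (intro allI ballI; (unfold mem_Collect_eq)?)
  have eq: "\<pi> g f h = poi g f h" if "smooth_fun f" "smooth_fun h" for g f h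
    using assms that unfolding same_bivector_field_def smooth_functions_def by blast
  fix a b f h assume f: "smooth_fun f" and h: "smooth_fun h"
  have left: "dR (f \<circ> (\<lambda>x. a \<otimes> x)) b = transpose_map (AD a) (dR f (a \<otimes> b))" if f: "smooth_fun f" for f
  proof -
    have "(f \<circ> (\<lambda>x. a \<otimes> x)) \<circ> (\<lambda>x. x \<otimes> b) = (f \<circ> (\<lambda>x. x \<otimes> b)) \<circ> (\<lambda>x. a \<otimes> x)" by (simp add: comp_def)
    then have "dR (f \<circ> (\<lambda>x. a \<otimes> x)) b = transpose_map (AD a) (dR (f \<circ> (\<lambda>x. x \<otimes> b)) a)"
      unfolding dR_def[of "f \<circ> (\<lambda>x. a \<otimes> x)"] by (simp add: dR_left smooth_fun_right[OF f])
    then show ?thesis by (simp add: dR_def comp_def)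
  qed
  have right: "dR (f \<circ> (\<lambda>x. x \<otimes> b)) a = dR f (a \<otimes> b)" for f
    by (simp add: dR_def comp_def)
  show "\<pi> (a \<otimes> b) f h = pushforward (\<lambda>x. a \<otimes> x) (\<pi> b) f h + pushforward (\<lambda>x. x \<otimes> b) (\<pi> a) f h"
    unfolding pushforward_def eq[OF f h] eq[OF smooth_fun_left[OF f] smooth_fun_left[OF h]]
      eq[OF smooth_fun_right[OF f] smooth_fun_right[OF h]]
    by (simp add: poi_def left right f h group_cocycleD(3)[OF group_cocycle] ext_mult_apply linear_AD)
qed

lemma corresponding_poisson_tensor_iff:
  "corresponding_poisson_tensor G A ex \<xi> \<pi> \<longleftrightarrow> same_bivector_field A \<pi> poi"
proof
  assume "corresponding_poisson_tensor G A ex \<xi> \<pi>"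
  then obtain \<Psi> where \<Psi>: "group_cocycle G A ex \<Psi>" "integrates ex \<Psi> \<xi>"
      "same_bivector_field A \<pi> (right_trivialized_field G ex \<Psi>)"
    by (auto simp: corresponding_poisson_tensor_def)
  have "\<Psi> = \<Phi>" by (rule cocycle_unique[OF \<Psi>(1,2) group_cocycle integrates])
  then show "same_bivector_field A \<pi> poi" using \<Psi>(3) by (simp add: right_trivialized_poi)
next
  assume same: "same_bivector_field A \<pi> poi"
  show "corresponding_poisson_tensor G A ex \<xi> \<pi>"
    unfolding corresponding_poisson_tensor_def
    by (intro conjI poisson_tensor_poi[OF same] multiplicative_poi[OF same] exI[of _ \<Phi>] group_cocycle integrates)
      (simp add: right_trivialized_poi same)
qed

end

section \<open>The semidirect product decomposition\<close>

context lie_group_split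
begin

lemma pt_ps: "pt (ps x) = ex (ps x)" and pt_pn: "pt (pn x) = ex (pn x)"
  by (simp_all add: pt_def)

lemma inj_on_ps: "inj_on ex (range ps)" and inj_on_pn: "inj_on ex (range pn)"
  using inj_pt by (auto simp: inj_on_def simp flip: pt_ps pt_pn)

lemma ps_AD_pt: "ps (AD (pt x) y) = ps y"
  by (simp add: pt_def AD_mult)

lemma semidirect: "internal_semidirect G (ex ` range ps) (ex ` range pn)"
proof -
  have sub: "subgroup (ex ` range q) G" if q: "linear q" "\<And>x y. ex (q x) \<otimes> ex (q y) = ex (q x + q y)" for q
  proof (rule subgroup.intro)
    show "x \<otimes> y \<in> ex ` range q" if "x \<in> ex ` range q" "y \<in> ex ` range q" for x y
      using that by (auto simp: q(2) simp flip: linear_add[OF q(1)])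
    show "\<one> \<in> ex ` range q" using imageI[OF rangeI[of q 0], of ex] by (simp add: linear_0[OF q(1)])
    show "inv x \<in> ex ` range q" if "x \<in> ex ` range q" for x
      using that by (auto simp flip: ex_minus linear_neg[OF q(1)])
  qed simp
  have "ex ` range pn \<lhd> G"
    unfolding normal_inv_iff
  proof (intro conjI ballI)
    show "subgroup (ex ` range pn) G" by (rule sub[OF linear_pn ex_pn_add])
    fix g h assume "h \<in> ex ` range pn"
    then obtain y where h: "h = ex (pn y)" by blast
    obtain x where g: "g = pt x" using surj_pt by blast
    have "AD g (pn y) = pn (AD g (pn y))" 
      using pn_eq[of "AD (pt x) (pn y)"] by (simp add: g ps_AD_pt)
    then show "g \<otimes> h \<otimes> inv g \<in> ex ` range pn" unfolding h conj_ex by (metis imageI rangeI)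
  qed
  moreover have "ex ` range ps \<inter> ex ` range pn = {\<one>}"
  proof (intro equalityI subsetI)
    fix g assume "g \<in> ex ` range ps \<inter> ex ` range pn"
    then obtain x y where "g = ex (ps x)" "g = ex (pn y)" by blast
    then have g: "g = pt (ps x)" and "pt (ps x) = pt (pn y)" unfolding pt_ps pt_pn by simp_all
    then have "ps x = pn y" by simp
    then have "ps (ps x) = ps (pn y)" by (rule arg_cong)
    then show "g \<in> {\<one>}" unfolding g by simp
  next
    fix g assume g: "g \<in> {\<one>}"
    show "g \<in> ex ` range ps \<inter> ex ` range pn"
      using imageI[OF rangeI[of ps 0], of ex] imageI[OF rangeI[of pn 0], of ex] g by simp
  qed
  moreover have "g \<in> ex ` range ps <#> ex ` range pn" for g
  proof -
    obtain x where g: "g = pt x" using surj_pt by blast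
    let ?w = "AD (inv (ex (ps x))) (pn x)"
    have w: "pn ?w = ?w" using pn_AD_ex[of "- ps x" x] by (simp add: ex_minus)
    have "ex ?w = inv (ex (ps x)) \<otimes> ex (pn x) \<otimes> ex (ps x)"
      using conj_ex[of "inv (ex (ps x))" "pn x"] by simp
    then have "g = ex (ps x) \<otimes> ex (pn ?w)" unfolding w by (simp add: g pt_def)
    then show ?thesis unfolding set_mult_def by blast
  qed
  ultimately show ?thesis
    using sub[OF linear_ps ex_ps_add] by (auto simp: internal_semidirect_def)
qed

lemma cocycle_determined_by_factors:
  assumes "group_cocycle G A ex \<Phi>" "group_cocycle G A ex \<Psi>"
    and "\<And>g. g \<in> ex ` range ps \<union> ex ` range pn \<Longrightarrow> \<Phi> g = \<Psi> g"
  shows "\<Phi> = \<Psi>"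
proof
  fix g
  obtain x where g: "g = pt x" using surj_pt by blast
  show "\<Phi> g = \<Psi> g"
    unfolding g pt_def group_cocycleD(3)[OF assms(1)] group_cocycleD(3)[OF assms(2)]
    using assms(3) by simp
qed

lemma group_cocycle_add:
  assumes "group_cocycle G A ex \<Phi>" "integrates ex \<Phi> \<xi>" "group_cocycle G A ex \<Psi>" "integrates ex \<Psi> \<eta>"
  shows "group_cocycle G A ex (\<lambda>g. \<Phi> g + \<Psi> g)" "integrates ex (\<lambda>g. \<Phi> g + \<Psi> g) (\<lambda>x. \<xi> x + \<eta> x)"
proof -
  note \<Phi> = group_cocycleD[OF assms(1)] and \<Psi> = group_cocycleD[OF assms(3)]
  have "smooth_map A vector_atlas (\<lambda>g. \<Phi> g + \<Psi> g)"
    using \<Phi>(1) \<Psi>(1) unfolding smooth_function_iff by (rule smooth_on_add[OF open_UNIV])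
  then show "group_cocycle G A ex (\<lambda>g. \<Phi> g + \<Psi> g)"
    using \<Phi>(2) \<Psi>(2) by (auto simp: group_cocycle_def \<Phi>(3) \<Psi>(3) bivectors_arith linear_add[OF linear_ADB])
  show "integrates ex (\<lambda>g. \<Phi> g + \<Psi> g) (\<lambda>x. \<xi> x + \<eta> x)"
    using has_derivative_add assms(2,4) unfolding integrates_def comp_def by blast
qed

lemma right_trivialized_eq: "right_trivialized_field G ex \<Phi> g f h = ev (\<Phi> g) (dR f g) (dR h g)"
  by (simp add: right_trivialized_field_def pushforward_def bivector_at_one_def dR_def)

lemma invariant_plus_right_trivialized:
  assumes "smooth_fun f" "smooth_fun h"
  shows "left_invariant_field G ex r g f h - right_invariant_field G ex r g f h + right_trivialized_field G ex \<Phi> g f h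
    = right_trivialized_field G ex (\<lambda>g. (ADB g r - r) + \<Phi> g) g f h"
  by (simp add: left_invariant_eq[OF assms] right_trivialized_eq)

end

context lie_group_cocycle
begin

lemma corresponding_poisson_tensor_decomposition:
  assumes r: "r \<in> bivectors" and \<xi>: "lie_bialgebra br (\<lambda>x. adb x r + R x)"
  shows "corresponding_poisson_tensor G A ex (\<lambda>x. adb x r + R x) \<pi> \<longleftrightarrow>
    same_bivector_field A \<pi> (\<lambda>g f h. left_invariant_field G ex r g f h - right_invariant_field G ex r g f h
      + right_trivialized_field G ex PhiR g f h)"
proof -
  let ?\<Phi> = "\<lambda>g. (ADB g r - r) + PhiR g"
  interpret b: lie_group_bialgebra G A ex br V W lg ps pn ?\<Phi> "\<lambda>x. adb x r + R x"
    by unfold_locales (rule group_cocycle_add[OF coboundary_cocycle[OF r] PhiR_cocycle PhiR_integrates] \<xi>)+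
  show ?thesis
    unfolding b.corresponding_poisson_tensor_iff b.right_trivialized_poi[symmetric]
    by (auto simp: same_bivector_field_def smooth_functions_def invariant_plus_right_trivialized)
qed

end

section \<open>Flat metric Lie algebras\<close>

text \<open>
  The component in \<open>s\<close> is chosen by \<open>SOME\<close>; its uniqueness makes the choice linear.
\<close>

lemma complementary_projection:
  fixes s n :: "'a::real_vector set"
  assumes s: "subspace s" and n: "subspace n" and sum: "\<And>x. \<exists>a\<in>s. x - a \<in> n" and int: "s \<inter> n = {0}"
  obtains q where "linear q" "range q = s" "\<And>x. q x = 0 \<longleftrightarrow> x \<in> n" "\<And>x. q (q x) = q x"
proof -
  define q where "q x = (SOME a. a \<in> s \<and> x - a \<in> n)" for x
  have q: "q x \<in> s" "x - q x \<in> n" for x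
    using someI_ex[of "\<lambda>a. a \<in> s \<and> x - a \<in> n"] sum[of x] unfolding q_def by blast+
  have uniq: "q x = a" if a: "a \<in> s" "x - a \<in> n" for x a
  proof -
    have "q x - a \<in> s" using subspace_diff[OF s q(1) a(1)] .
    moreover have "q x - a \<in> n" using subspace_diff[OF n a(2) q(2)[of x]] by simp
    ultimately have "q x - a \<in> s \<inter> n" by (rule IntI)
    then show ?thesis unfolding int by simp
  qed
  have id: "q x = x" if "x \<in> s" for x by (rule uniq) (use that subspace_0[OF n] in auto)
  show ?thesis
  proof
    show "linear q"
    proof
      show "q (x + y) = q x + q y" for x y
        by (rule uniq) (use subspace_add[OF s q(1) q(1)] subspace_add[OF n q(2)[of x] q(2)[of y]]
            in \<open>auto simp: algebra_simps\<close>)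
      show "q (c *\<^sub>R x) = c *\<^sub>R q x" for c x
        by (rule uniq) (use subspace_scale[OF s q(1)] subspace_scale[OF n q(2)[of x], of c]
            in \<open>auto simp: algebra_simps\<close>)
    qed
    show "range q = s" using q(1) id by (metis (full_types) rangeI subsetI subset_antisym image_subsetI)
    show "q x = 0 \<longleftrightarrow> x \<in> n" for x
      using q(2)[of x] uniq[of 0 x] subspace_0[OF s] by auto
    show "q (q x) = q x" for x using id q(1) by blast
  qed
qed

lemma subspace_lie_center: "bilinear br \<Longrightarrow> subspace (lie_center br)"
  by (auto simp: subspace_def lie_center_def bilinear_lzero bilinear_ladd bilinear_lmul)

lemma lie_algebra_swap: "lie_algebra br \<Longrightarrow> br x y = - br y x"
proof -
  assume l: "lie_algebra br"
  then have b: "bilinear br" and z: "\<And>x. br x x = 0" by (auto simp: lie_algebra_def)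
  have "br x y + br y x = br (x + y) (x + y)" unfolding bilinear_ladd[OF b] bilinear_radd[OF b] by (simp add: z)
  then show ?thesis by (simp add: z eq_neg_iff_add_eq_0)
qed

lemma wedge_0 [simp]: "wedge 0 y = 0" "wedge x 0 = 0"
  by (rule bilin_eqI; simp add: wedge_apply)+

theorem theorem7p2:
  fixes br :: "'a::euclidean_space \<Rightarrow> 'a \<Rightarrow> 'a"
    and s :: "'a set" and m :: nat and P :: "nat \<Rightarrow> 'a set"
    and lam :: "nat \<Rightarrow> 'a \<Rightarrow> real" and J :: "nat \<Rightarrow> 'a \<Rightarrow> 'a"
    and G :: "('g::{t2_space,second_countable_topology}) monoid"
    and A :: "('g, 'a) chart set" and ex :: "'a \<Rightarrow> 'g"
    and R :: "'a \<Rightarrow> 'a bilin"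
    and n :: "'a set" and S N :: "'g set"
  defines "n \<equiv> subspace_sum (lie_center br) (derived_algebra br)"
    and "S \<equiv> ex ` s" and "N \<equiv> ex ` n"
  assumes flat: "flat_metric_lie_algebra br"
    and decomposition: "milnor_decomposition br s m P lam J"
    and nondeg: "nondegenerate s m lam"
    and group: "lie_group_with_algebra G A ex br"
    and simply_conn: "simply_connected (UNIV :: 'g set)"
    and R: "normalized_cocycle br s m P R"
  shows "internal_semidirect G S N \<and> inj_on ex s \<and> inj_on ex n \<and>
    (\<exists>\<Phi>\<^sub>R.
      (\<forall>\<Phi>. group_cocycle G A ex \<Phi> \<and> integrates ex \<Phi> R \<longleftrightarrow> \<Phi> = \<Phi>\<^sub>R) \<and>
      (\<forall>\<Phi>. group_cocycle G A ex \<Phi> \<and> (\<forall>g \<in> S \<union> N. \<Phi> g = \<Phi>\<^sub>R g) \<longrightarrow> \<Phi> = \<Phi>\<^sub>R) \<and>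
      (\<forall>g\<in>S. \<Phi>\<^sub>R g = R (the_inv_into s ex g)) \<and>
      (\<forall>u\<in>n. \<Phi>\<^sub>R (ex u) = R u + (1/2) *\<^sub>R ad_biv br u (R u)) \<and>
      (\<forall>g\<in>S. \<forall>u\<in>n. \<Phi>\<^sub>R (g \<otimes>\<^bsub>G\<^esub> ex u) =
         R (the_inv_into s ex g) + ext_mult (Ad G A ex g) (R u + (1/2) *\<^sub>R ad_biv br u (R u))) \<and>
      (\<forall>r\<in>bivectors. \<forall>\<xi>. \<xi> = (\<lambda>x. ad_biv br x r + R x) \<and> lie_bialgebra br \<xi> \<longrightarrow>
         (let \<pi>\<^sub>r = (\<lambda>g f h. left_invariant_field G ex r g f h - right_invariant_field G ex r g f h);
              \<pi>\<^sub>R = right_trivialized_field G ex \<Phi>\<^sub>R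
          in \<forall>\<pi>. corresponding_poisson_tensor G A ex \<xi> \<pi> \<longleftrightarrow>
               same_bivector_field A \<pi> (\<lambda>g f h. \<pi>\<^sub>r g f h + \<pi>\<^sub>R g f h))))"
proof -
  let ?z = "lie_center br" and ?u = "derived_algebra br"
  have lie: "lie_algebra br" using flat by (simp add: flat_metric_lie_algebra_def)
  then have bil: "bilinear br" by (simp add: lie_algebra_def)
  have dec: "subspace s" "\<forall>x\<in>s. \<forall>y\<in>s. br x y = 0" "\<forall>x\<in>s. \<forall>y\<in>?z. x \<bullet> y = 0" "\<forall>x\<in>s. \<forall>y\<in>?u. x \<bullet> y = 0"
      "subspace_sum (subspace_sum s ?z) ?u = UNIV" "\<forall>x\<in>?u. \<forall>y\<in>?u. br x y = 0" "?u = span (\<Union>l<m. P l)"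
    using decomposition unfolding milnor_decomposition_def Let_def by - (elim conjE, assumption)+
  have s: "subspace s" "\<And>x y. x \<in> s \<Longrightarrow> y \<in> s \<Longrightarrow> br x y = 0" using dec(1,2) by auto
  have u: "subspace ?u" "\<And>x y. br x y \<in> ?u" "\<And>x y. x \<in> ?u \<Longrightarrow> y \<in> ?u \<Longrightarrow> br x y = 0"
      "?u = span (\<Union>l<m. P l)"
  proof -
    show "subspace ?u" by (simp add: derived_algebra_def)
    show "br x y \<in> ?u" for x y unfolding derived_algebra_def by (rule span_base) blast
  qed (use dec(6,7) in auto)
  have z: "subspace ?z" "\<And>x y. x \<in> ?z \<Longrightarrow> br x y = 0" 
    using subspace_lie_center[OF bil] by (auto simp: lie_center_def)
  have z': "br x y = 0" if "y \<in> ?z" for x y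
    using lie_algebra_swap[OF lie, of x y] z(2)[OF that] by simp
  have n: "subspace n" unfolding n_def subspace_sum_def by (rule subspace_sums[OF z(1) u(1)])
  have un: "?u \<subseteq> n"
    using subspace_0[OF z(1)] unfolding n_def subspace_sum_def by (force intro: exI[of _ 0])
  have n_abelian: "br x y = 0" if "x \<in> n" "y \<in> n" for x y
    using that z(2) z' u(3) by (auto simp: n_def subspace_sum_def bilinear_ladd[OF bil] bilinear_radd[OF bil])
  have ortho: "a \<bullet> x = 0" if "a \<in> s" "x \<in> n" for a x
    using that dec(3,4) by (auto simp: n_def subspace_sum_def inner_add_right)
  have total: "\<exists>a\<in>s. x - a \<in> n" for x
  proof -
    have "x \<in> subspace_sum (subspace_sum s ?z) ?u" using dec(5) by simp
    then obtain a c d where "a \<in> s" "c \<in> ?z" "d \<in> ?u" "x = a + c + d"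
      unfolding subspace_sum_def by blast
    then have "a \<in> s" "x - a \<in> n" unfolding n_def subspace_sum_def by auto
    then show ?thesis by blast
  qed
  have "x = 0" if "x \<in> s" "x \<in> n" for x using ortho[OF that] by simp
  then have "s \<inter> n = {0}" using subspace_0[OF s(1)] subspace_0[OF n] by blast
  then obtain ps where ps: "linear ps" "range ps = s" "\<And>x. ps x = 0 \<longleftrightarrow> x \<in> n" "\<And>x. ps (ps x) = ps x"
    using complementary_projection[OF s(1) n total] by metis
  define pn where "pn x = x - ps x" for x
  have pn: "linear pn" "\<And>x. pn x \<in> n" "range pn = n"
  proof -
    show "linear pn" unfolding pn_def[abs_def] by (intro linear_compose_sub linear_ident ps(1))
    show pn: "pn x \<in> n" for x using ps(4) by (simp add: pn_def linear_diff[OF ps(1)] flip: ps(3))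
    have "x = pn x" if "x \<in> n" for x using that by (simp add: pn_def flip: ps(3))
    then show "range pn = n" using pn by (metis image_subsetI rangeI subsetI subset_antisym)
  qed
  have R_coc: "cocycle br R" and R_inv: "R ` subspace_sum s ?z \<subseteq> invariant_bivectors br"
    and R_P: "\<And>l. l < m \<Longrightarrow> R ` P l \<subseteq> subspace_sum (wedge_space s (P l)) (wedge_space ?z (P l))"
    using R by (auto simp: normalized_cocycle_def)
  have lin_R: "linear R" using R_coc by (simp add: cocycle_def)
  have lin_br: "linear (br x)" for x using bil by (simp add: bilinear_def)
  have inv: "ad_biv br x (R y) = 0" if "y \<in> s \<or> y \<in> ?z" for x y
  proof -
    have "y \<in> subspace_sum s ?z"
      using that subspace_0[OF s(1)] subspace_0[OF z(1)] unfolding subspace_sum_def by (force intro: exI[of _ 0])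
    then show ?thesis using R_inv by (auto simp: invariant_bivectors_def)
  qed
  have nil: "ad_biv br x (ad_biv br y (R w)) = 0" if x: "x \<in> n" and y: "y \<in> n" and w: "w \<in> n" for x y w
  proof -
    let ?D = "\<lambda>r. ad_biv br x (ad_biv br y r)"
    have lin: "linear ?D"
      using linear_compose[OF linear_ext_deriv[OF lin_br] linear_ext_deriv[OF lin_br]] by (simp add: comp_def)
    (* A bivector v \<and> p with p in the abelian ideal is mapped to [y, v] \<and> p, where [y, v] is in
       the ideal as well, and then to zero. *)
    have wedge0: "?D r = 0" if "r \<in> wedge_space V' (P l)" "l < m" for r V' l
    proof -
      have "wedge_space V' (P l) \<subseteq> {r. ?D r = 0}"
        unfolding wedge_space_def
      proof (rule span_minimal)
        show "subspace {r. ?D r = 0}" using linear_subspace_kernel[OF lin] .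
        have "?D (wedge v p) = 0" if "p \<in> P l" for v p
        proof -
          have p: "p \<in> n" using that \<open>l < m\<close> un u(4) by (auto intro: span_base)
          have "br y v \<in> n" using u(2) un by blast
          then show ?thesis
            by (simp add: ext_deriv_wedge lin_br n_abelian[OF x p] n_abelian[OF y p] n_abelian[OF x] linear_0[OF lin_br])
        qed
        then show "{wedge v p |v p. v \<in> V' \<and> p \<in> P l} \<subseteq> {r. ?D r = 0}" by auto
      qed
      then show ?thesis using that(1) by blast
    qed
    obtain c d where cd: "c \<in> ?z" "d \<in> ?u" "w = c + d" using w by (auto simp: n_def subspace_sum_def)
    have "?u \<subseteq> {v. ?D (R v) = 0}"
      unfolding u(4)
    proof (rule span_minimal)
      show "subspace {v. ?D (R v) = 0}"
        using linear_subspace_kernel[OF linear_compose[OF lin_R lin]] by (simp add: comp_def)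
      show "(\<Union>l<m. P l) \<subseteq> {v. ?D (R v) = 0}"
      proof
        fix v assume "v \<in> (\<Union>l<m. P l)"
        then obtain l where l: "l < m" "v \<in> P l" by blast
        then have "R v \<in> subspace_sum (wedge_space s (P l)) (wedge_space ?z (P l))" using R_P by blast
        then obtain r1 r2 where "r1 \<in> wedge_space s (P l)" "r2 \<in> wedge_space ?z (P l)" "R v = r1 + r2"
          unfolding subspace_sum_def by blast
        then show "v \<in> {v. ?D (R v) = 0}" using wedge0[OF _ l(1)] by (simp add: linear_add[OF lin])
      qed
    qed
    then have "?D (R d) = 0" using cd(2) by blast
    moreover have "?D (R c) = 0" using inv[of c] cd(1) by (simp add: linear_0[OF linear_ext_deriv[OF lin_br]])
    ultimately show ?thesis by (simp add: cd(3) linear_add[OF lin_R] linear_add[OF lin])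
  qed
  (* The complement is s and the ideal is n; orthogonality makes their sum direct. *)
  interpret lie_group_algebra G A ex br by unfold_locales (rule group lie)+
  obtain V W lg where log: "inverse_chart ex V W lg" by (rule log_chart_exists)
  interpret lie_group_cocycle G A ex br V W lg ps pn R
  proof unfold_locales
    show "ps (br x y) = 0" for x y using ps(3) u(2) un by blast
    show "br (ps x) (ps y) = 0" for x y using s(2) ps(2) by blast
    show "br (pn x) (pn y) = 0" for x y using n_abelian pn(2) by blast
    show "ad_biv br x (R (ps y)) = 0" for x y using inv ps(2) by blast
    show "ad_biv br (pn x) (ad_biv br (pn y) (R (pn z))) = 0" for x y z using nil pn(2) by blast
  qed (use log ps(4) simply_conn R_coc in
      \<open>simp_all add: pn_def linear_add[OF ps(1)] linear_scale[OF ps(1)] algebra_simps\<close>)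
  have SN: "S = ex ` range ps" "N = ex ` range pn" by (simp_all add: S_def N_def ps(2) pn(3))
  have inj_s: "inj_on ex s" using inj_on_ps by (simp add: ps(2))
  have inj_n: "inj_on ex n" using inj_on_pn by (simp add: pn(3))
  have log_s: "the_inv_into s ex (ex a) = a" if "a \<in> s" for a using the_inv_into_f_f[OF inj_s that] .
  have PhiS: "PhiR (ex a) = R a" if a: "a \<in> s" for a
  proof -
    obtain x where "a = ps x" using a ps(2) by blast
    then show ?thesis by (simp add: PhiR_ex_ps)
  qed
  have PhiN: "PhiR (ex v) = R v + (1/2) *\<^sub>R ad_biv br v (R v)" if v: "v \<in> n" for v
  proof -
    obtain x where "v = pn x" using v pn(3) by blast
    then show ?thesis by (simp add: PhiR_ex_pn PhiN_def)
  qed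
  show ?thesis
  proof (intro conjI exI[of _ PhiR])
    show "internal_semidirect G S N" unfolding SN by (rule semidirect)
    show "inj_on ex s" "inj_on ex n" by (rule inj_s inj_n)+
    show "\<forall>\<Phi>. group_cocycle G A ex \<Phi> \<and> integrates ex \<Phi> R \<longleftrightarrow> \<Phi> = PhiR"
      using PhiR_cocycle PhiR_integrates cocycle_unique by blast
    show "\<forall>\<Phi>. group_cocycle G A ex \<Phi> \<and> (\<forall>g\<in>S \<union> N. \<Phi> g = PhiR g) \<longrightarrow> \<Phi> = PhiR"
      unfolding SN using cocycle_determined_by_factors[OF _ PhiR_cocycle] by blast
    show "\<forall>g\<in>S. PhiR g = R (the_inv_into s ex g)" by (auto simp: S_def log_s PhiS)
    show "\<forall>u\<in>n. PhiR (ex u) = R u + (1/2) *\<^sub>R ad_biv br u (R u)" using PhiN by blast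
    show "\<forall>g\<in>S. \<forall>u\<in>n. PhiR (g \<otimes>\<^bsub>G\<^esub> ex u) =
        R (the_inv_into s ex g) + ext_mult (Ad G A ex g) (R u + (1/2) *\<^sub>R ad_biv br u (R u))"
      by (auto simp: S_def log_s PhiS PhiN PhiR_mult)
  qed (use corresponding_poisson_tensor_decomposition in \<open>unfold Let_def, blast\<close>)
qed

end
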